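(* Let $\mathbb K$ be a field, let $d$ be a nonnegative integer and let $A,A^*$ be matrices in $\mathrm{Mat}_{d+1}(\mathbb K)$. Assume $A$ is tridiagonal and $A^*$ is diagonal. Then the following (i), (ii) are equivalent. (i) The pair $A,A^*$ is a Leonard pair in $\mathrm{Mat}_{d+1}(\mathbb K)$. (ii) There exists a parameter array $(\theta_i,\theta^*_i,i=0..d;\varphi_j,\phi_j,j=1..d)$ over $\mathbb K$ such that $$A_{ii}=\theta_i+\frac{\varphi_i}{\theta^*_i-\theta^*_{i-1}}+\frac{\varphi_{i+1}}{\theta^*_i-\theta^*_{i+1}}\qquad(0\le i\le d),$$ $$A_{i,i-1}A_{i-1,i}=\varphi_i\phi_i\,\frac{\prod_{h=0}^{i-2}(\theta^*_{i-1}-\theta^*_h)}{\prod_{h=0}^{i-1}(\theta^*_i-\theta^*_h)}\cdot\frac{\prod_{h=i+1}^{d}(\theta^*_i-\theta^*_h)}{\prod_{h=i}^{d}(\theta^*_{i-1}-\theta^*_h)}\qquad(1\le i\le d),$$ $$A^*_{ii}=\theta^*_i\qquad(0\le i\le d).$$ Suppose (i), (ii) hold and let $R$ denote the set of parameter arrays over $\mathbb K$ which satisfy (ii). Then $R$ consists of the parameter arrays $(\theta_i,\theta^*_i,i=0..d;\varphi_j,\phi_j,j=1..d)$ of the Leonard pair $A,A^*$ which satisfy $\theta^*_i=A^*_{ii}$ for $0\le i\le d$. If $(\theta_i,\theta^*_i,i=0..d;\varphi_j,\phi_j,j=1..d)$ is in $R$ then so is $(\theta_{d-i},\theta^*_i,i=0..d;\phi_j,\varphi_j,j=1..d)$,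 and $R$ contains no further elements.
   Context: $\mathrm{Mat}_{d+1}(\mathbb K)$ is the algebra of $(d+1)\times(d+1)$ matrices over $\mathbb K$, rows and columns indexed by $0,1,\dots,d$. A matrix is tridiagonal if every nonzero entry lies on the diagonal, subdiagonal or superdiagonal. Leonard pairs and systems. Let $\mathcal A$ be a $\mathbb K$-algebra isomorphic to $\mathrm{Mat}_{d+1}(\mathbb K)$. An element $A\in\mathcal A$ is multiplicity-free if it has $d+1$ distinct eigenvalues in $\mathbb K$; if these are $\theta_0,\dots,\theta_d$, the primitive idempotent of $A$ associated with $\theta_i$ is $E_i=\prod_{j\ne i}(A-\theta_jI)/(\theta_i-\theta_j)$. For multiplicity-free $A,A^*\in\mathcal A$ ($A^*$ is just a name, not an adjoint), an idempotent sequence for $A,A^*$ is an ordering $E_0,\dots,E_d$ of the primitive idempotents of $A$ such that $E_iA^*E_j=0$ if $|i-j|>1$ and $E_iA^*E_j\ne0$ if $|i-j|=1$ ($0\le i,j\le d$); a dual idempotent sequence for $A,A^*$ is an idempotent sequence for $A^*,A$. A Leonard pair in $\mathcal A$ is an ordered pair $A,A^*$ of multiplicity-free elements of $\mathcal A$ for which an idempotent sequence and a dual idempotent sequence exist. A Leonard system in $\mathcal A$ is a sequence $\Phi=(A,A^*;E_i,E^*_i,i=0..d)$ where $A,A^*\in\mathcal A$ are multiplicity-free, $E_0,\dots,E_d$ is an idempotent sequence for $A,A^*$ and $E^*_0,\dots,E^*_d$ is a dual idempotent sequence for $A,A^*$; then $A,A^*$ is a Leonard pair, said to be associated with $\Phi$.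 The eigenvalue sequence (resp. dual eigenvalue sequence) of $\Phi$ is $\theta_0,\dots,\theta_d$ (resp. $\theta^*_0,\dots,\theta^*_d$), where $\theta_i$ (resp. $\theta^*_i$) is the eigenvalue of $A$ (resp. $A^*$) associated with $E_i$ (resp. $E^*_i$). Split sequences. Let $V$ be an irreducible left $\mathcal A$-module (unique up to isomorphism, of dimension $d+1$) and set $U_i=(E^*_0V+\cdots+E^*_iV)\cap(E_iV+\cdots+E_dV)$. It is known that each $U_i$ has dimension 1, $V$ is the direct sum of $U_0,\dots,U_d$, $(A-\theta_iI)U_i=U_{i+1}$ ($0\le i\le d-1$), $(A-\theta_dI)U_d=0$, $(A^*-\theta^*_iI)U_i=U_{i-1}$ ($1\le i\le d$), $(A^*-\theta_0^*I)U_0=0$. For $1\le i\le d$, $\varphi_i$ is the (nonzero) eigenvalue of $(A-\theta_{i-1}I)(A^*-\theta^*_iI)$ on $U_i$. The sequence $\varphi_1,\dots,\varphi_d$ is the first split sequence of $\Phi$. The second split sequence $\phi_1,\dots,\phi_d$ of $\Phi$ is the first split sequence of $\Phi^\Downarrow=(A,A^*;E_{d-i},E^*_i,i=0..d)$. Parameter arrays. A parameter array over $\mathbb K$ of diameter $d$ is a sequence $(\theta_i,\theta^*_i,i=0..d;\varphi_j,\phi_j,j=1..d)$ of scalars in $\mathbb K$ such that: (1) $\varphi_i\ne0$, $\phi_i\ne0$ ($1\le i\le d$); (2) $\theta_i\ne\theta_j$, $\theta^*_i\ne\theta^*_j$ if $i\ne j$; (3) $\varphi_i=\phi_1\sum_{h=0}^{i-1}\frac{\theta_h-\theta_{d-h}}{\theta_0-\theta_d}+(\theta^*_i-\theta^*_0)(\theta_{i-1}-\theta_d)$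 ($1\le i\le d$); (4) $\phi_i=\varphi_1\sum_{h=0}^{i-1}\frac{\theta_h-\theta_{d-h}}{\theta_0-\theta_d}+(\theta^*_i-\theta^*_0)(\theta_{d-i+1}-\theta_0)$ ($1\le i\le d$); (5) the expressions $\frac{\theta_{i-2}-\theta_{i+1}}{\theta_{i-1}-\theta_i}$ and $\frac{\theta^*_{i-2}-\theta^*_{i+1}}{\theta^*_{i-1}-\theta^*_i}$ are equal and independent of $i$ for $2\le i\le d-1$. The parameter array of a Leonard system $\Phi$ consists of its eigenvalue sequence, dual eigenvalue sequence, first split sequence and second split sequence; it is known that this sequence is a parameter array over $\mathbb K$ of diameter $d$, and that $\Phi\mapsto$ (parameter array of $\Phi$) induces a bijection from isomorphism classes of Leonard systems over $\mathbb K$ to parameter arrays over $\mathbb K$. A parameter array of a Leonard pair is the parameter array of some Leonard system associated with that pair. Conventions: $\varphi_0=0$, $\varphi_{d+1}=0$, and $\theta^*_{-1},\theta^*_{d+1}$ are indeterminates (so the terms with numerator $\varphi_0$ or $\varphi_{d+1}$ are $0$). *)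

theory Defs
  imports "Jordan_Normal_Form.Char_Poly"
begin

text \<open>
  Rows and columns of matrices are indexed by \<open>0, \<dots>, d\<close>, so the algebra of all
  \<open>(d+1) \<times> (d+1)\<close> matrices is \<open>carrier_mat (d+1) (d+1)\<close>.  The letter \<open>As\<close> stands for
  \<open>A*\<close>, which is just a name; likewise \<open>Es\<close>, \<open>ths\<close>.
\<close>

definition tridiagonal_mat :: "'a::zero mat \<Rightarrow> bool" where
  "tridiagonal_mat A \<longleftrightarrow>
     (\<forall>i<dim_row A. \<forall>j<dim_col A. \<bar>int i - int j\<bar> > 1 \<longrightarrow> A $$ (i,j) = 0)"


section \<open>Leonard pairs and Leonard systems\<close>

definition multiplicity_free :: "nat \<Rightarrow> 'a::field mat \<Rightarrow> bool" where
  "multiplicity_free d A \<longleftrightarrow>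
     A \<in> carrier_mat (d+1) (d+1) \<and> card {t. eigenvalue A t} = d + 1"

text \<open>
  The product over \<open>j \<noteq> i\<close> of \<open>(A - th\<^sub>j I) / (th\<^sub>i - th\<^sub>j)\<close>.  Matrix multiplication is not
  commutative, so the product is written over the list of the \<open>j\<close> in increasing order; the
  factors commute with each other, so the order is immaterial.
\<close>

definition primitive_idempotent ::
    "nat \<Rightarrow> 'a::field mat \<Rightarrow> (nat \<Rightarrow> 'a) \<Rightarrow> nat \<Rightarrow> 'a mat" where
  "primitive_idempotent d A th i =
     foldr (\<lambda>j M. (inverse (th i - th j) \<cdot>\<^sub>m (A - th j \<cdot>\<^sub>m 1\<^sub>m (d+1))) * M)
       (filter (\<lambda>j. j \<noteq> i) [0..<d+1]) (1\<^sub>m (d+1))"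

text \<open>
  A finite sequence of scalars \<open>f\<^sub>m, \<dots>, f\<^sub>n\<close> is encoded as a function on the naturals that
  vanishes outside \<open>{m..n}\<close>.  Thus equality of functions is equality of sequences, and the
  conventions that the terms of index \<open>0\<close> and \<open>d+1\<close> of a split sequence are \<open>0\<close> hold by
  encoding.
\<close>

definition scalar_seq :: "nat \<Rightarrow> nat \<Rightarrow> (nat \<Rightarrow> 'a::zero) \<Rightarrow> bool" where
  "scalar_seq m n f \<longleftrightarrow> (\<forall>i. i \<notin> {m..n} \<longrightarrow> f i = 0)"

text \<open>
  \<open>E\<^sub>0, \<dots>, E\<^sub>d\<close> is an ordering of the primitive idempotents of \<open>A\<close>, and \<open>th\<^sub>i\<close> is the
  eigenvalue of \<open>A\<close> associated with \<open>E\<^sub>i\<close>.  Here and below, only the values of \<open>E\<close> at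
  \<open>0, \<dots>, d\<close> matter.
\<close>

definition eigenvalue_sequence ::
    "nat \<Rightarrow> 'a::field mat \<Rightarrow> (nat \<Rightarrow> 'a mat) \<Rightarrow> (nat \<Rightarrow> 'a) \<Rightarrow> bool" where
  "eigenvalue_sequence d A E th \<longleftrightarrow>
     scalar_seq 0 d th \<and>
     bij_betw th {0..d} {t. eigenvalue A t} \<and>
     (\<forall>i\<le>d. E i = primitive_idempotent d A th i)"

definition idempotent_sequence ::
    "nat \<Rightarrow> 'a::field mat \<Rightarrow> 'a mat \<Rightarrow> (nat \<Rightarrow> 'a mat) \<Rightarrow> bool" where
  "idempotent_sequence d A As E \<longleftrightarrow>
     (\<exists>th. eigenvalue_sequence d A E th) \<and>
     (\<forall>i\<le>d. \<forall>j\<le>d.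
        (\<bar>int i - int j\<bar> > 1 \<longrightarrow> E i * As * E j = 0\<^sub>m (d+1) (d+1)) \<and>
        (\<bar>int i - int j\<bar> = 1 \<longrightarrow> E i * As * E j \<noteq> 0\<^sub>m (d+1) (d+1)))"

definition leonard_pair :: "nat \<Rightarrow> 'a::field mat \<Rightarrow> 'a mat \<Rightarrow> bool" where
  "leonard_pair d A As \<longleftrightarrow>
     multiplicity_free d A \<and> multiplicity_free d As \<and>
     (\<exists>E. idempotent_sequence d A As E) \<and>
     (\<exists>Es. idempotent_sequence d As A Es)"

definition leonard_system ::
    "nat \<Rightarrow> 'a::field mat \<Rightarrow> 'a mat \<Rightarrow> (nat \<Rightarrow> 'a mat) \<Rightarrow> (nat \<Rightarrow> 'a mat) \<Rightarrow> bool" where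
  "leonard_system d A As E Es \<longleftrightarrow>
     multiplicity_free d A \<and> multiplicity_free d As \<and>
     idempotent_sequence d A As E \<and> idempotent_sequence d As A Es"


section \<open>Split sequences\<close>

text \<open>
  The irreducible module \<open>V\<close> is taken to be the space \<open>carrier_vec (d+1)\<close> of column vectors.
  The following is the sum of the subspaces \<open>E\<^sub>h V\<close> with \<open>h\<close> in \<open>I\<close>.
\<close>

definition image_sum ::
    "nat \<Rightarrow> (nat \<Rightarrow> 'a::field mat) \<Rightarrow> nat set \<Rightarrow> 'a vec set" where
  "image_sum d E I =
     {finsum_vec TYPE('a) (d+1) (\<lambda>h. E h *\<^sub>v v h) I | v. \<forall>h\<in>I. v h \<in> carrier_vec (d+1)}"

definition split_space ::
    "nat \<Rightarrow> (nat \<Rightarrow> 'a::field mat) \<Rightarrow> (nat \<Rightarrow> 'a mat) \<Rightarrow> nat \<Rightarrow> 'a vec set" where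
  "split_space d E Es i = image_sum d Es {0..i} \<inter> image_sum d E {i..d}"

text \<open>
  For a Leonard system, \<open>split_space d E Es i\<close> has dimension 1 and is invariant under the matrix
  below, so the eigenvalue \<open>vphi\<^sub>i\<close> of that matrix on this space is unique.
\<close>

definition first_split_sequence ::
    "nat \<Rightarrow> 'a::field mat \<Rightarrow> 'a mat \<Rightarrow> (nat \<Rightarrow> 'a mat) \<Rightarrow> (nat \<Rightarrow> 'a mat) \<Rightarrow>
     (nat \<Rightarrow> 'a) \<Rightarrow> bool" where
  "first_split_sequence d A As E Es vphi \<longleftrightarrow>
     scalar_seq 1 d vphi \<and>
     (\<exists>th ths. eigenvalue_sequence d A E th \<and> eigenvalue_sequence d As Es ths \<and>
        (\<forall>i\<in>{1..d}. \<exists>u\<in>split_space d E Es i.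
           eigenvector
             ((A - th (i-1) \<cdot>\<^sub>m 1\<^sub>m (d+1)) * (As - ths i \<cdot>\<^sub>m 1\<^sub>m (d+1))) u (vphi i)))"

definition second_split_sequence ::
    "nat \<Rightarrow> 'a::field mat \<Rightarrow> 'a mat \<Rightarrow> (nat \<Rightarrow> 'a mat) \<Rightarrow> (nat \<Rightarrow> 'a mat) \<Rightarrow>
     (nat \<Rightarrow> 'a) \<Rightarrow> bool" where
  "second_split_sequence d A As E Es phi \<longleftrightarrow>
     first_split_sequence d A As (\<lambda>i. E (d - i)) Es phi"


section \<open>Parameter arrays\<close>

text \<open>
  A tuple \<open>(th, ths, vphi, phi)\<close>: eigenvalues, dual eigenvalues, first and second split sequence.
\<close>

type_synonym 'a array = "(nat \<Rightarrow> 'a) \<times> (nat \<Rightarrow> 'a) \<times> (nat \<Rightarrow> 'a) \<times> (nat \<Rightarrow> 'a)"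

fun parameter_array :: "nat \<Rightarrow> 'a::field array \<Rightarrow> bool" where
  "parameter_array d (th, ths, vphi, phi) \<longleftrightarrow>
     scalar_seq 0 d th \<and> scalar_seq 0 d ths \<and> scalar_seq 1 d vphi \<and> scalar_seq 1 d phi \<and>
     (\<forall>i\<in>{1..d}. vphi i \<noteq> 0 \<and> phi i \<noteq> 0) \<and>
     (\<forall>i\<le>d. \<forall>j\<le>d. i \<noteq> j \<longrightarrow> th i \<noteq> th j \<and> ths i \<noteq> ths j) \<and>
     (\<forall>i\<in>{1..d}.
        vphi i = phi 1 * (\<Sum>h\<in>{0..i-1}. (th h - th (d-h)) / (th 0 - th d))
                 + (ths i - ths 0) * (th (i-1) - th d)) \<and>
     (\<forall>i\<in>{1..d}.
        phi i = vphi 1 * (\<Sum>h\<in>{0..i-1}. (th h - th (d-h)) / (th 0 - th d))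
                + (ths i - ths 0) * (th (d-i+1) - th 0)) \<and>
     (\<exists>c. \<forall>i\<in>{2..d-1}.
        (th (i-2) - th (i+1)) / (th (i-1) - th i) = c \<and>
        (ths (i-2) - ths (i+1)) / (ths (i-1) - ths i) = c)"

fun parameter_array_of_system ::
    "nat \<Rightarrow> 'a::field mat \<Rightarrow> 'a mat \<Rightarrow> (nat \<Rightarrow> 'a mat) \<Rightarrow> (nat \<Rightarrow> 'a mat) \<Rightarrow>
     'a array \<Rightarrow> bool" where
  "parameter_array_of_system d A As E Es (th, ths, vphi, phi) \<longleftrightarrow>
     eigenvalue_sequence d A E th \<and> eigenvalue_sequence d As Es ths \<and>
     first_split_sequence d A As E Es vphi \<and> second_split_sequence d A As E Es phi"

definition parameter_array_of_pair ::
    "nat \<Rightarrow> 'a::field mat \<Rightarrow> 'a mat \<Rightarrow> 'a array \<Rightarrow> bool" where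
  "parameter_array_of_pair d A As p \<longleftrightarrow>
     (\<exists>E Es. leonard_system d A As E Es \<and> parameter_array_of_system d A As E Es p)"

text \<open>
  In the first formula, \<open>ths (i-1)\<close> for \<open>i = 0\<close> and \<open>ths (i+1)\<close> for \<open>i = d\<close> are irrelevant: the
  numerators \<open>vphi 0\<close> and \<open>vphi (d+1)\<close> of these terms are \<open>0\<close>.
\<close>

fun entries_given_by :: "nat \<Rightarrow> 'a::field mat \<Rightarrow> 'a mat \<Rightarrow> 'a array \<Rightarrow> bool" where
  "entries_given_by d A As (th, ths, vphi, phi) \<longleftrightarrow>
     (\<forall>i\<le>d. A $$ (i,i) =
        th i + vphi i / (ths i - ths (i-1)) + vphi (i+1) / (ths i - ths (i+1))) \<and>
     (\<forall>i\<in>{1..d}. A $$ (i,i-1) * A $$ (i-1,i) =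
        vphi i * phi i
        * ((\<Prod>h\<in>{0..<i-1}. ths (i-1) - ths h) / (\<Prod>h\<in>{0..i-1}. ths i - ths h))
        * ((\<Prod>h\<in>{i+1..d}. ths i - ths h) / (\<Prod>h\<in>{i..d}. ths (i-1) - ths h))) \<and>
     (\<forall>i\<le>d. As $$ (i,i) = ths i)"

text \<open>The array \<open>(th\<^sub>d\<^sub>-\<^sub>i, ths\<^sub>i; phi\<^sub>j, vphi\<^sub>j)\<close>.\<close>

fun down_array :: "nat \<Rightarrow> 'a::zero array \<Rightarrow> 'a array" where
  "down_array d (th, ths, vphi, phi) =
     ((\<lambda>i. if i \<le> d then th (d - i) else 0), ths, phi, vphi)"

end

theory Submission
  imports Defs
begin

text \<open>
  Functions on the eigenvalues \<open>\<theta>\<^sub>0, \<dots>, \<theta>\<^sub>d\<close> of \<open>A\<close> form a model of the irreducible module in which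
  \<open>A\<close> is multiplication by \<open>\<theta>\<close>, \<open>A*\<close> is tridiagonal, and the standard basis consists of polynomials of
  degree \<open>0, \<dots>, d\<close> in \<open>\<theta>\<close>.  There the split basis is the Newton basis
  \<open>\<tau>\<^sub>i = (\<theta> - \<theta>\<^sub>0) \<dots> (\<theta> - \<theta>\<^sub>i\<^sub>-\<^sub>1)\<close>, on which \<open>A* \<tau>\<^sub>i = \<theta>*\<^sub>i \<tau>\<^sub>i + \<phi>\<^sub>i \<tau>\<^sub>i\<^sub>-\<^sub>1\<close>.  Comparing leading
  coefficients gives the diagonal entries of both matrices; exchanging \<open>A\<close> and \<open>A*\<close> and reversing the
  order of the points gives the products of off-diagonal entries.

  Conditions (3) to (5) on a parameter array come from two operators that commute with \<open>A\<close>, hence are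
  polynomials in \<open>A\<close>, whose degrees are read off from their values at the constant function: one is
  cubic and yields the recurrence (5), the other is the quadratic right hand side of the Askey-Wilson
  relation and yields a recurrence for the split sequence with a unique solution.

  Conversely, a parameter array defines an operator on the functions on
  \<open>\<theta>*\<^sub>0, \<dots>, \<theta>*\<^sub>d\<close> by its action on the Newton basis.  It satisfies the Askey-Wilson relation, and
  therefore acts in the same way on the Newton basis of the reversed points.  The two actions
  force its matrix to be tridiagonal with the prescribed entries, so that it is conjugate to \<open>A\<close> by a
  diagonal matrix.
\<close>

section \<open>Polynomial functions on finitely many points\<close>

text \<open>No closed form of the eigenvalues is used, so the argument is uniform in the field: only
  the recurrences enter. The entry formulas give products of opposite off-diagonal entries because
  conjugation by diagonal matrices leaves just these invariant. Such a product couples an entry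
  above the diagonal with one below, while a Newton basis controls only the entries above; those
  below are reached through the reversed points. This is why the converse needs one operator that is
  bidiagonal in both bases. Its remaining obstacle is the irreducibility of \<open>A*\<close> in the
  eigenbasis of \<open>A\<close>: triangular factors settle it below the diagonal, and a bilinear
  form for which \<open>A\<close> and \<open>A*\<close> are both symmetric carries it across. That
  \<open>R\<close> has no further elements is combinatorial: a reordering of the eigenvalues that
  preserves irreducible tridiagonal shape is an automorphism of a path.\<close>

definition newton :: "(nat \<Rightarrow> 'a::comm_ring_1) \<Rightarrow> nat \<Rightarrow> 'a \<Rightarrow> 'a" where
  "newton s i x = (\<Prod>h<i. x - s h)"

lemma newton_0 [simp]: "newton s 0 x = 1"
  by (simp add: newton_def)

lemma newton_Suc: "newton s (Suc i) x = newton s i x * (x - s i)"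
  by (simp add: newton_def)

lemma newton_eq_0: "h < i \<Longrightarrow> newton s i (s h) = 0"
  unfolding newton_def by (rule prod_zero) auto

lemma newton_neq_0:
  fixes s :: "nat \<Rightarrow> 'a::field"
  assumes "inj_on s {..d}" "i \<le> h" "h \<le> d"
  shows "newton s i (s h) \<noteq> 0"
  using assms by (force simp: newton_def inj_on_def)

text \<open>The degree is only bounded by \<open>k\<close> and \<open>c\<close> may be 0, which
  makes the relation linear. Polynomials are identified with their values, so \<open>c\<close> is
  determined only for \<open>k \<le> d\<close>: a polynomial of degree \<open>d + 1\<close> can
  vanish at all points.\<close>

definition lead :: "nat \<Rightarrow> (nat \<Rightarrow> 'a::field) \<Rightarrow> nat \<Rightarrow> (nat \<Rightarrow> 'a) \<Rightarrow> 'a \<Rightarrow> bool" where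
  "lead d s k f c \<longleftrightarrow>
     (\<exists>g. (\<forall>n>k. coeff g n = 0) \<and> coeff g k = c \<and> (\<forall>h\<le>d. f h = poly g (s h)))"

lemma leadI: "(\<And>n. n > k \<Longrightarrow> coeff g n = 0) \<Longrightarrow> coeff g k = c \<Longrightarrow>
    (\<And>h. h \<le> d \<Longrightarrow> f h = poly g (s h)) \<Longrightarrow> lead d s k f c"
  unfolding lead_def by blast

lemma leadE:
  assumes "lead d s k f c"
  obtains g where "\<And>n. n > k \<Longrightarrow> coeff g n = 0" "coeff g k = c"
    "\<And>h. h \<le> d \<Longrightarrow> f h = poly g (s h)"
  using assms unfolding lead_def by blast

lemma lead_cong: "lead d s k f c \<Longrightarrow> (\<And>h. h \<le> d \<Longrightarrow> f' h = f h) \<Longrightarrow> lead d s k f' c"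
  by (auto simp: lead_def)

lemma lead_add: "lead d s k f c \<Longrightarrow> lead d s k f' c' \<Longrightarrow> lead d s k (\<lambda>h. f h + f' h) (c + c')"
  by (elim leadE, rule_tac g = "g + ga" in leadI) auto

lemma lead_cmult: "lead d s k f c \<Longrightarrow> lead d s k (\<lambda>h. a * f h) (a * c)"
  by (elim leadE, rule_tac g = "Polynomial.smult a g" in leadI) auto

lemma lead_diff: "lead d s k f c \<Longrightarrow> lead d s k f' c' \<Longrightarrow> lead d s k (\<lambda>h. f h - f' h) (c - c')"
  by (elim leadE, rule_tac g = "g - ga" in leadI) auto

lemma lead_shift: "lead d s k f c \<Longrightarrow> lead d s (Suc k) (\<lambda>h. s h * f h) c"
  by (elim leadE, rule_tac g = "pCons 0 g" in leadI) (auto simp: coeff_pCons split: nat.splits)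

lemma lead_weaken: "lead d s k f c \<Longrightarrow> k < k' \<Longrightarrow> lead d s k' f 0"
  by (elim leadE, rule_tac g = g in leadI) auto

lemma lead_reduce: "lead d s (Suc k) f 0 \<Longrightarrow> \<exists>c. lead d s k f c"
proof -
  assume "lead d s (Suc k) f 0"
  then obtain g where g: "\<And>n. n > Suc k \<Longrightarrow> coeff g n = 0" "coeff g (Suc k) = 0"
    "\<And>h. h \<le> d \<Longrightarrow> f h = poly g (s h)" by (erule leadE)
  have "coeff g n = 0" if "n > k" for n
    using g(1)[of n] g(2) that by (cases "n = Suc k") auto
  thus ?thesis using g(3) by (auto simp: lead_def)
qed

lemma lead_const: "lead d s 0 (\<lambda>_. c) c"
  by (rule leadI[of _ "[:c:]"]) (auto simp: coeff_pCons split: nat.splits)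

lemma lead_0_const: "lead d s 0 f c \<Longrightarrow> h \<le> d \<Longrightarrow> f h = c"
proof (elim leadE)
  fix g assume g: "\<And>n. n > 0 \<Longrightarrow> coeff g n = 0" "coeff g 0 = c"
    "\<And>h. h \<le> d \<Longrightarrow> f h = poly g (s h)" and h: "h \<le> d"
  have "g = [:c:]" using g(1,2) by (intro poly_eqI) (auto simp: coeff_pCons split: nat.splits)
  thus "f h = c" using g(3)[OF h] by simp
qed

lemma poly_eq_0_if_many_roots:
  fixes g :: "'a::field poly"
  assumes "inj_on s {..<k}" "\<And>n. n \<ge> k \<Longrightarrow> coeff g n = 0" "\<And>h. h < k \<Longrightarrow> poly g (s h) = 0"
  shows "g = 0"
proof (rule ccontr)
  assume g: "g \<noteq> 0"
  have "card (s ` {..<k}) \<le> card {x. poly g x = 0}"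
    using assms(3) poly_roots_finite[OF g] by (intro card_mono) auto
  also have "\<dots> \<le> degree g" by (rule poly_roots_degree[OF g])
  finally have "k \<le> degree g" using card_image[OF assms(1)] by simp
  hence "coeff g (degree g) = 0" by (rule assms(2))
  thus False using g by simp
qed

lemma lead_unique:
  assumes "inj_on s {..d}" "k \<le> d" "lead d s k f c" "lead d s k f c'"
  shows "c = c'"
proof -
  have "lead d s k (\<lambda>h. f h - f h) (c - c')" by (rule lead_diff) fact+
  then obtain g where g: "\<And>n. n > k \<Longrightarrow> coeff g n = 0" "coeff g k = c - c'"
    "\<And>h. h \<le> d \<Longrightarrow> f h - f h = poly g (s h)" by (erule leadE)
  have "g = 0" using assms(1,2) g(1,3)
    by (intro poly_eq_0_if_many_roots[of s "Suc k"]) (auto intro: inj_on_subset)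
  thus ?thesis using g(2) by simp
qed

lemma lead_newton: "lead d s k (\<lambda>h. newton s k (s h)) 1"
proof (induction k)
  case 0
  show ?case using lead_const[of d s 1] by simp
next
  case (Suc k)
  have "lead d s (Suc k) (\<lambda>h. s h * newton s k (s h) - s k * newton s k (s h)) (1 - s k * 0)"
    by (intro lead_diff lead_shift lead_cmult lead_weaken[OF Suc.IH] Suc.IH) simp
  thus ?case by (simp add: newton_Suc algebra_simps)
qed

text \<open>After subtraction of \<open>c * newton s k\<close> the degree drops below
  \<open>k\<close> while the \<open>k\<close> zeros remain. Newton polynomials are thus recognised
  by degree and initial zeros.\<close>

lemma lead_eq_newton:
  assumes "inj_on s {..d}" "k \<le> d" "lead d s k f c" "\<And>h. h < k \<Longrightarrow> f h = 0" "h \<le> d"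
  shows "f h = c * newton s k (s h)"
proof -
  have "lead d s k (\<lambda>h. f h - c * newton s k (s h)) (c - c * 1)"
    by (intro lead_diff lead_cmult lead_newton) fact
  then obtain g where g: "\<And>n. n > k \<Longrightarrow> coeff g n = 0" "coeff g k = c - c * 1"
    "\<And>h. h \<le> d \<Longrightarrow> f h - c * newton s k (s h) = poly g (s h)" by (erule leadE)
  have "g = 0"
  proof (rule poly_eq_0_if_many_roots[of s k])
    show "inj_on s {..<k}" using assms(1,2) by (auto intro: inj_on_subset)
    show "coeff g n = 0" if "n \<ge> k" for n
      using g(1)[of n] g(2) that by (cases "n = k") auto
    show "poly g (s h) = 0" if "h < k" for h
      using g(3)[of h] assms(2) assms(4)[OF that] newton_eq_0[OF that, of s] that by simp
  qed
  thus ?thesis using g(3)[OF assms(5)] by simp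
qed

lemma lead_interpolation:
  assumes "inj_on s {..d}"
  shows "\<exists>c. lead d s d f c"
proof -
  have "\<exists>g. (\<forall>n\<ge>k. coeff g n = 0) \<and> (\<forall>h<k. f h = poly g (s h))" if "k \<le> Suc d" for k
    using that
  proof (induction k)
    case 0
    show ?case by (rule exI[of _ 0]) simp
  next
    case (Suc k)
    then obtain g where g: "\<And>n. n \<ge> k \<Longrightarrow> coeff g n = 0" "\<And>h. h < k \<Longrightarrow> f h = poly g (s h)"
      by auto
    obtain t where t: "\<And>n. n > k \<Longrightarrow> coeff t n = 0"
      "\<And>h. h \<le> d \<Longrightarrow> newton s k (s h) = poly t (s h)"
      using lead_newton[of d s k] unfolding lead_def by blast
    let ?c = "(f k - poly g (s k)) / newton s k (s k)"
    have nz: "newton s k (s k) \<noteq> 0" using newton_neq_0[OF assms, of k k] Suc.prems by simp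
    show ?case
    proof (intro exI[of _ "g + Polynomial.smult ?c t"] conjI allI impI)
      fix n assume "n \<ge> Suc k" thus "coeff (g + Polynomial.smult ?c t) n = 0" using g(1) t(1) by simp
    next
      fix h assume h: "h < Suc k"
      hence "poly t (s h) = newton s k (s h)" using t(2) Suc.prems by simp
      thus "f h = poly (g + Polynomial.smult ?c t) (s h)"
        using g(2)[of h] h nz newton_eq_0[of h k s] by (cases "h = k") auto
    qed
  qed
  from this[of "Suc d"] obtain g where "\<forall>n\<ge>Suc d. coeff g n = 0" "\<forall>h<Suc d. f h = poly g (s h)"
    by auto
  thus ?thesis by (intro exI leadI[of d g]) auto
qed

lemma lead_descend:
  assumes "lead d s (k + n) f c" "\<And>i b. k < i \<Longrightarrow> i \<le> k + n \<Longrightarrow> lead d s i f b \<Longrightarrow> b = 0"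
  shows "\<exists>b. lead d s k f b"
  using assms
proof (induction n arbitrary: c)
  case (Suc n)
  have "c = 0" using Suc.prems(2)[of "k + Suc n" c] Suc.prems(1) by simp
  with Suc.prems(1) obtain b where "lead d s (k + n) f b" using lead_reduce by fastforce
  from Suc.IH[OF this] Suc.prems(2) show ?case by simp
qed auto


section \<open>Irreducible tridiagonal matrices\<close>

definition irreducible_tridiagonal :: "nat \<Rightarrow> (nat \<Rightarrow> nat \<Rightarrow> 'a::zero) \<Rightarrow> bool" where
  "irreducible_tridiagonal d X \<longleftrightarrow>
     (\<forall>i\<le>d. \<forall>j\<le>d. (\<bar>int i - int j\<bar> > 1 \<longrightarrow> X i j = 0) \<and> (\<bar>int i - int j\<bar> = 1 \<longrightarrow> X i j \<noteq> 0))"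

lemma irreducible_tridiagonalD:
  assumes "irreducible_tridiagonal d X"
  shows "i \<le> d \<Longrightarrow> j \<le> d \<Longrightarrow> \<bar>int i - int j\<bar> > 1 \<Longrightarrow> X i j = 0"
    and "i < d \<Longrightarrow> X i (Suc i) \<noteq> 0" and "i < d \<Longrightarrow> X (Suc i) i \<noteq> 0"
  using assms unfolding irreducible_tridiagonal_def by auto

lemma sum_near_diagonal:
  fixes G :: "nat \<Rightarrow> 'a::comm_monoid_add"
  assumes "j \<le> d" "\<And>k. k \<le> d \<Longrightarrow> \<bar>int k - int j\<bar> > 1 \<Longrightarrow> G k = 0"
  shows "(\<Sum>k\<le>d. G k) =
    (if j = 0 then 0 else G (j - 1)) + (G j + (if j < d then G (Suc j) else 0))"
proof -
  let ?S = "(if j = 0 then {} else {j - 1}) \<union> ({j} \<union> (if j < d then {Suc j} else {}))"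
  have "(\<Sum>k\<le>d. G k) = (\<Sum>k\<in>?S. G k)"
  proof (rule sum.mono_neutral_right)
    show "\<forall>k\<in>{..d} - ?S. G k = 0"
    proof
      fix k assume "k \<in> {..d} - ?S"
      hence "k \<le> d" "\<bar>int k - int j\<bar> > 1" using assms(1) by (auto split: if_splits)
      thus "G k = 0" by (rule assms(2))
    qed
  qed (use assms(1) in auto)
  also have "\<dots> = (if j = 0 then 0 else G (j - 1)) + (G j + (if j < d then G (Suc j) else 0))"
    using assms(1) by (auto simp: add_ac)
  finally show ?thesis .
qed

section \<open>Matrices acting bidiagonally on the Newton basis\<close>

text \<open>In the Newton basis the operator \<open>N\<close> is bidiagonal with diagonal
  \<open>u\<close> and superdiagonal \<open>f\<close>. At \<open>i = 0\<close> the natural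
  subtraction \<open>i - 1\<close> gives 0 again; the extra term is harmless for split sequences,
  which are 0 there.\<close>

definition newton_action ::
    "nat \<Rightarrow> (nat \<Rightarrow> nat \<Rightarrow> 'a::field) \<Rightarrow> (nat \<Rightarrow> 'a) \<Rightarrow> (nat \<Rightarrow> 'a) \<Rightarrow> (nat \<Rightarrow> 'a) \<Rightarrow> bool" where
  "newton_action d N s u f \<longleftrightarrow> (\<forall>i\<le>d. \<forall>j\<le>d.
     (\<Sum>k\<le>d. N j k * newton s i (s k)) = u i * newton s i (s j) + f i * newton s (i - 1) (s j))"

lemma newton_actionD: "newton_action d N s u f \<Longrightarrow> i \<le> d \<Longrightarrow> j \<le> d \<Longrightarrow>
    (\<Sum>k\<le>d. N j k * newton s i (s k)) = u i * newton s i (s j) + f i * newton s (i - 1) (s j)"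
  by (simp add: newton_action_def)

text \<open>Downward induction on the column: in the sum against \<open>newton s k\<close> the
  columns below \<open>k\<close> are killed by zeros and those above by induction, while both Newton
  polynomials on the right vanish at \<open>s j\<close> because \<open>j < k - 1\<close>.\<close>

lemma newton_action_upper:
  assumes N: "newton_action d N s u f" and s: "inj_on s {..d}"
  shows "j + 1 < k \<Longrightarrow> k \<le> d \<Longrightarrow> N j k = 0"
proof (induction "d - k" arbitrary: k rule: less_induct)
  case less
  have "(\<Sum>m\<le>d. N j m * newton s k (s m)) = (\<Sum>m\<in>{k}. N j m * newton s k (s m))"
  proof (rule sum.mono_neutral_right)
    show "\<forall>m\<in>{..d} - {k}. N j m * newton s k (s m) = 0"
    proof
      fix m assume m: "m \<in> {..d} - {k}"
      show "N j m * newton s k (s m) = 0"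
      proof (cases "m < k")
        case True
        thus ?thesis by (simp add: newton_eq_0)
      next
        case False
        hence "N j m = 0" using m less.prems by (intro less.hyps) auto
        thus ?thesis by simp
      qed
    qed
  qed (use less.prems in auto)
  moreover have "(\<Sum>m\<le>d. N j m * newton s k (s m)) = 0"
    using newton_actionD[OF N less.prems(2), of j] less.prems by (simp add: newton_eq_0)
  ultimately show ?case using newton_neq_0[OF s, of k k] less.prems by simp
qed

lemma newton_action_sum:
  assumes N: "newton_action d N s u f" and s: "inj_on s {..d}" and ij: "j \<le> i" "i \<le> d" "i \<le> Suc j"
  shows "N j i * newton s i (s i) + (if i < d \<and> i \<le> j then N j (Suc i) * newton s i (s (Suc i)) else 0)
    = u i * newton s i (s j) + f i * newton s (i - 1) (s j)"
proof -
  have "(\<Sum>k\<le>d. N j k * newton s i (s k)) =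
    (\<Sum>k\<in>{i} \<union> (if i < d \<and> i \<le> j then {Suc i} else {}). N j k * newton s i (s k))"
  proof (rule sum.mono_neutral_right)
    show "\<forall>k\<in>{..d} - ({i} \<union> (if i < d \<and> i \<le> j then {Suc i} else {})). N j k * newton s i (s k) = 0"
    proof
      fix k assume k: "k \<in> {..d} - ({i} \<union> (if i < d \<and> i \<le> j then {Suc i} else {}))"
      show "N j k * newton s i (s k) = 0"
      proof (cases "k < i")
        case False
        hence "N j k = 0" using k ij by (intro newton_action_upper[OF N s]) (auto split: if_splits)
        thus ?thesis by simp
      qed (simp add: newton_eq_0)
    qed
  qed (use ij in auto)
  also have "\<dots> = N j i * newton s i (s i) + (if i < d \<and> i \<le> j then N j (Suc i) * newton s i (s (Suc i)) else 0)"
    by auto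
  finally show ?thesis using newton_actionD[OF N ij(2), of j] ij by simp
qed

lemma newton_action_super:
  assumes N: "newton_action d N s u f" and s: "inj_on s {..d}" and j: "j < d"
  shows "N j (Suc j) * newton s (Suc j) (s (Suc j)) = f (Suc j) * newton s j (s j)"
  using newton_action_sum[OF N s, of j "Suc j"] j by (simp add: newton_eq_0)

lemma newton_action_diag:
  assumes N: "newton_action d N s u f" and s: "inj_on s {..d}" and i: "i \<le> d"
    and f: "f 0 = 0" "f (Suc d) = 0"
  shows "N i i = u i + f i / (s i - s (i - 1)) + f (i + 1) / (s i - s (i + 1))"
proof -
  have nz: "newton s i (s i) \<noteq> 0" using newton_neq_0[OF s, of i i] i by simp
  have 1: "f i * newton s (i - 1) (s i) = f i / (s i - s (i - 1)) * newton s i (s i)"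
  proof (cases i)
    case (Suc j)
    have "s i - s j \<noteq> 0" using s Suc i by (force simp: inj_on_def)
    thus ?thesis using Suc by (simp add: newton_Suc)
  qed (simp add: f)
  have 2: "(if i < d then N i (Suc i) * newton s i (s (Suc i)) else 0) =
      - (f (i + 1) / (s i - s (i + 1)) * newton s i (s i))"
  proof (cases "i < d")
    case True
    have "s (Suc i) - s i \<noteq> 0" using s True by (force simp: inj_on_def)
    moreover from this have "s i - s (Suc i) \<noteq> 0" by simp
    moreover have "N i (Suc i) * newton s i (s (Suc i)) * (s (Suc i) - s i) = f (Suc i) * newton s i (s i)"
      using newton_action_super[OF N s True] by (simp add: newton_Suc mult_ac)
    ultimately show ?thesis using True by (simp add: field_simps)
  next
    case False
    hence "i = d" using i by simp
    thus ?thesis using f by simp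
  qed
  have "N i i * newton s i (s i) + (if i < d then N i (Suc i) * newton s i (s (Suc i)) else 0)
     = u i * newton s i (s i) + f i * newton s (i - 1) (s i)"
    using newton_action_sum[OF N s, of i i] i by simp
  with 1 2 have "N i i * newton s i (s i) =
     (u i + f i / (s i - s (i - 1)) + f (i + 1) / (s i - s (i + 1))) * newton s i (s i)"
    by (simp add: algebra_simps)
  thus ?thesis using nz by simp
qed

section \<open>Eigenbases on which a pair of operators acts tridiagonally\<close>

text \<open>
  Functions on the points \<open>s 0, \<dots>, s d\<close> carry two operators: multiplication by \<open>s\<close>, whose
  matrix in the basis \<open>p 0, \<dots>, p d\<close> is \<open>X\<close>, and the operator with matrix \<open>B\<close>, which is
  diagonal in that basis.
\<close>

definition split_sequence :: "nat \<Rightarrow> (nat \<Rightarrow> 'a::field) \<Rightarrow> (nat \<Rightarrow> nat \<Rightarrow> 'a) \<Rightarrow> nat \<Rightarrow> 'a" where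
  "split_sequence d s B i =
     (if 1 \<le> i \<and> i \<le> d
      then B (i - 1) i * newton s i (s i) / newton s (i - 1) (s (i - 1)) else 0)"

locale leonard_model =
  fixes d :: nat and s s' :: "nat \<Rightarrow> 'a::field" and X B :: "nat \<Rightarrow> nat \<Rightarrow> 'a"
    and p :: "nat \<Rightarrow> nat \<Rightarrow> 'a"
  assumes inj_s: "inj_on s {..d}" and inj_s': "inj_on s' {..d}"
    and X: "irreducible_tridiagonal d X" and B: "irreducible_tridiagonal d B"
    and p_0: "h \<le> d \<Longrightarrow> p 0 h = 1"
    and X_p: "h \<le> d \<Longrightarrow> j \<le> d \<Longrightarrow> (\<Sum>k\<le>d. p k h * X k j) = s h * p j h"
    and B_p: "h \<le> d \<Longrightarrow> j \<le> d \<Longrightarrow> (\<Sum>k\<le>d. B h k * p j k) = s' j * p j h"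
begin

abbreviation deg :: "nat \<Rightarrow> (nat \<Rightarrow> 'a) \<Rightarrow> 'a \<Rightarrow> bool" where "deg \<equiv> lead d s"

abbreviation nw :: "nat \<Rightarrow> nat \<Rightarrow> 'a" where "nw i h \<equiv> newton s i (s h)"

abbreviation split_seq :: "nat \<Rightarrow> 'a" where "split_seq \<equiv> split_sequence d s B"

definition ap :: "(nat \<Rightarrow> 'a) \<Rightarrow> nat \<Rightarrow> 'a" where "ap f h = (\<Sum>k\<le>d. B h k * f k)"

lemma ap_diff: "ap (\<lambda>h. f h - g h) h = ap f h - ap g h"
  by (simp add: ap_def right_diff_distrib sum_subtractf)

lemma ap_cmult: "ap (\<lambda>h. a * f h) h = a * ap f h"
  by (simp add: ap_def sum_distrib_left mult_ac)

lemma ap_cong: "(\<And>h. h \<le> d \<Longrightarrow> f h = g h) \<Longrightarrow> ap f h = ap g h"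
  by (simp add: ap_def)

lemma ap_p: "h \<le> d \<Longrightarrow> j \<le> d \<Longrightarrow> ap (p j) h = s' j * p j h"
  by (simp add: ap_def B_p)

lemma ap_tridiagonal:
  assumes "h \<le> d"
  shows "ap f h = (if h = 0 then 0 else B h (h - 1) * f (h - 1)) +
    (B h h * f h + (if h < d then B h (Suc h) * f (Suc h) else 0))"
  unfolding ap_def using assms by (intro sum_near_diagonal) (auto simp: irreducible_tridiagonalD(1)[OF B])

lemma three_term:
  assumes "h \<le> d" "j \<le> d"
  shows "s h * p j h = (if j = 0 then 0 else p (j - 1) h * X (j - 1) j) +
    (p j h * X j j + (if j < d then p (Suc j) h * X (Suc j) j else 0))"
  unfolding X_p[OF assms, symmetric] using assms
  by (intro sum_near_diagonal) (auto simp: irreducible_tridiagonalD(1)[OF X])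

lemma p_Suc:
  assumes "h \<le> d" "j < d"
  shows "p (Suc j) h = 1 / X (Suc j) j *
    (s h * p j h - X j j * p j h - (if j = 0 then 0 else X (j - 1) j) * p (j - 1) h)"
proof -
  note three_term[OF assms(1), of j]
  moreover have "X (Suc j) j \<noteq> 0" using irreducible_tridiagonalD(3)[OF X assms(2)] .
  ultimately show ?thesis using assms(2) by (cases "j = 0") (auto simp: field_simps)
qed

lemma p_lead_Suc:
  assumes "j < d" "deg j (p j) c" "j > 0 \<Longrightarrow> deg (j - 1) (p (j - 1)) c'"
  shows "deg (Suc j) (p (Suc j)) (c / X (Suc j) j)"
proof -
  have "deg (Suc j) (\<lambda>h. (if j = 0 then 0 else X (j - 1) j) * p (j - 1) h) 0"
  proof (cases "j = 0")
    case True
    thus ?thesis using lead_weaken[OF lead_const[of d s 0]] by simp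
  next
    case False
    hence "deg (Suc j) (p (j - 1)) 0" using assms(3) by (intro lead_weaken) auto
    from lead_cmult[OF this, of "X (j - 1) j"] show ?thesis using False by simp
  qed
  from lead_cmult[OF lead_diff[OF lead_diff[OF lead_shift[OF assms(2)]
      lead_cmult[OF lead_weaken[OF assms(2), of "Suc j"], of "X j j"]] this],
      of "1 / X (Suc j) j"]
  have "deg (Suc j) (\<lambda>h. 1 / X (Suc j) j * (s h * p j h - X j j * p j h -
      (if j = 0 then 0 else X (j - 1) j) * p (j - 1) h)) (c / X (Suc j) j)" by simp
  thus ?thesis by (rule lead_cong) (rule p_Suc[OF _ assms(1)])
qed

lemma p_lead: "j \<le> d \<Longrightarrow> \<exists>c. c \<noteq> 0 \<and> deg j (p j) c"
proof (induction j rule: less_induct)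
  case (less j)
  show ?case
  proof (cases j)
    case 0
    have "deg 0 (p 0) 1" by (rule lead_cong[OF lead_const]) (simp add: p_0)
    thus ?thesis using 0 by (intro exI[of _ 1]) simp
  next
    case (Suc i)
    hence i: "i < d" using less.prems by simp
    obtain c where c: "c \<noteq> 0" "deg i (p i) c" using less.IH[of i] Suc i by auto
    have "i - 1 < j" "i - 1 \<le> d" using Suc i by auto
    from less.IH[OF this] obtain c' where "i > 0 \<longrightarrow> deg (i - 1) (p (i - 1)) c'" by blast
    hence "deg j (p j) (c / X j i)" using p_lead_Suc[OF i c(2)] Suc by blast
    moreover have "c / X j i \<noteq> 0" using c(1) irreducible_tridiagonalD(3)[OF X i] Suc by simp
    ultimately show ?thesis by blast
  qed
qed

text \<open>The functions \<open>p 0, ..., p k\<close> have each degree up to \<open>k\<close>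
  exactly once, so leading terms can be removed one after the other. The coefficients of a Newton
  polynomial in this basis later give a vector of the split space.\<close>

lemma lead_expand:
  assumes "k \<le> d" "deg k f c"
  shows "\<exists>\<alpha>. \<forall>h\<le>d. f h = (\<Sum>j\<le>k. \<alpha> j * p j h)"
  using assms
proof (induction k arbitrary: f c)
  case 0
  show ?case using lead_0_const[OF 0(2)] p_0 by (intro exI[of _ "\<lambda>_. c"]) simp
next
  case (Suc k)
  obtain l where l: "l \<noteq> 0" "deg (Suc k) (p (Suc k)) l" using p_lead Suc.prems(1) by blast
  have "deg (Suc k) (\<lambda>h. f h - c / l * p (Suc k) h) (c - c / l * l)"
    by (intro lead_diff lead_cmult l(2)) fact
  then obtain c' where "deg k (\<lambda>h. f h - c / l * p (Suc k) h) c'"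
    using lead_reduce l(1) by fastforce
  then obtain \<alpha> where \<alpha>: "\<forall>h\<le>d. f h - c / l * p (Suc k) h = (\<Sum>j\<le>k. \<alpha> j * p j h)"
    using Suc.IH Suc.prems(1) by (meson Suc_leD)
  show ?case
  proof (intro exI[of _ "\<alpha>(Suc k := c / l)"] allI impI)
    fix h assume "h \<le> d"
    hence "f h = (\<Sum>j\<le>k. \<alpha> j * p j h) + c / l * p (Suc k) h" using \<alpha> by (metis diff_add_cancel)
    also have "(\<Sum>j\<le>k. \<alpha> j * p j h) = (\<Sum>j\<le>k. (\<alpha>(Suc k := c / l)) j * p j h)"
      by (intro sum.cong) auto
    finally show "f h = (\<Sum>j\<le>Suc k. (\<alpha>(Suc k := c / l)) j * p j h)" by simp
  qed
qed

text \<open>The operator is diagonal in the basis \<open>p\<close>, which contains one function of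
  each degree; hence it is triangular for the degree filtration, with \<open>s' k\<close> acting on
  the leading coefficient.\<close>

lemma lead_ap:
  assumes "k \<le> d" "deg k f c"
  shows "deg k (ap f) (s' k * c)"
  using assms
proof (induction k arbitrary: f c)
  case 0
  have "ap f h = s' 0 * c" if "h \<le> d" for h
  proof -
    have "ap f h = ap (\<lambda>h. c * p 0 h) h"
      by (rule ap_cong) (simp add: lead_0_const[OF 0(2)] p_0)
    thus ?thesis using ap_p[OF that, of 0] p_0[OF that] by (simp add: ap_cmult)
  qed
  thus ?case by (rule lead_cong[OF lead_const])
next
  case (Suc k)
  obtain l where l: "l \<noteq> 0" "deg (Suc k) (p (Suc k)) l" using p_lead Suc.prems(1) by blast
  let ?g = "\<lambda>h. f h - c / l * p (Suc k) h"
  have "deg (Suc k) ?g (c - c / l * l)"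
    by (intro lead_diff lead_cmult l(2)) fact
  then obtain c' where "deg k ?g c'" using lead_reduce l(1) by fastforce
  hence "deg k (ap ?g) (s' k * c')" using Suc by simp
  hence "deg (Suc k) (ap ?g) 0" by (rule lead_weaken) simp
  hence "deg (Suc k) (\<lambda>h. ap ?g h + (s' (Suc k) * (c / l)) * p (Suc k) h)
      (0 + s' (Suc k) * (c / l) * l)"
    by (intro lead_add lead_cmult l(2))
  hence "deg (Suc k) (\<lambda>h. ap ?g h + (s' (Suc k) * (c / l)) * p (Suc k) h) (s' (Suc k) * c)"
    using l(1) by simp
  moreover have "ap f h = ap ?g h + (s' (Suc k) * (c / l)) * p (Suc k) h" if "h \<le> d" for h
    using ap_p[OF that Suc.prems(1)] by (simp only: ap_diff ap_cmult) (simp add: algebra_simps)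
  ultimately show ?case by (rule lead_cong)
qed

section \<open>Newton basis and diagonal entries of both matrices\<close>

lemma split_seq_0 [simp]: "split_seq 0 = 0" and split_seq_beyond [simp]: "i > d \<Longrightarrow> split_seq i = 0"
  by (auto simp: split_sequence_def)

text \<open>The left hand side is the image of \<open>nw (Suc i)\<close> under \<open>B\<close>,
  evaluated at \<open>s i\<close>: the zeros of \<open>nw (Suc i)\<close> leave only the entry above
  the diagonal. This evaluation is the origin of \<open>split_sequence\<close>.\<close>

lemma split_seq_Suc: "i < d \<Longrightarrow> B i (Suc i) * nw (Suc i) (Suc i) = split_seq (Suc i) * nw i i"
  using newton_neq_0[OF inj_s, of i i] by (simp add: split_sequence_def)

lemma split_seq_neq_0: "1 \<le> i \<Longrightarrow> i \<le> d \<Longrightarrow> split_seq i \<noteq> 0"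
  using newton_neq_0[OF inj_s, of i i] newton_neq_0[OF inj_s, of "i - 1" "i - 1"]
    irreducible_tridiagonalD(2)[OF B, of "i - 1"]
  by (auto simp: split_sequence_def)

text \<open>By \<open>lead_ap\<close> the difference of \<open>ap (nw i)\<close> and
  \<open>s' i * nw i\<close> has degree below \<open>i\<close>; since \<open>B\<close> is
  tridiagonal, it still vanishes at the first \<open>i - 1\<close> points. So it is a multiple of
  \<open>nw (i - 1)\<close>, and the value at \<open>s (i - 1)\<close> gives the factor.\<close>

lemma ap_newton:
  assumes "i \<le> d" "h \<le> d"
  shows "ap (nw i) h = s' i * nw i h + split_seq i * nw (i - 1) h"
proof (cases i)
  case 0
  have "ap (nw 0) h = ap (p 0) h" by (rule ap_cong) (simp add: p_0)
  thus ?thesis using 0 ap_p[OF assms(2), of 0] p_0[OF assms(2)] by simp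
next
  case (Suc j)
  let ?g = "\<lambda>h. ap (nw i) h - s' i * nw i h"
  have "deg (Suc j) ?g (s' i * 1 - s' i * 1)"
    unfolding Suc using Suc assms by (intro lead_diff lead_cmult lead_ap lead_newton) auto
  hence "deg (Suc j) ?g 0" by simp
  from lead_reduce[OF this] obtain c where c: "deg j ?g c" ..
  have "?g h = 0" if "h < j" for h
    using that Suc assms by (simp add: ap_tridiagonal newton_eq_0)
  from lead_eq_newton[OF inj_s _ c this] have g: "?g h = c * nw j h" if "h \<le> d" for h
    using that Suc assms by simp
  from g[of j] have "B j (Suc j) * nw (Suc j) (Suc j) = c * nw j j"
    using Suc assms by (simp add: ap_tridiagonal newton_eq_0 split: if_splits)
  hence "split_seq (Suc j) * nw j j = c * nw j j" using split_seq_Suc[of j] Suc assms by simp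
  hence "c = split_seq (Suc j)" using newton_neq_0[OF inj_s, of j j] Suc assms by simp
  thus ?thesis using g[OF assms(2)] Suc by (simp add: algebra_simps)
qed

lemma B_newton_action: "newton_action d B s s' split_seq"
  unfolding newton_action_def using ap_newton by (simp add: ap_def)

lemma B_diag:
  "i \<le> d \<Longrightarrow> B i i = s' i + split_seq i / (s i - s (i - 1)) + split_seq (i + 1) / (s i - s (i + 1))"
  by (rule newton_action_diag[OF B_newton_action inj_s]) simp_all

text \<open>Second coefficient of \<open>p i\<close> in the Newton basis. The degree
  \<open>i - 1\<close> coefficient of the image of \<open>p i - c * nw i\<close> is computed twice:
  by \<open>lead_ap\<close> with eigenvalue \<open>s' (i - 1)\<close>, and from the known images of
  \<open>p i\<close> and \<open>nw i\<close>. The case \<open>i = 0\<close> is separate, as there is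
  no degree \<open>-1\<close>.\<close>

lemma p_sublead:
  assumes "i \<le> d" "deg i (p i) c"
  shows "i = 0 \<and> (\<forall>h\<le>d. p i h = c * nw i h) \<or>
    i > 0 \<and> deg (i - 1) (\<lambda>h. p i h - c * nw i h) (c * (split_seq i / (s' i - s' (i - 1))))"
proof (cases i)
  case 0
  thus ?thesis using lead_0_const[OF assms(2)[unfolded 0]] by simp
next
  case (Suc j)
  let ?g = "\<lambda>h. p i h - c * nw i h"
  have "deg (Suc j) ?g (c - c * 1)"
    unfolding Suc by (rule lead_diff[OF assms(2)[unfolded Suc] lead_cmult[OF lead_newton]])
  then obtain e where e: "deg j ?g e" using lead_reduce by fastforce
  have "deg j (\<lambda>h. s' i * ?g h - c * split_seq i * nw j h) (s' i * e - c * split_seq i * 1)"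
    by (intro lead_diff[OF lead_cmult lead_cmult] e lead_newton)
  moreover have "ap ?g h = s' i * ?g h - c * split_seq i * nw j h" if "h \<le> d" for h
    using that ap_p[OF that assms(1)] ap_newton[OF assms(1) that] Suc
    by (simp add: ap_diff ap_cmult algebra_simps)
  ultimately have "deg j (ap ?g) (s' i * e - c * split_seq i * 1)"
    by (rule lead_cong)
  moreover have "deg j (ap ?g) (s' j * e)" using e assms(1) Suc by (intro lead_ap) auto
  ultimately have "s' i * e - c * split_seq i = s' j * e"
    using lead_unique[OF inj_s, of j] assms(1) Suc by auto
  moreover have "s' i - s' j \<noteq> 0" using inj_s' assms(1) Suc by (force simp: inj_on_def)
  ultimately have "e = c * (split_seq i / (s' i - s' j))" by (simp add: field_simps)
  thus ?thesis using e Suc by simp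
qed

lemma lead_shift_sublead:
  assumes "i \<le> d" "deg i (p i) c"
  shows "deg i (\<lambda>h. s h * (p i h - c * nw i h)) (c * (split_seq i / (s' i - s' (i - 1))))"
  using p_sublead[OF assms]
proof (elim disjE conjE)
  assume "i = 0" "\<forall>h\<le>d. p i h = c * nw i h"
  moreover have "deg 0 (\<lambda>_. 0) 0" by (rule lead_const)
  ultimately show ?thesis by (auto elim!: lead_cong)
next
  assume "i > 0" "deg (i - 1) (\<lambda>h. p i h - c * nw i h) (c * (split_seq i / (s' i - s' (i - 1))))"
  from lead_shift[OF this(2)] this(1) show ?thesis by simp
qed

text \<open>Comparison of the coefficients of degree \<open>i\<close> in the three-term recurrence,
  after the leading Newton terms have been cancelled.\<close>

lemma X_diag:
  assumes "i \<le> d"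
  shows "X i i = s i + split_seq i / (s' i - s' (i - 1)) + split_seq (i + 1) / (s' i - s' (i + 1))"
proof -
  obtain c where c: "c \<noteq> 0" "deg i (p i) c" using p_lead assms by blast
  have low: "deg i (\<lambda>h. if i = 0 then 0 else p (i - 1) h * X (i - 1) i) 0"
  proof (cases i)
    case 0
    thus ?thesis using lead_const[of d s 0] by simp
  next
    case (Suc j)
    obtain c' where "deg j (p j) c'" using p_lead[of j] Suc assms by auto
    hence "deg i (\<lambda>h. X j i * p j h) (X j i * 0)" using Suc by (intro lead_cmult lead_weaken) auto
    thus ?thesis using Suc by (simp add: mult.commute)
  qed
  let ?e = "\<lambda>i. split_seq i / (s' i - s' (i - 1))"
  \<comment> \<open>By the three-term recurrence this equals
    \<open>X (Suc i) i * p (Suc i) h - c * nw (Suc i) h\<close> for \<open>i < d\<close>; the form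
    chosen here involves only \<open>p i\<close> and lower functions.\<close>
  let ?g = "\<lambda>h. s h * (p i h - c * nw i h) + c * s i * nw i h - X i i * p i h -
    (if i = 0 then 0 else p (i - 1) h * X (i - 1) i)"
  have "deg i ?g (c * ?e i + c * s i * 1 - X i i * c - 0)"
    by (intro lead_diff lead_add lead_shift_sublead lead_cmult lead_newton c low assms)
  moreover have "deg i ?g (c * ?e (i + 1))"
  proof (cases "i < d")
    case True
    let ?c' = "c / X (Suc i) i"
    have nz: "X (Suc i) i \<noteq> 0" using irreducible_tridiagonalD(3)[OF X True] .
    have "i - 1 \<le> d" using assms by simp
    from p_lead[OF this] obtain c' where "i > 0 \<longrightarrow> deg (i - 1) (p (i - 1)) c'" by blast
    hence "deg (Suc i) (p (Suc i)) ?c'" using p_lead_Suc[OF True c(2)] by blast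
    from p_sublead[OF _ this] True
    have "deg i (\<lambda>h. p (Suc i) h - ?c' * nw (Suc i) h) (?c' * ?e (Suc i))" by simp
    from lead_cmult[OF this, of "X (Suc i) i"]
    have "deg i (\<lambda>h. X (Suc i) i * (p (Suc i) h - ?c' * nw (Suc i) h)) (c * ?e (i + 1))"
      using nz by simp
    thus ?thesis
      using True nz by (elim lead_cong) (simp add: newton_Suc algebra_simps three_term[OF _ assms])
  next
    case False
    hence id: "i = d" using assms by simp
    \<comment> \<open>No \<open>p (d + 1)\<close> exists; what remains is a multiple of
      \<open>nw (d + 1)\<close>, which vanishes at every point.\<close>
    have "?g h = 0" if "h \<le> d" for h
    proof -
      have "nw d h * (s h - s d) = 0" using newton_eq_0[of h "Suc d" s] that by (simp add: newton_Suc)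
      hence "nw d h = 0 \<or> s h = s d" by simp
      moreover note three_term[OF that assms]
      ultimately show ?thesis using id by (auto simp: algebra_simps)
    qed
    moreover have "deg i (\<lambda>_. 0) 0"
      using lead_cmult[OF c(2), of 0] by simp
    ultimately show ?thesis using id by (auto elim!: lead_cong)
  qed
  ultimately have "c * ?e i + c * s i - X i i * c = c * ?e (i + 1)"
    using lead_unique[OF inj_s assms] by fastforce
  hence "c * X i i = c * (s i + ?e i - ?e (i + 1))" by (simp add: algebra_simps)
  hence "X i i = s i + ?e i - ?e (i + 1)" using c(1) by simp
  moreover have "?e (i + 1) = - (split_seq (i + 1) / (s' i - s' (i + 1)))"
    by (metis add_diff_cancel_right' divide_minus_right minus_diff_eq)
  ultimately show ?thesis by simp
qed

end

section \<open>Three-term recurrences\<close>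

text \<open>Indexing by the integers spares the boundary terms: an eigenvalue sequence is
  extended by the recurrence in both directions.\<close>

definition recurrent :: "'a::field \<Rightarrow> 'a \<Rightarrow> (int \<Rightarrow> 'a) \<Rightarrow> bool" where
  "recurrent b g x \<longleftrightarrow> (\<forall>i. x (i - 1) - b * x i + x (i + 1) = g)"

lemma recurrentD: "recurrent b g x \<Longrightarrow> x (i + 1) = g + b * x i - x (i - 1)"
  unfolding recurrent_def by (drule spec[of _ i]) (metis add.commute add_diff_cancel_left' diff_add_cancel diff_diff_eq2)

lemma recurrent_prev: "recurrent b g x \<Longrightarrow> x (i - 1) = g + b * x i - x (i + 1)"
  by (simp add: recurrentD)

lemma recurrent_next2: "recurrent b g x \<Longrightarrow> x (i + 2) = g + b * x (i + 1) - x i"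
  using recurrentD[of b g x "i + 1"] by (simp add: add.assoc)

lemma recurrent_reverse: "recurrent b g x \<Longrightarrow> recurrent b g (\<lambda>i. x (m - i))"
  unfolding recurrent_def
proof
  fix i assume *: "\<forall>i. x (i - 1) - b * x i + x (i + 1) = g"
  have "x (m - i - 1) - b * x (m - i) + x (m - i + 1) = g" using * by blast
  thus "x (m - (i - 1)) - b * x (m - i) + x (m - (i + 1)) = g"
    by (simp add: algebra_simps)
qed

fun iterate_recurrence :: "'a::field \<Rightarrow> 'a \<Rightarrow> 'a \<Rightarrow> 'a \<Rightarrow> nat \<Rightarrow> 'a" where
  "iterate_recurrence b g u v 0 = u"
| "iterate_recurrence b g u v (Suc 0) = v"
| "iterate_recurrence b g u v (Suc (Suc n)) =
     g + b * iterate_recurrence b g u v (Suc n) - iterate_recurrence b g u v n"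

lemma recurrent_extension:
  assumes "\<And>i. i + 2 \<le> d \<Longrightarrow> t i - b * t (i + 1) + t (i + 2) = g"
  shows "\<exists>x. recurrent b g x \<and> (\<forall>i\<le>d. x (int i) = t i)"
proof -
  \<comment> \<open>The recurrence is symmetric under reversal: the iteration started with
    \<open>t 1, t 0\<close> runs to the left, its index \<open>n\<close> standing for the position
    \<open>1 - n\<close>.\<close>
  let ?u = "iterate_recurrence b g (t 0) (t 1)" and ?v = "iterate_recurrence b g (t 1) (t 0)"
  define x where "x i = (if i \<ge> 0 then ?u (nat i) else ?v (nat (1 - i)))" for i
  have pos: "x (int n) = ?u n" for n by (simp add: x_def)
  have neg: "x (1 - int n) = ?v n" for n
  proof (cases "n \<le> 1")
    case True
    hence "n = 0 \<or> n = 1" by auto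
    thus ?thesis by (auto simp: x_def)
  qed (simp add: x_def)
  have "x (i - 1) - b * x i + x (i + 1) = g" for i
  proof (cases "i \<ge> 1")
    case True
    define n where "n = nat (i - 1)"
    have n: "i = int (Suc n)" using True by (simp add: n_def)
    have "i - 1 = int n" "i = int (Suc n)" "i + 1 = int (Suc (Suc n))" using n by auto
    thus ?thesis by (simp only: pos) (simp add: algebra_simps)
  next
    case False
    define n where "n = nat (- i)"
    have "i - 1 = 1 - int (Suc (Suc n))" "i = 1 - int (Suc n)" "i + 1 = 1 - int n"
      using False by (auto simp: n_def)
    thus ?thesis by (simp only: neg) (simp add: algebra_simps)
  qed
  moreover have "?u i = t i" if "i \<le> d" for i
    using that
  proof (induction i rule: less_induct)
    case (less i)
    show ?case
    proof (cases "i \<le> 1")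
      case True
      hence "i = 0 \<or> i = 1" by auto
      thus ?thesis by auto
    next
      case False
      define n where "n = i - 2"
      have n: "i = Suc (Suc n)" using False by (simp add: n_def)
      have "?u i = g + b * t (Suc n) - t n" using n less.IH[of n] less.IH[of "Suc n"] less.prems by simp
      also have "\<dots> = t i" using assms[of n] n less.prems by (simp add: algebra_simps)
      finally show ?thesis .
    qed
  qed
  ultimately show ?thesis by (intro exI[of _ x]) (auto simp: recurrent_def pos)
qed

lemma int_sequence_constant:
  fixes f :: "int \<Rightarrow> 'a"
  assumes "\<And>i. f (i + 1) = f i"
  shows "f i = f 0"
proof (induction i rule: int_induct[of _ 0])
  case (step2 i)
  thus ?case using assms[of "i - 1"] by simp
qed (use assms in auto)

text \<open>A first integral: consecutive values differ by \<open>x (i + 2) - x i\<close> times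
  \<open>x (i + 2) - b * x (i + 1) + x i - g\<close>, which is 0. This will annihilate the
  off-diagonal entries of the Askey-Wilson expression.\<close>

lemma recurrent_quadratic:
  assumes "recurrent b g x"
  obtains r where "\<And>i. x i ^ 2 - b * x i * x (i + 1) + x (i + 1) ^ 2 - g * (x i + x (i + 1)) = r"
proof -
  let ?f = "\<lambda>i. x i ^ 2 - b * x i * x (i + 1) + x (i + 1) ^ 2 - g * (x i + x (i + 1))"
  have "?f (i + 1) = ?f i" for i
  proof -
    have "x (i + 1 + 1) = g + b * x (i + 1) - x i" using recurrentD[OF assms, of "i + 1"] by simp
    thus ?thesis by (simp only:) (simp add: algebra_simps power2_eq_square)
  qed
  from int_sequence_constant[of ?f, OF this] show thesis by (rule that)
qed

text \<open>The polynomial \<open>x i ^ 2 - b * x i * z + z ^ 2 - g * (x i + z) - r\<close> in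
  \<open>z\<close> has the roots \<open>x (i - 1)\<close> and \<open>x (i + 1)\<close>; the left
  hand side is its value at \<open>z = x i\<close>.\<close>

lemma recurrent_diag:
  assumes "recurrent b g x"
    and "\<And>i. x i ^ 2 - b * x i * x (i + 1) + x (i + 1) ^ 2 - g * (x i + x (i + 1)) = r"
  shows "x i ^ 2 * (2 - b) - 2 * g * x i - r = (x i - x (i - 1)) * (x i - x (i + 1))"
  unfolding assms(2)[of i, symmetric] recurrent_prev[OF assms(1), of i]
  by (simp add: algebra_simps power2_eq_square)

text \<open>For a bidiagonal pair as in the split basis, the difference of the two sides of the Askey-Wilson
  relation
  \<open>A\<^sup>2 A* - b A A* A + A* A\<^sup>2 - g (A A* + A* A) - r A* = g' A\<^sup>2 + w A + e\<close> has components of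
  degree \<open>-1, \<dots>, 2\<close>.  Those of degree \<open>-1\<close> and \<open>2\<close> vanish by the recurrences for
  the eigenvalues; the others state that \<open>aw1\<close> equals \<open>w\<close> and that \<open>aw0\<close> at \<open>i\<close>
  equals \<open>w x\<^sub>i + e\<close>.\<close>

definition aw1 :: "'a::field \<Rightarrow> 'a \<Rightarrow> 'a \<Rightarrow> (int \<Rightarrow> 'a) \<Rightarrow> (int \<Rightarrow> 'a) \<Rightarrow> (nat \<Rightarrow> 'a) \<Rightarrow> nat \<Rightarrow> 'a" where
  "aw1 b g g' x y f i = f i - b * f (i + 1) + f (i + 2)
     + (x (int i) + x (int i + 1)) * (y (int i) + y (int i + 1)) - b * (x (int i) * y (int i) + x (int i + 1) * y (int i + 1))
     - g * (y (int i) + y (int i + 1)) - g' * (x (int i) + x (int i + 1))"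

definition aw0 :: "'a::field \<Rightarrow> (int \<Rightarrow> 'a) \<Rightarrow> (int \<Rightarrow> 'a) \<Rightarrow> (nat \<Rightarrow> 'a) \<Rightarrow> nat \<Rightarrow> 'a" where
  "aw0 g' x y f i = f i * (x (int i) - x (int i + 1)) + f (i + 1) * (x (int i) - x (int i - 1))
     + y (int i) * (x (int i) - x (int i - 1)) * (x (int i) - x (int i + 1)) - g' * x (int i) ^ 2"

text \<open>If \<open>aw1\<close> is constantly \<open>w\<close>, then \<open>aw0\<close> is affine
  in \<open>x\<close> with slope \<open>w\<close>, and conversely where consecutive \<open>x\<close>
  are distinct. Thus only the constant \<open>e\<close> remains to be compared.\<close>

lemma aw0_Suc:
  assumes "recurrent b g x"
  shows "aw0 g' x y f (Suc i) - aw0 g' x y f i = (x (int i + 1) - x (int i)) * aw1 b g g' x y f i"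
proof -
  define u0 u1 u2 u3 where u: "u0 = x (int i - 1)" "u1 = x (int i)" "u2 = x (int i + 1)" "u3 = x (int i + 2)"
  define v1 v2 where v: "v1 = y (int i)" "v2 = y (int i + 1)"
  have r: "u0 = g + b * u1 - u2" "u3 = g + b * u2 - u1"
    unfolding u by (rule recurrent_prev[OF assms] recurrent_next2[OF assms])+
  have i: "int (Suc i) - 1 = int i" "int (Suc i) + 1 = int i + 2" "int (Suc i) = int i + 1"
    "Suc i + 1 = i + 2" "Suc i = i + 1" by auto
  have 1: "aw0 g' x y f (Suc i) = f (i + 1) * (u2 - u3) + f (i + 2) * (u2 - u1)
     + v2 * (u2 - u1) * (u2 - u3) - g' * u2 ^ 2"
    unfolding aw0_def u v i(1,2) by (simp add: add_ac)
  have 2: "aw0 g' x y f i = f i * (u1 - u2) + f (i + 1) * (u1 - u0)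
     + v1 * (u1 - u0) * (u1 - u2) - g' * u1 ^ 2"
    unfolding aw0_def u v ..
  have 3: "aw1 b g g' x y f i = f i - b * f (i + 1) + f (i + 2)
     + (u1 + u2) * (v1 + v2) - b * (u1 * v1 + u2 * v2) - g * (v1 + v2) - g' * (u1 + u2)"
    unfolding aw1_def u v ..
  have 4: "x (int i + 1) - x (int i) = u2 - u1" unfolding u ..
  show ?thesis unfolding 1 2 3 4 r by (simp add: algebra_simps power2_eq_square)
qed

lemma aw1_symmetric: "aw1 b g g' x y f = aw1 b g' g y x f"
  by (rule ext) (simp add: aw1_def algebra_simps)

section \<open>The explicit formula as a solution of the recurrence\<close>

definition dsum :: "nat \<Rightarrow> (int \<Rightarrow> 'a::field) \<Rightarrow> nat \<Rightarrow> 'a" where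
  "dsum d x i = (\<Sum>h<i. x (int h) - x (int d - int h))"

text \<open>The formula for the split sequences in a parameter array, with the denominator
  \<open>th 0 - th d\<close> absorbed in \<open>k\<close>. On integer-indexed sequences it makes
  sense for all \<open>i\<close>; it vanishes at \<open>i = 0\<close> and at
  \<open>i = d + 1\<close>, the latter because both \<open>dsum\<close> and
  \<open>x (i - 1) - x d\<close> do.\<close>

definition split_formula ::
    "nat \<Rightarrow> (int \<Rightarrow> 'a::field) \<Rightarrow> (int \<Rightarrow> 'a) \<Rightarrow> 'a \<Rightarrow> nat \<Rightarrow> 'a" where
  "split_formula d x y k i = k * dsum d x i + (y i - y 0) * (x (int i - 1) - x d)"

lemma dsum_0 [simp]: "dsum d x 0 = 0" by (simp add: dsum_def)

lemma dsum_Suc: "dsum d x (Suc i) = dsum d x i + (x (int i) - x (int d - int i))"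
  by (simp add: dsum_def)

lemma dsum_Suc_d [simp]: "dsum d x (Suc d) = 0"
proof -
  have "(\<Sum>h\<le>d. x (int d - int h)) = (\<Sum>h\<le>d. x (int h))"
    by (rule sum.reindex_bij_witness[of _ "\<lambda>h. d - h" "\<lambda>h. d - h"]) (auto simp: of_nat_diff)
  thus ?thesis by (simp add: dsum_def lessThan_Suc_atMost sum_subtractf)
qed

lemma dsum_d: "dsum d x d = x 0 - x d"
proof -
  have "dsum d x d + (x (int d) - x 0) = 0" using dsum_Suc[of d x d] by simp
  thus ?thesis by (metis add_implies_diff diff_0 minus_diff_eq)
qed

lemma split_formula_eq:
  assumes x: "\<And>i. i \<le> d \<Longrightarrow> x (int i) = t i" and y: "\<And>i. i \<le> d \<Longrightarrow> y (int i) = t' i"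
    and i: "1 \<le> i" "i \<le> d"
  shows "split_formula d x y (c / (t 0 - t d)) i =
    c * (\<Sum>h\<in>{0..i-1}. (t h - t (d - h)) / (t 0 - t d)) + (t' i - t' 0) * (t (i - 1) - t d)"
proof -
  have "dsum d x i = (\<Sum>h<i. t h - t (d - h))"
    unfolding dsum_def using i(2) x
    by (intro sum.cong) (auto simp: of_nat_diff[symmetric] simp del: of_nat_diff)
  moreover have "{..<i} = {0..i-1}" using i(1) by auto
  moreover have "x (int i - 1) = t (i - 1)" using x[of "i - 1"] i by (simp add: of_nat_diff)
  ultimately show ?thesis
    using y[of 0] x[of d] y[of i] i
    by (simp add: split_formula_def sum_divide_distrib[symmetric] mult_ac)
qed

text \<open>Two consecutive values of the three-term expression differ by
  \<open>t i - t (i + 3) - c * (t (i + 1) - t (i + 2))\<close>. This is the origin of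
  \<open>b = c - 1\<close>.\<close>

lemma four_term_recurrence:
  fixes t :: "nat \<Rightarrow> 'a::field"
  assumes "\<And>i. i + 3 \<le> d \<Longrightarrow> t i - t (i + 3) = c * (t (i + 1) - t (i + 2))"
  shows "i + 2 \<le> d \<Longrightarrow> t i - (c - 1) * t (i + 1) + t (i + 2) = t 0 - (c - 1) * t 1 + t 2"
proof (induction i)
  case (Suc i)
  have "t i - t (i + 3) = c * (t (i + 1) - t (i + 2))" using assms[of i] Suc.prems by simp
  hence "t i - (c - 1) * t (i + 1) + t (i + 2) = t (i + 1) - (c - 1) * t (i + 2) + t (i + 3)"
    by (simp add: algebra_simps)
  thus ?case using Suc by (simp add: eval_nat_numeral)
qed (simp add: numeral_2_eq_2)

lemma dsum_recurrence:
  assumes "recurrent b g x"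
  shows "dsum d x i - b * dsum d x (i + 1) + dsum d x (i + 2) = dsum d x 2 - b * dsum d x 1"
proof (induction i)
  case (Suc i)
  have 1: "x (int i) = g + b * x (int i + 1) - x (int i + 2)"
    using recurrent_next2[OF assms, of "int i"] by simp
  have 2: "x (int d - int i) = g + b * x (int d - int i - 1) - x (int d - int i - 2)"
    using recurrentD[OF assms, of "int d - int i - 1"] by (simp add: algebra_simps)
  have i: "Suc i + 1 = Suc (i + 1)" "Suc i + 2 = Suc (i + 2)" by auto
  have "dsum d x (Suc i) - b * dsum d x (Suc i + 1) + dsum d x (Suc i + 2) =
     (dsum d x i - b * dsum d x (i + 1) + dsum d x (i + 2))"
    unfolding i dsum_Suc by (subst 1, subst 2) (simp add: algebra_simps)
  thus ?case using Suc by simp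
qed (simp add: numeral_2_eq_2)

text \<open>By \<open>dsum_recurrence\<close> the multiplier \<open>k\<close> contributes a
  constant, which reduces the claim to \<open>k = 0\<close>; there it is a polynomial identity in
  four consecutive terms once the recurrences are inserted.\<close>

lemma aw1_split_formula:
  assumes x: "recurrent b g x" and y: "recurrent b g' y"
  shows "aw1 b g g' x y (split_formula d x y k) i = aw1 b g g' x y (split_formula d x y k) 0"
proof (induction i)
  case (Suc i)
  let ?D = "\<lambda>i. dsum d x i - b * dsum d x (i + 1) + dsum d x (i + 2)"
  have D: "?D (Suc i) = ?D i" using dsum_recurrence[OF x, of d] by metis
  have e: "aw1 b g g' x y (split_formula d x y k) j = k * ?D j +
     aw1 b g g' x y (split_formula d x y 0) j" for j
    by (simp add: aw1_def split_formula_def algebra_simps)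
  define u0 u1 u2 u3 where u: "u0 = x (int i - 1)" "u1 = x (int i)" "u2 = x (int i + 1)" "u3 = x (int i + 2)"
  define v1 v2 v3 v4 where v: "v1 = y (int i)" "v2 = y (int i + 1)" "v3 = y (int i + 2)" "v4 = y (int i + 3)"
  define X Y where XY: "X = x (int d)" "Y = y 0"
  have r: "u0 = g + b * u1 - u2" "u3 = g + b * u2 - u1" "v3 = g' + b * v2 - v1"
      "v4 = g' + b * v3 - v2"
    unfolding u v using recurrent_next2[OF y, of "int i + 1"]
    by (simp_all add: recurrent_prev[OF x] recurrent_next2[OF x] recurrent_next2[OF y] add.assoc)
  have 1: "aw1 b g g' x y (split_formula d x y 0) i = (v1 - Y) * (u0 - X) - b * ((v2 - Y) * (u1 - X))
     + (v3 - Y) * (u2 - X) + (u1 + u2) * (v1 + v2) - b * (u1 * v1 + u2 * v2)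
     - g * (v1 + v2) - g' * (u1 + u2)"
    unfolding aw1_def split_formula_def u v XY by (simp add: add_ac)
  have 2: "aw1 b g g' x y (split_formula d x y 0) (Suc i) = (v2 - Y) * (u1 - X) - b * ((v3 - Y) * (u2 - X))
     + (v4 - Y) * (u3 - X) + (u2 + u3) * (v2 + v3) - b * (u2 * v2 + u3 * v3)
     - g * (v2 + v3) - g' * (u2 + u3)"
    unfolding aw1_def split_formula_def u v XY by (simp add: add_ac)
  have "aw1 b g g' x y (split_formula d x y 0) (Suc i) = aw1 b g g' x y (split_formula d x y 0) i"
    unfolding 1 2 r by (simp add: algebra_simps)
  hence "aw1 b g g' x y (split_formula d x y k) (Suc i) = aw1 b g g' x y (split_formula d x y k) i"
    unfolding e D by simp
  thus ?case using Suc by simp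
qed simp

text \<open>If the conclusion failed, then \<open>x\<close> would be an affine combination of \<open>f\<close> and its
  difference sequence, both of which vanish at \<open>0\<close> and \<open>d\<close>.\<close>

lemma recurrence_unique:
  fixes f :: "nat \<Rightarrow> 'a::field"
  assumes x: "recurrent b g x" and ne: "x 0 \<noteq> x (int d)" and d: "d \<ge> 1"
    and f: "\<And>i. i < d \<Longrightarrow> f i - b * f (i + 1) + f (i + 2) = k"
    and f0: "f 0 = 0" "f 1 = 0" "f d = 0" "f (d + 1) = 0"
  shows "i \<le> d + 1 \<Longrightarrow> f i = 0"
proof (cases "k = 0")
  case True
  have "f j = 0 \<and> f (Suc j) = 0" if "j \<le> d" for j
    using that f0(1,2)
  proof (induction j)
    case (Suc j)
    thus ?case using f[of j] True by (auto simp: eval_nat_numeral)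
  qed auto
  from this[of "i - 1"] show "i \<le> d + 1 \<Longrightarrow> f i = 0" using f0 by (cases i) auto
next
  case False
  \<comment> \<open>\<open>m\<close> matches the constant terms of the two recurrences;
    \<open>l\<close> matches the values at 1, where \<open>f 2 = k\<close>.\<close>
  define m where "m = (g - (2 - b) * x 0) / k"
  define l where "l = (x 1 - x 0) / k"
  have f2: "f (i + 2) = k + b * f (i + 1) - f i" if "i < d" for i
    using f[OF that] by (simp add: algebra_simps)
  have "x (int i) = x 0 + l * (f (i + 1) - f i) + m * f i" if "i \<le> d" for i
    using that
  proof (induction i rule: less_induct)
    case (less i)
    show ?case
    proof (cases "i \<le> 1")
      case True
      hence "i = 0 \<or> i = 1" by auto
      moreover have "f 2 = k" using f2[of 0] f0 d by (simp add: numeral_2_eq_2)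
      ultimately show ?thesis using False f0 by (auto simp: l_def numeral_2_eq_2)
    next
      case gt: False
      define n where "n = i - 2"
      have i: "i = n + 2" using gt by (simp add: n_def)
      have "x (int i) = g + b * x (int (n + 1)) - x (int n)"
        using recurrent_next2[OF x, of "int n"] i by (simp add: add_ac)
      also have "\<dots> = g + b * (x 0 + l * (f (n + 2) - f (n + 1)) + m * f (n + 1)) -
          (x 0 + l * (f (n + 1) - f n) + m * f n)"
        using less.IH[of n] less.IH[of "n + 1"] i less.prems by (simp add: eval_nat_numeral)
      also have "\<dots> = x 0 + l * (f (n + 3) - f (n + 2)) + m * f (n + 2)"
      proof -
        have "f (n + 3) = k + b * f (n + 2) - f (n + 1)"
          using f2[of "n + 1"] i less.prems by (simp add: eval_nat_numeral)
        moreover have fn: "f (n + 2) = k + b * f (n + 1) - f n" using f2[of n] i less.prems by simp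
        moreover have "m * k = g - (2 - b) * x 0" using False by (simp add: m_def)
        hence "g = m * k + (2 - b) * x 0" by simp
        ultimately show ?thesis by (simp only:) (simp add: algebra_simps)
      qed
      finally show ?thesis using i by (simp add: eval_nat_numeral)
    qed
  qed
  from this[of d] f0 ne show "i \<le> d + 1 \<Longrightarrow> f i = 0" by simp
qed

section \<open>The recurrence satisfied by the eigenvalues\<close>

lemma lead_mult_power: "lead d s k f c \<Longrightarrow> lead d s (m + k) (\<lambda>h. s h ^ m * f h) c"
proof (induction m)
  case (Suc m)
  from lead_shift[OF Suc.IH[OF Suc.prems]] show ?case by (simp add: mult_ac)
qed simp

lemma lead_poly:
  assumes "lead d s k f c"
  obtains a where "a k = c" "\<And>h. h \<le> d \<Longrightarrow> f h = (\<Sum>i\<le>k. a i * s h ^ i)"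
proof -
  obtain g where g: "\<And>n. n > k \<Longrightarrow> coeff g n = 0" "coeff g k = c"
    "\<And>h. h \<le> d \<Longrightarrow> f h = poly g (s h)" using assms by (erule leadE)
  have "degree g \<le> k" by (rule degree_le) (use g(1) in auto)
  hence "poly g x = (\<Sum>i\<le>k. coeff g i * x ^ i)" for x
    unfolding poly_altdef
    by (intro sum.mono_neutral_left) (auto intro: coeff_eq_0)
  thus thesis using that[of "coeff g"] g(2,3) by simp
qed

context leonard_model
begin

lemma s_neq: "i \<le> d \<Longrightarrow> j \<le> d \<Longrightarrow> i \<noteq> j \<Longrightarrow> s i \<noteq> s j"
  using inj_s by (auto simp: inj_on_def)

lemma s'_neq: "i \<le> d \<Longrightarrow> j \<le> d \<Longrightarrow> i \<noteq> j \<Longrightarrow> s' i \<noteq> s' j"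
  using inj_s' by (auto simp: inj_on_def)

lemma ap_1: "h \<le> d \<Longrightarrow> ap (\<lambda>_. 1) h = s' 0"
  using ap_newton[of 0 h] by simp

text \<open>The operator \<open>z\<close> below commutes with multiplication by \<open>s\<close>, and its commutator
  with \<open>B\<close> is \<open>s\<^sup>2 B s - s B s\<^sup>2\<close>.  Applied to the constant function, this shows
  that \<open>z\<close> is cubic in \<open>s\<close>.\<close>

lemma cubic_commutator:
  assumes d: "d \<ge> 3"
  obtains a :: "nat \<Rightarrow> 'a" where
    "\<And>i. i < d \<Longrightarrow> (\<Sum>m\<le>3. a m * s (Suc i) ^ m) - (\<Sum>m\<le>3. a m * s i ^ m) =
       s i * s (Suc i) * (s (Suc i) - s i)"
    "\<And>i. i + 3 \<le> d \<Longrightarrow> a 3 * (s' i - s' (i + 3)) = s' (i + 1) - s' (i + 2)"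
proof -
  \<comment> \<open>Summed up so that \<open>z h - z k = s h * s k * (s h - s k)\<close> for
    neighbouring \<open>h\<close> and \<open>k\<close>, the only off-diagonal positions at which
    \<open>B\<close> is nonzero.\<close>
  define z where "z j = (\<Sum>h<j. s h * s (Suc h) * (s (Suc h) - s h))" for j
  have z: "z (Suc i) = z i + s i * s (Suc i) * (s (Suc i) - s i)" for i by (simp add: z_def)
  have comm: "z h * ap f h - ap (\<lambda>k. z k * f k) h =
      s h ^ 2 * ap (\<lambda>k. s k * f k) h - s h * ap (\<lambda>k. s k ^ 2 * f k) h" if "h \<le> d" for f h
    using that by (cases h) (auto simp: ap_tridiagonal z algebra_simps power2_eq_square)
  have deg3: "deg (i + 3) (\<lambda>h. s h ^ 2 * ap (\<lambda>k. s k * nw i k) h - s h * ap (\<lambda>k. s k ^ 2 * nw i k) h)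
      (s' (i + 1) * 1 - s' (i + 2) * 1)" if "i + 2 \<le> d" for i
  proof (rule lead_diff)
    have "deg (2 + (i + 1)) (\<lambda>h. s h ^ 2 * ap (\<lambda>k. s k * nw i k) h) (s' (i + 1) * 1)"
      using that lead_shift[OF lead_newton[of d s i]] by (intro lead_mult_power lead_ap) auto
    moreover have "2 + (i + 1) = i + 3" by simp
    ultimately show "deg (i + 3) (\<lambda>h. s h ^ 2 * ap (\<lambda>k. s k * nw i k) h) (s' (i + 1) * 1)" by metis
    have "deg (i + 2) (\<lambda>k. s k ^ 2 * nw i k) 1"
      using lead_mult_power[OF lead_newton[of d s i], of 2] by (simp add: add.commute)
    hence "deg (Suc (i + 2)) (\<lambda>h. s h * ap (\<lambda>k. s k ^ 2 * nw i k) h) (s' (i + 2) * 1)"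
      using that by (intro lead_shift lead_ap) auto
    moreover have "Suc (i + 2) = i + 3" by simp
    ultimately show "deg (i + 3) (\<lambda>h. s h * ap (\<lambda>k. s k ^ 2 * nw i k) h) (s' (i + 2) * 1)" by metis
  qed
  obtain c where c: "deg d z c" using lead_interpolation[OF inj_s] by blast
  \<comment> \<open>At the constant function the commutator gives degree at most 3 on one side and
    the coefficient \<open>(s' 0 - s' i) * b\<close> in degree \<open>i\<close> on the
    other.\<close>
  have "b = 0" if i: "3 < i" "i \<le> d" and b: "deg i z b" for i b
  proof -
    have "deg i (\<lambda>h. s' 0 * z h - ap z h) (s' 0 * b - s' i * b)"
      by (intro lead_diff lead_cmult lead_ap b i)
    moreover have "deg i (\<lambda>h. s h ^ 2 * ap (\<lambda>k. s k * nw 0 k) h - s h * ap (\<lambda>k. s k ^ 2 * nw 0 k) h) 0"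
      using lead_weaken[OF deg3[of 0]] i d by simp
    moreover have "s' 0 * z h - ap z h = s h ^ 2 * ap (\<lambda>k. s k * nw 0 k) h - s h * ap (\<lambda>k. s k ^ 2 * nw 0 k) h"
      if "h \<le> d" for h
      using comm[OF that, of "\<lambda>_. 1"] ap_1[OF that] by (simp add: mult.commute)
    ultimately have "s' 0 * b - s' i * b = 0"
      using lead_unique[OF inj_s i(2)] by (metis (no_types, lifting) lead_cong)
    thus "b = 0" using s'_neq[of 0 i] i by (simp add: left_diff_distrib[symmetric])
  qed
  hence "\<exists>b. deg 3 z b" using lead_descend[of d s 3 "d - 3" z c] c d by auto
  then obtain g where "deg 3 z g" ..
  then obtain a where a: "a 3 = g" "\<And>h. h \<le> d \<Longrightarrow> z h = (\<Sum>m\<le>3. a m * s h ^ m)"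
    by (rule lead_poly) blast
  show thesis
  proof (rule that)
    fix i assume i: "i < d"
    have "z (Suc i) - z i = s i * s (Suc i) * (s (Suc i) - s i)" by (simp add: z)
    thus "(\<Sum>m\<le>3. a m * s (Suc i) ^ m) - (\<Sum>m\<le>3. a m * s i ^ m) =
       s i * s (Suc i) * (s (Suc i) - s i)"
      using i by (simp only: a(2) Suc_leI less_imp_le)
  next
    fix i assume i: "i + 3 \<le> d"
    have mult_z: "deg (i + 3) (\<lambda>h. z h * f h) (a 3 * c)" if f: "deg i f c" for f c
    proof -
      have pw: "deg (i + 3) (\<lambda>h. a m * (s h ^ m * f h)) (a m * 0)" if "m < 3" for m
        using that by (intro lead_cmult lead_weaken[OF lead_mult_power[OF f, of m]]) auto
      have "deg (i + 3) (\<lambda>h. a 3 * (s h ^ 3 * f h)) (a 3 * c)"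
        using lead_mult_power[OF f, of 3] by (intro lead_cmult) (simp add: add.commute)
      from lead_add[OF lead_add[OF lead_add[OF pw[of 0] pw[of 1]] pw[of 2]] this]
      have "deg (i + 3) (\<lambda>h. a 0 * (s h ^ 0 * f h) + a 1 * (s h ^ 1 * f h) + a 2 * (s h ^ 2 * f h)
          + a 3 * (s h ^ 3 * f h)) (a 3 * c)" by simp
      thus ?thesis by (rule lead_cong) (simp add: a eval_nat_numeral algebra_simps)
    qed
    have "deg (i + 3) (\<lambda>h. z h * ap (nw i) h - ap (\<lambda>k. z k * nw i k) h)
        (a 3 * (s' i * 1) - s' (i + 3) * (a 3 * 1))"
      using i by (intro lead_diff mult_z lead_ap lead_newton) auto
    moreover have "deg (i + 3) (\<lambda>h. z h * ap (nw i) h - ap (\<lambda>k. z k * nw i k) h)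
        (s' (i + 1) * 1 - s' (i + 2) * 1)"
      by (rule lead_cong[OF deg3]) (use i comm in auto)
    ultimately have "a 3 * (s' i * 1) - s' (i + 3) * (a 3 * 1) = s' (i + 1) * 1 - s' (i + 2) * 1"
      using lead_unique[OF inj_s i] by blast
    thus "a 3 * (s' i - s' (i + 3)) = s' (i + 1) - s' (i + 2)" by (simp add: algebra_simps)
  qed
qed

text \<open>For \<open>d \<ge> 3\<close> the cubic equation is divided twice: by
  \<open>s (i + 1) - s i\<close> and, after subtracting neighbouring equations, by
  \<open>s (i + 2) - s i\<close>. The result is the recurrence for \<open>s\<close> with
  \<open>b = 1 / a 3 - 1\<close>, the value that the second property of \<open>a\<close> gives for
  \<open>s'\<close>.\<close>

lemma eigenvalue_recurrence:
  obtains b g g' where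
    "\<And>i. i + 2 \<le> d \<Longrightarrow> s i - b * s (i + 1) + s (i + 2) = g"
    "\<And>i. i + 2 \<le> d \<Longrightarrow> s' i - b * s' (i + 1) + s' (i + 2) = g'"
proof (cases "d \<ge> 3")
  case False
  show thesis
  proof (rule that)
    fix i assume "i + 2 \<le> d"
    hence "i = 0" using False by simp
    thus "s i - 0 * s (i + 1) + s (i + 2) = s 0 + s 2" "s' i - 0 * s' (i + 1) + s' (i + 2) = s' 0 + s' 2"
      by (simp_all add: numeral_2_eq_2)
  qed
next
  case d: True
  obtain a where a: "\<And>i. i < d \<Longrightarrow> (\<Sum>m\<le>3. a m * s (Suc i) ^ m) - (\<Sum>m\<le>3. a m * s i ^ m) =
       s i * s (Suc i) * (s (Suc i) - s i)"
    and s': "\<And>i. i + 3 \<le> d \<Longrightarrow> a 3 * (s' i - s' (i + 3)) = s' (i + 1) - s' (i + 2)"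
    by (rule cubic_commutator[OF d]) blast
  define c where "c = a 3"
  have c: "c \<noteq> 0" using s'[of 0] s'_neq[of 1 2] d by (auto simp: c_def numeral_2_eq_2)
  have P: "s i * s (Suc i) = c * (s i ^ 2 + s i * s (Suc i) + s (Suc i) ^ 2)
      + a 2 * (s i + s (Suc i)) + a 1" if "i < d" for i
  proof -
    let ?R = "c * (s i ^ 2 + s i * s (Suc i) + s (Suc i) ^ 2) + a 2 * (s i + s (Suc i)) + a 1"
    have "s i * s (Suc i) * (s (Suc i) - s i) = ?R * (s (Suc i) - s i)"
      using a[OF that] by (simp add: c_def eval_nat_numeral algebra_simps)
    thus ?thesis using s_neq[of i "Suc i"] that by simp
  qed
  show thesis
  proof (rule that)
    fix i assume i: "i + 2 \<le> d"
    have aux: "(w - u) * (v - (c * (u + v + w) + a 2)) =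
        (v * w - (c * (v ^ 2 + v * w + w ^ 2) + a 2 * (v + w) + a 1)) -
        (u * v - (c * (u ^ 2 + u * v + v ^ 2) + a 2 * (u + v) + a 1))" for u v w
      by (simp add: algebra_simps power2_eq_square)
    have e: "x - y = 0" if "x = y" for x y :: 'a using that by simp
    have "(s (i + 2) - s i) * (s (i + 1) - (c * (s i + s (i + 1) + s (i + 2)) + a 2)) = 0"
      unfolding aux using e[OF P[of i]] e[OF P[of "Suc i"]] i by simp
    hence "s (i + 1) = c * (s i + s (i + 1) + s (i + 2)) + a 2" using s_neq[of i "i + 2"] i by auto
    hence "s (i + 1) / c = (c * (s i + s (i + 1) + s (i + 2)) + a 2) / c" by (rule arg_cong)
    also have "\<dots> = s i + s (i + 1) + s (i + 2) + a 2 / c" using c by (simp add: add_divide_distrib)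
    finally show "s i - (1 / c - 1) * s (i + 1) + s (i + 2) = - a 2 / c" by (simp add: algebra_simps)
  next
    have "s' i - s' (i + 3) = 1 / c * (s' (i + 1) - s' (i + 2))" if "i + 3 \<le> d" for i
      using s'[OF that] c by (simp add: c_def field_simps)
    thus "i + 2 \<le> d \<Longrightarrow> s' i - (1 / c - 1) * s' (i + 1) + s' (i + 2) = s' 0 - (1 / c - 1) * s' 1 + s' 2" for i
      by (rule four_term_recurrence)
  qed
qed

text \<open>By the recurrence, the off-diagonal entries of the left hand side \<open>Y\<close> of the Askey-Wilson relation
  vanish, so \<open>Y\<close> is multiplication by a function; this function is the image of the
  constant \<open>1\<close> and thus quadratic in \<open>s\<close>.\<close>

lemma aw0_split_seq:
  assumes d: "d \<ge> 2" and x: "recurrent b g x" "\<And>i. i \<le> d \<Longrightarrow> x (int i) = s i"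
    and s': "s' 0 - b * s' 1 + s' 2 = g'" and y: "\<And>i. i \<le> d \<Longrightarrow> y (int i) = s' i"
  obtains w e where "\<And>i. i \<le> d \<Longrightarrow> aw0 g' x y split_seq i = w * s i + e"
proof -
  obtain r where r: "\<And>i. x i ^ 2 - b * x i * x (i + 1) + x (i + 1) ^ 2 - g * (x i + x (i + 1)) = r"
    using recurrent_quadratic[OF x(1)] by blast
  have r': "s h ^ 2 - b * s h * s (Suc h) + s (Suc h) ^ 2 - g * (s h + s (Suc h)) = r" if "h < d" for h
    using r[of "int h"] x(2)[of h] x(2)[of "Suc h"] that by (simp add: add.commute)
  define Y where "Y h = s h ^ 2 * ap (\<lambda>_. 1) h - b * (s h * ap s h) + ap (\<lambda>k. s k ^ 2) h
    - g * (s h * ap (\<lambda>_. 1) h + ap s h) - r * ap (\<lambda>_. 1) h" for h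
  have "Y h = (\<Sum>k\<le>d. B h k * (s h ^ 2 - b * s h * s k + s k ^ 2 - g * (s h + s k) - r))" for h
    unfolding Y_def ap_def
    by (simp add: sum_distrib_left sum_distrib_right algebra_simps sum.distrib sum_subtractf)
  hence Yap: "Y h = ap (\<lambda>k. s h ^ 2 - b * s h * s k + s k ^ 2 - g * (s h + s k) - r) h" for h
    by (simp add: ap_def)
  \<comment> \<open>The kernel vanishes at the two neighbours of \<open>s h\<close> by the choice of
    \<open>r\<close>, so only the diagonal entry of \<open>B\<close> survives.\<close>
  have Y_diag: "Y h = B h h * (s h ^ 2 * (2 - b) - 2 * g * s h - r)" if h: "h \<le> d" for h
  proof -
    have 1: "s h ^ 2 - b * s h * s (Suc h) + s (Suc h) ^ 2 - g * (s h + s (Suc h)) - r = 0" if "h < d"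
      using r'[OF that] by simp
    have 2: "s h ^ 2 - b * s h * s (h - 1) + s (h - 1) ^ 2 - g * (s h + s (h - 1)) - r = 0" if "h \<noteq> 0"
    proof -
      from that h have "Suc (h - 1) = h" "h - 1 < d" by auto
      thus ?thesis using r'[of "h - 1"] by (simp add: algebra_simps)
    qed
    have 3: "s h ^ 2 - b * s h * s h + s h ^ 2 - g * (s h + s h) - r = s h ^ 2 * (2 - b) - 2 * g * s h - r"
      by (simp add: algebra_simps power2_eq_square)
    show ?thesis unfolding Yap ap_tridiagonal[OF h] 3 using 1 2 by auto
  qed
  have d0: "deg 0 (ap (\<lambda>_. 1)) (s' 0 * 1)" by (intro lead_ap lead_const) simp
  have sdeg: "deg 1 s 1" using lead_shift[OF lead_const[of d s 1]] by simp
  have d1: "deg 1 (ap s) (s' 1 * 1)" using d by (intro lead_ap sdeg) simp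
  have s2: "deg 2 (\<lambda>k. s k ^ 2) 1" using lead_shift[OF sdeg] by (simp add: power2_eq_square numeral_2_eq_2)
  have t1: "deg 2 (\<lambda>h. s h ^ 2 * ap (\<lambda>_. 1) h) (s' 0 * 1)" using lead_mult_power[OF d0, of 2] by simp
  have t2: "deg 2 (\<lambda>h. s h * ap s h) (s' 1 * 1)" using lead_shift[OF d1] by (simp add: numeral_2_eq_2)
  have t3: "deg 2 (ap (\<lambda>k. s k ^ 2)) (s' 2 * 1)" using d by (intro lead_ap s2)
  have t4: "deg 2 (\<lambda>h. s h * ap (\<lambda>_. 1) h + ap s h) (0 + 0)"
    by (intro lead_add lead_weaken[OF lead_shift[OF d0]] lead_weaken[OF d1]) auto
  have t5: "deg 2 (ap (\<lambda>_. 1)) 0" by (rule lead_weaken[OF d0]) simp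
  \<comment> \<open>\<open>Y\<close> is the image of the constant 1; its coefficient of degree 2 is
    the recurrence expression of \<open>s'\<close> at 0, that is \<open>g'\<close>.\<close>
  have "deg 2 Y (s' 0 * 1 - b * (s' 1 * 1) + s' 2 * 1 - g * (0 + 0) - r * 0)"
    unfolding Y_def by (intro lead_diff lead_add lead_cmult t1 t2 t3 t4 t5)
  hence "deg 2 Y g'" using s' by simp
  then obtain a where a: "a 2 = g'" "\<And>h. h \<le> d \<Longrightarrow> Y h = (\<Sum>i\<le>2. a i * s h ^ i)"
    by (rule lead_poly) blast
  show thesis
  proof (rule that)
    fix i assume i: "i \<le> d"
    let ?xm = "x (int i - 1)" and ?xp = "x (int i + 1)"
    have prev: "split_seq i / (s i - s (i - 1)) * (s i - ?xm) = split_seq i"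
    proof (cases i)
      case (Suc j)
      hence "?xm = s j" "s i - s j \<noteq> 0" using x(2)[of j] s_neq[of i j] i by auto
      thus ?thesis using Suc by simp
    qed simp
    have nxt: "split_seq (i + 1) / (s i - s (i + 1)) * (s i - ?xp) = split_seq (i + 1)"
    proof (cases "i < d")
      case True
      hence "?xp = s (i + 1)" "s i - s (i + 1) \<noteq> 0" using x(2)[of "i + 1"] s_neq[of i "i + 1"] by (auto simp: add.commute)
      thus ?thesis by simp
    qed simp
    \<comment> \<open>The diagonal factor splits into the differences from the two neighbours;
      inserting \<open>B_diag\<close> turns the product into \<open>aw0\<close> plus
      \<open>g' * s i ^ 2\<close>.\<close>
    have "Y i = B i i * ((s i - ?xm) * (s i - ?xp))"
      using Y_diag[OF i] recurrent_diag[OF x(1) r, of "int i"] x(2)[OF i] by simp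
    also have "\<dots> = s' i * (s i - ?xm) * (s i - ?xp)
       + split_seq i / (s i - s (i - 1)) * (s i - ?xm) * (s i - ?xp)
       + split_seq (i + 1) / (s i - s (i + 1)) * (s i - ?xp) * (s i - ?xm)"
    proof -
      have "(u + e + f) * (p * q) = u * p * q + e * p * q + f * q * p" for u e f p q :: 'a
        by (simp add: algebra_simps)
      thus ?thesis unfolding B_diag[OF i] .
    qed
    also have "\<dots> = aw0 g' x y split_seq i + g' * s i ^ 2"
      unfolding prev nxt aw0_def x(2)[OF i] y[OF i] by (simp add: algebra_simps)
    finally show "aw0 g' x y split_seq i = a 1 * s i + a 0"
      using a(2)[OF i] a(1) by (simp add: numeral_2_eq_2 add.commute)
  qed
qed

end

text \<open>Reversing the order of the points turns a Leonard system into its relative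
  \<open>\<Phi>\<Down>\<close>.\<close>

lemma irreducible_tridiagonal_reverse:
  assumes "irreducible_tridiagonal d X"
  shows "irreducible_tridiagonal d (\<lambda>i j. X (d - i) (d - j))"
  unfolding irreducible_tridiagonal_def
proof (intro allI impI)
  fix i j assume ij: "i \<le> d" "j \<le> d"
  hence "\<bar>int (d - i) - int (d - j)\<bar> = \<bar>int i - int j\<bar>" by (simp add: of_nat_diff)
  thus "(1 < \<bar>int i - int j\<bar> \<longrightarrow> X (d - i) (d - j) = 0) \<and> (\<bar>int i - int j\<bar> = 1 \<longrightarrow> X (d - i) (d - j) \<noteq> 0)"
    using assms ij unfolding irreducible_tridiagonal_def by (metis diff_le_self)
qed

lemma inj_on_reverse: "inj_on s {..d} \<Longrightarrow> inj_on (\<lambda>h::nat. s (d - h)) {..d}"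
  by (rule inj_onI) (metis atMost_iff diff_diff_cancel diff_le_self inj_onD)

lemma sum_reverse: "(\<Sum>k\<le>d. f (d - k)) = (\<Sum>k\<le>(d::nat). f k)"
  by (rule sum.reindex_bij_witness[of _ "\<lambda>h. d - h" "\<lambda>h. d - h"]) auto

context leonard_model
begin

lemma reverse:
  "leonard_model d (\<lambda>h. s (d - h)) s' X (\<lambda>h k. B (d - h) (d - k)) (\<lambda>j h. p j (d - h))"
proof
  fix h j assume h: "h \<le> d" "j \<le> d"
  show "(\<Sum>k\<le>d. p k (d - h) * X k j) = s (d - h) * p j (d - h)" using h by (simp add: X_p)
  show "(\<Sum>k\<le>d. B (d - h) (d - k) * p j (d - k)) = s' j * p j (d - h)"
    using sum_reverse[of "\<lambda>k. B (d - h) k * p j k" d] h by (simp add: B_p)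
qed (simp_all add: inj_on_reverse inj_s inj_s' irreducible_tridiagonal_reverse X B p_0)

abbreviation split_rev :: "nat \<Rightarrow> 'a" where
  "split_rev \<equiv> split_sequence d (\<lambda>h. s (d - h)) (\<lambda>h k. B (d - h) (d - k))"

interpretation rev: leonard_model d "\<lambda>h. s (d - h)" s' X "\<lambda>h k. B (d - h) (d - k)" "\<lambda>j h. p j (d - h)"
  by (rule reverse)

text \<open>The split sequence and the explicit formula satisfy the same recurrence up to its
  constant term and agree at 0, 1, \<open>d\<close> and \<open>d + 1\<close>, so
  \<open>recurrence_unique\<close> identifies them. The agreement at 1 and \<open>d\<close> comes
  from one diagonal entry computed for both orders of the points: of \<open>X\<close> at 0, of
  \<open>B\<close> at \<open>d\<close>. For \<open>d \<le> 2\<close> no other index occurs.\<close>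

theorem split_seq_formula:
  assumes i: "1 \<le> i" "i \<le> d"
  shows "split_seq i = split_rev 1 * (\<Sum>h\<in>{0..i-1}. (s h - s (d - h)) / (s 0 - s d))
    + (s' i - s' 0) * (s (i - 1) - s d)"
proof -
  have d: "1 \<le> d" using i by simp
  have s0d: "s 0 - s d \<noteq> 0" using s_neq[of 0 d] d by auto
  obtain b g g' where bg: "\<And>i. i + 2 \<le> d \<Longrightarrow> s i - b * s (i + 1) + s (i + 2) = g"
    "\<And>i. i + 2 \<le> d \<Longrightarrow> s' i - b * s' (i + 1) + s' (i + 2) = g'" by (rule eigenvalue_recurrence) blast
  obtain x where x: "recurrent b g x" "\<And>i. i \<le> d \<Longrightarrow> x (int i) = s i"
    using recurrent_extension[of d s b g] bg(1) by blast
  obtain y where y: "recurrent b g' y" "\<And>i. i \<le> d \<Longrightarrow> y (int i) = s' i"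
    using recurrent_extension[of d s' b g'] bg(2) by blast
  define k where "k = split_rev 1 / (s 0 - s d)"
  define F where "F = split_formula d x y k"
  have F: "F i = split_rev 1 * (\<Sum>h\<in>{0..i-1}. (s h - s (d - h)) / (s 0 - s d))
    + (s' i - s' 0) * (s (i - 1) - s d)" if i: "1 \<le> i" "i \<le> d" for i
    unfolding F_def k_def by (rule split_formula_eq) (use x y i in auto)
  have one: "split_seq 1 = F 1"
  proof -
    have n: "s' 0 - s' 1 \<noteq> 0" using s'_neq[of 0 1] d by auto
    have "s 0 + split_seq 1 / (s' 0 - s' 1) = s d + split_rev 1 / (s' 0 - s' 1)"
      using X_diag[of 0] rev.X_diag[of 0] by simp
    hence "split_seq 1 = split_rev 1 + (s' 1 - s' 0) * (s 0 - s d)" using n by (simp add: field_simps)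
    thus ?thesis using F[of 1] d s0d by simp
  qed
  have last: "split_seq d = F d"
  proof -
    have n: "s d - s (d - 1) \<noteq> 0" using s_neq[of d "d - 1"] d by auto
    have "s' d + split_seq d / (s d - s (d - 1)) = s' 0 + split_rev 1 / (s d - s (d - 1))"
      using B_diag[of d] rev.B_diag[of 0] by simp
    hence "split_seq d = split_rev 1 + (s' d - s' 0) * (s (d - 1) - s d)" using n by (simp add: field_simps)
    moreover have "F d = split_rev 1 + (s' d - s' 0) * (s (d - 1) - s d)"
      using dsum_d[of d x] x(2)[of 0] x(2)[of d] x(2)[of "d - 1"] y(2)[of 0] y(2)[of d] d s0d
      by (simp add: F_def split_formula_def k_def of_nat_diff)
    ultimately show ?thesis by simp
  qed
  show ?thesis
  proof (cases "d \<le> 2")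
    case True
    hence "i = 1 \<or> i = d" using i by auto
    thus ?thesis using one last F[OF i] by auto
  next
    case False
    hence d2: "d \<ge> 2" by simp
    obtain w e where w: "\<And>i. i \<le> d \<Longrightarrow> aw0 g' x y split_seq i = w * s i + e"
      using aw0_split_seq[OF d2 x _ y(2), of g'] bg(2)[of 0] d2
      by (auto simp: numeral_2_eq_2)
    have aw1: "aw1 b g g' x y split_seq j = w" if j: "j < d" for j
    proof -
      have sj: "x (int j + 1) = s (Suc j)" "x (int j) = s j" using x(2)[of "Suc j"] x(2)[of j] j
        by (auto simp: add.commute)
      have "(s (Suc j) - s j) * aw1 b g g' x y split_seq j = (s (Suc j) - s j) * w"
        using aw0_Suc[OF x(1), of g' y split_seq j] w[of j] w[of "Suc j"] j sj
        by (simp add: algebra_simps)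
      thus ?thesis using s_neq[of "Suc j" j] j by simp
    qed
    define w' where "w' = aw1 b g g' x y F 0"
    have aw1F: "aw1 b g g' x y F j = w'" for j
      unfolding F_def w'_def by (rule aw1_split_formula[OF x(1) y(1)])
    have "split_seq i - F i = 0"
    proof (rule recurrence_unique[OF x(1) _ d, of "\<lambda>i. split_seq i - F i" "w - w'"])
      show "x 0 \<noteq> x (int d)" using x(2)[of 0] x(2)[of d] s0d by auto
      fix j assume j: "j < d"
      have "aw1 b g g' x y split_seq j - aw1 b g g' x y F j = split_seq j - F j
          - b * (split_seq (j + 1) - F (j + 1)) + (split_seq (j + 2) - F (j + 2))"
        by (simp add: aw1_def algebra_simps)
      thus "split_seq j - F j - b * (split_seq (j + 1) - F (j + 1)) +
          (split_seq (j + 2) - F (j + 2)) = w - w'"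
        using aw1[OF j] aw1F[of j] by simp
    next
      show "split_seq (d + 1) - F (d + 1) = 0" by (simp add: F_def split_formula_def)
      show "split_seq 0 - F 0 = 0" by (simp add: F_def split_formula_def)
    qed (use one last i in simp_all)
    thus ?thesis using F[OF i] by simp
  qed
qed

end

section \<open>Matrices as functions of two indices\<close>

lemma index_mult_mat_sum:
  "X \<in> carrier_mat (Suc d) (Suc d) \<Longrightarrow> Y \<in> carrier_mat (Suc d) (Suc d) \<Longrightarrow> i \<le> d \<Longrightarrow> j \<le> d \<Longrightarrow>
    (X * Y) $$ (i, j) = (\<Sum>k\<le>d. X $$ (i, k) * Y $$ (k, j))"
  by (auto simp: scalar_prod_def lessThan_Suc_atMost[symmetric] atLeast0LessThan intro!: sum.cong)

lemma index_mult_mat_vec_sum: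
  "X \<in> carrier_mat (Suc d) (Suc d) \<Longrightarrow> v \<in> carrier_vec (Suc d) \<Longrightarrow> j \<le> d \<Longrightarrow>
    (X *\<^sub>v v) $ j = (\<Sum>k\<le>d. X $$ (j, k) * v $ k)"
  by (auto simp: scalar_prod_def lessThan_Suc_atMost[symmetric] atLeast0LessThan intro!: sum.cong)

lemma eq_matI_le:
  "X \<in> carrier_mat (Suc d) (Suc d) \<Longrightarrow> Y \<in> carrier_mat (Suc d) (Suc d) \<Longrightarrow>
    (\<And>i j. i \<le> d \<Longrightarrow> j \<le> d \<Longrightarrow> X $$ (i, j) = Y $$ (i, j)) \<Longrightarrow> X = Y"
  by (rule eq_matI) auto

lemma delta_sum: "j \<le> d \<Longrightarrow> (\<Sum>k\<le>(d::nat). f k * (if k = j then 1 else 0)) = (f j :: 'a::semiring_1)"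
  by (simp add: if_distrib[of "\<lambda>x. _ * x"] cong: if_cong)

lemma mat_inverse_functions:
  fixes T :: "nat \<Rightarrow> nat \<Rightarrow> 'a::field"
  assumes "det (mat (Suc d) (Suc d) (\<lambda>(i, j). T i j)) \<noteq> 0"
  obtains S where "\<And>i j. i \<le> d \<Longrightarrow> j \<le> d \<Longrightarrow> (\<Sum>k\<le>d. T i k * S k j) = (if i = j then 1 else 0)"
    "\<And>i j. i \<le> d \<Longrightarrow> j \<le> d \<Longrightarrow> (\<Sum>k\<le>d. S i k * T k j) = (if i = j then 1 else 0)"
proof -
  let ?n = "Suc d" and ?T = "mat (Suc d) (Suc d) (\<lambda>(i, j). T i j)"
  have T: "?T \<in> carrier_mat ?n ?n" by simp
  from det_non_zero_imp_unit[OF T assms, of "()"]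
  obtain S where S: "S \<in> carrier_mat ?n ?n" "S * ?T = 1\<^sub>m ?n" "?T * S = 1\<^sub>m ?n"
    unfolding Units_def ring_mat_simps by auto
  have "(\<Sum>k\<le>d. T i k * S $$ (k, j)) = (if i = j then 1 else 0)" if "i \<le> d" "j \<le> d" for i j
  proof -
    have "(\<Sum>k\<le>d. T i k * S $$ (k, j)) = (?T * S) $$ (i, j)"
      unfolding index_mult_mat_sum[OF T S(1) that] using that by (intro sum.cong) auto
    thus ?thesis using S(3) that by simp
  qed
  moreover have "(\<Sum>k\<le>d. S $$ (i, k) * T k j) = (if i = j then 1 else 0)" if "i \<le> d" "j \<le> d" for i j
  proof -
    have "(\<Sum>k\<le>d. S $$ (i, k) * T k j) = (S * ?T) $$ (i, j)"
      unfolding index_mult_mat_sum[OF S(1) T that] using that by (intro sum.cong) auto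
    thus ?thesis using S(2) that by simp
  qed
  ultimately show thesis by (rule that[of "\<lambda>i j. S $$ (i, j)"])
qed

lemma lower_triangular_inverse:
  fixes T :: "nat \<Rightarrow> nat \<Rightarrow> 'a::field"
  assumes "\<And>i j. i < j \<Longrightarrow> j \<le> d \<Longrightarrow> T i j = 0" "\<And>i. i \<le> d \<Longrightarrow> T i i \<noteq> 0"
  obtains S where "\<And>i j. i \<le> d \<Longrightarrow> j \<le> d \<Longrightarrow> (\<Sum>k\<le>d. T i k * S k j) = (if i = j then 1 else 0)"
    "\<And>i j. i \<le> d \<Longrightarrow> j \<le> d \<Longrightarrow> (\<Sum>k\<le>d. S i k * T k j) = (if i = j then 1 else 0)"
proof (rule mat_inverse_functions)
  let ?T = "mat (Suc d) (Suc d) (\<lambda>(i, j). T i j)"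
  have "det ?T = prod_list (diag_mat ?T)"
    by (rule det_lower_triangular[of "Suc d"]) (use assms(1) in auto)
  moreover have "0 \<notin> set (diag_mat ?T)" using assms(2) by (auto simp: diag_mat_def)
  ultimately show "det ?T \<noteq> 0" by (simp add: prod_list_zero_iff)
qed (use that in blast)

section \<open>The Askey-Wilson relation in a split basis\<close>

text \<open>The Askey-Wilson relation at the Newton polynomial \<open>t i\<close>, evaluated at
  \<open>z\<close>: \<open>n i\<close> is the image of \<open>t i\<close>, and products of points
  with Newton polynomials are rewritten by \<open>z * t i = y i * t i + t (i + 1)\<close>. Here
  \<open>y\<close> supplies the points and \<open>x\<close> the diagonal of the operator, hence the
  order of the arguments of \<open>aw0\<close>.\<close>

lemma askey_wilson_split:
  fixes x y :: "int \<Rightarrow> 'a::field" and F :: "nat \<Rightarrow> 'a" and i :: nat and z :: 'a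
  assumes x: "recurrent b g x" and y: "recurrent b g' y"
    and r: "\<And>i. y i ^ 2 - b * y i * y (i + 1) + y (i + 1) ^ 2 - g' * (y i + y (i + 1)) = r"
    and aw1: "aw1 b g g' x y F i = w" and aw0: "aw0 g y x F i = w * y (int i) + e"
    and F0: "i = 0 \<Longrightarrow> F 0 = 0"
  defines "t \<equiv> \<lambda>i. newton (\<lambda>h. y (int h)) i z"
  defines "n \<equiv> \<lambda>i. x (int i) * t i + F i * t (i - 1)"
  shows "z ^ 2 * n i - b * z * (y i * n i + n (i + 1))
    + (y i ^ 2 * n i + (y i + y (int i + 1)) * n (i + 1) + n (i + 2))
    - g' * (z * n i + (y i * n i + n (i + 1))) - r * n i = (g * z ^ 2 + w * z + e) * t i"
proof -
  define x1 x2 x3 where xd: "x1 = x (int i)" "x2 = x (int i + 1)" "x3 = x (int i + 2)"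
  define y0 y1 y2 where yd: "y0 = y (int i - 1)" "y1 = y (int i)" "y2 = y (int i + 1)"
  define f1 f2 f3 where fd: "f1 = F i" "f2 = F (i + 1)" "f3 = F (i + 2)"
  define p where "p = t (i - 1)"
  have t1: "f1 * t i = f1 * ((z - y0) * p)"
  proof (cases i)
    case (Suc j)
    have "y0 = y (int j)" using Suc by (simp add: yd)
    thus ?thesis using Suc by (simp add: p_def t_def newton_Suc mult.commute)
  qed (use F0 fd in simp)
  define q where "q = t i"
  have t2: "t (i + 1) = (z - y1) * q" "t (i + 2) = (z - y2) * ((z - y1) * q)"
    by (simp_all add: q_def t_def newton_Suc yd mult.commute add.commute)
  have n1: "n i = x1 * q + f1 * p" by (simp add: n_def q_def p_def fd xd)
  have n2: "n (i + 1) = x2 * ((z - y1) * q) + f2 * q"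
    by (simp add: n_def fd xd t2[simplified] add.commute) (simp add: q_def)
  have n3: "n (i + 2) = x3 * ((z - y2) * ((z - y1) * q)) + f3 * ((z - y1) * q)"
    using t2 by (simp add: n_def fd xd add.commute)
  have c2: "x1 - b * x2 + x3 - g = 0"
    using recurrent_next2[OF x, of "int i"] by (simp add: xd)
  have c1: "f1 - b * f2 + f3 + (x1 + x2) * (y1 + y2) - b * (x1 * y1 + x2 * y2)
     - g * (y1 + y2) - g' * (x1 + x2) - w = 0"
    using aw1 by (simp add: aw1_def xd yd fd)
  have yp: "y0 = g' + b * y1 - y2" unfolding yd by (rule recurrent_prev[OF y])
  have dg: "y1 ^ 2 * (2 - b) - 2 * g' * y1 - r = (y1 - y0) * (y1 - y2)"
    unfolding yd by (rule recurrent_diag[OF y r])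
  have c0: "f1 * (y1 - y2) + f2 * (y1 - y0) + x1 * (y1 ^ 2 * (2 - b) - 2 * g' * y1 - r)
     - g * y1 ^ 2 - w * y1 - e = 0"
    unfolding dg using aw0 by (simp add: aw0_def xd yd fd mult.assoc)
  have cm: "y0 ^ 2 - b * y0 * y1 + y1 ^ 2 - g' * (y0 + y1) - r = 0"
    using r[of "int i - 1"] by (simp add: yd)
  \<comment> \<open>Expansion in Newton polynomials: the first four brackets are the components of
    degrees 2, 1, 0, -1 relative to \<open>t i\<close>; the last two summands vanish by
    \<open>t1\<close> and \<open>yp\<close>.\<close>
  have "z ^ 2 * n i - b * z * (y1 * n i + n (i + 1))
    + (y1 ^ 2 * n i + (y1 + y2) * n (i + 1) + n (i + 2))
    - g' * (z * n i + (y1 * n i + n (i + 1))) - r * n i - (g * z ^ 2 + w * z + e) * q =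
    (x1 - b * x2 + x3 - g) * ((z - y2) * ((z - y1) * q))
    + (f1 - b * f2 + f3 + (x1 + x2) * (y1 + y2) - b * (x1 * y1 + x2 * y2)
       - g * (y1 + y2) - g' * (x1 + x2) - w) * ((z - y1) * q)
    + (f1 * (y1 - y2) + f2 * (y1 - y0) + x1 * (y1 ^ 2 * (2 - b) - 2 * g' * y1 - r)
       - g * y1 ^ 2 - w * y1 - e) * q
    + (y0 ^ 2 - b * y0 * y1 + y1 ^ 2 - g' * (y0 + y1) - r) * (f1 * p)
    + (z + y0 - b * y1 - g') * (f1 * ((z - y0) * p) - f1 * q)
    + (y0 - (g' + b * y1 - y2)) * ((f1 + f2) * q)"
    unfolding n1 n2 n3 by (simp add: algebra_simps power2_eq_square)
  also have "\<dots> = 0"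
    unfolding c2 c1 c0 cm using t1 yp by (auto simp: q_def)
  finally show ?thesis by (simp add: q_def yd add.commute)
qed

text \<open>The Askey-Wilson relation determines the value of \<open>N\<close> at a reversed Newton polynomial of degree
  \<open>i + 2\<close> from the values at those of degree \<open>i\<close> and \<open>i + 1\<close>.  Both split forms satisfy the relation with
  the same constants \<open>w\<close> and \<open>e\<close>, so the values agree.\<close>

lemma newton_action_reverse:
  fixes x y :: "int \<Rightarrow> 'a::field" and F F' :: "nat \<Rightarrow> 'a" and s :: "nat \<Rightarrow> 'a" and d :: nat
  defines "y' \<equiv> \<lambda>i. y (int d - i)"
  assumes x: "recurrent b g x" and y: "recurrent b g' y"
    and s: "inj_on s {..d}" "\<And>i. i \<le> d \<Longrightarrow> y (int i) = s i"
    and N: "newton_action d N s (\<lambda>i. x (int i)) F"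
    and F0: "F 0 = 0" "F (Suc d) = 0" "F' 0 = 0"
    and awF: "\<And>i. aw1 b g g' x y F i = w" "\<And>i. aw0 g y x F i = w * y (int i) + e"
    and awF': "\<And>i. i < d \<Longrightarrow> aw1 b g g' x y' F' i = w"
      "\<And>i. i \<le> d \<Longrightarrow> aw0 g y' x F' i = w * y' (int i) + e"
    and F1: "F 1 - F' 1 = (x 1 - x 0) * (y 0 - y (int d))"
  shows "newton_action d (\<lambda>j k. N (d - j) (d - k)) (\<lambda>h. s (d - h)) (\<lambda>i. x (int i)) F'"
proof -
  define t where "t i j = newton (\<lambda>h. y (int h)) i (s j)" for i j
  define t' where "t' i j = newton (\<lambda>h. y' (int h)) i (s j)" for i j
  define NA where "NA u j = (\<Sum>k\<le>d. N j k * u k)" for u j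
  have NA_add: "NA (\<lambda>k. u k + v k) j = NA u j + NA v j" for u v j
    by (simp add: NA_def distrib_left sum.distrib)
  have NA_cmult: "NA (\<lambda>k. a * u k) j = a * NA u j" for a u j
    by (simp add: NA_def sum_distrib_left mult_ac)
  obtain r where r: "\<And>i. y i ^ 2 - b * y i * y (i + 1) + y (i + 1) ^ 2 - g' * (y i + y (i + 1)) = r"
    using recurrent_quadratic[OF y] by blast
  have y': "recurrent b g' y'" unfolding y'_def by (rule recurrent_reverse[OF y])
  have r': "y' i ^ 2 - b * y' i * y' (i + 1) + y' (i + 1) ^ 2 - g' * (y' i + y' (i + 1)) = r" for i
  proof -
    have "y' i = y (int d - i - 1 + 1)" "y' (i + 1) = y (int d - i - 1)"
      by (simp_all add: y'_def algebra_simps)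
    thus ?thesis using r[of "int d - i - 1"] by (simp only:) (simp add: algebra_simps)
  qed
  have t_s: "t i j = newton s i (s j)" if "i \<le> Suc d" for i j
    unfolding t_def newton_def using s(2) that by (intro prod.cong) auto
  have t_beyond: "t i j = 0" if "i > d" "j \<le> d" for i j
  proof -
    have "y (int j) = s j" using s(2) that by simp
    thus ?thesis using newton_eq_0[of j i "\<lambda>h. y (int h)"] that by (simp add: t_def)
  qed
  have zt: "s j * t i j = y i * t i j + t (i + 1) j" for i j
    by (simp add: t_def newton_Suc algebra_simps)
  have zt': "s j * t' i j = y' i * t' i j + t' (i + 1) j" for i j
    by (simp add: t'_def newton_Suc algebra_simps)
  \<comment> \<open>Valid beyond \<open>d\<close> as well, since \<open>t i\<close> then vanishes at
    all points and \<open>F (d + 1) = 0\<close>; the relation at \<open>t i\<close> involves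
    \<open>t (i + 2)\<close>.\<close>
  have NA_t: "NA (t i) j = x (int i) * t i j + F i * t (i - 1) j" if j: "j \<le> d" for i j
  proof (cases "i \<le> d")
    case True
    thus ?thesis using newton_actionD[OF N True j] by (simp add: NA_def t_s)
  next
    case False
    have "NA (t i) j = 0" unfolding NA_def using False by (intro sum.neutral) (auto simp: t_beyond)
    moreover have "F i * t (i - 1) j = 0"
    proof (cases "i = Suc d")
      case False
      hence "i - 1 > d" using \<open>\<not> i \<le> d\<close> by simp
      thus ?thesis using t_beyond j by simp
    qed (simp add: F0)
    ultimately show ?thesis using False t_beyond j by simp
  qed
  define L where "L u j = s j ^ 2 * NA u j - b * s j * NA (\<lambda>k. s k * u k) j + NA (\<lambda>k. s k ^ 2 * u k) j
    - g' * (s j * NA u j + NA (\<lambda>k. s k * u k) j) - r * NA u j" for u j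
  have L_t: "L (t i) j = (g * s j ^ 2 + w * s j + e) * t i j" if j: "j \<le> d" for i j
  proof -
    have 1: "NA (\<lambda>k. s k * t i k) j = y i * NA (t i) j + NA (t (i + 1)) j" for i
      by (simp add: zt NA_add NA_cmult)
    have sq: "s k ^ 2 * t i k = y i * (s k * t i k) + s k * t (i + 1) k" for k
    proof -
      have "s k ^ 2 * t i k = s k * (s k * t i k)" by (simp add: power2_eq_square mult.assoc)
      also have "\<dots> = s k * (y i * t i k + t (i + 1) k)" by (simp only: zt)
      also have "\<dots> = y i * (s k * t i k) + s k * t (i + 1) k"
        by (simp only: distrib_left mult.left_commute)
      finally show ?thesis .
    qed
    have 2: "NA (\<lambda>k. s k ^ 2 * t i k) j =
       y i ^ 2 * NA (t i) j + (y i + y (int i + 1)) * NA (t (i + 1)) j + NA (t (i + 2)) j"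
      unfolding sq NA_add NA_cmult 1 by (simp add: algebra_simps power2_eq_square)
    show ?thesis
      unfolding L_def 1 2
      using askey_wilson_split[where i = i and z = "s j", OF x y r awF(1) awF(2) F0(1), folded t_def]
      by (simp only: NA_t[OF j])
  qed
  \<comment> \<open>Inverse of the triangular evaluation matrix: every function is a combination of
    Newton polynomials, which extends the relation from \<open>t i\<close> to all
    \<open>u\<close>.\<close>
  obtain S where S: "\<And>k m. k \<le> d \<Longrightarrow> m \<le> d \<Longrightarrow> (\<Sum>i\<le>d. t i k * S i m) = (if k = m then 1 else 0)"
  proof (rule lower_triangular_inverse[of d "\<lambda>k i. t i k"])
    show "t i k = 0" if "k < i" "i \<le> d" for k i
      using that by (simp add: t_s newton_eq_0)
    show "t i i \<noteq> 0" if "i \<le> d" for i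
      using that newton_neq_0[OF s(1), of i i] by (simp add: t_s)
  qed (use that in blast)
  define K where "K j k = N j k * (s j ^ 2 - b * s j * s k + s k ^ 2 - g' * (s j + s k) - r)" for j k
  have LK: "L u j = (\<Sum>k\<le>d. K j k * u k)" for u j
    unfolding L_def NA_def K_def
    by (simp add: sum_distrib_left sum_distrib_right algebra_simps sum.distrib sum_subtractf)
  have AW: "L u j = (g * s j ^ 2 + w * s j + e) * u j" if j: "j \<le> d" for u j
  proof -
    define \<alpha> where "\<alpha> i = (\<Sum>m\<le>d. S i m * u m)" for i
    have u: "u k = (\<Sum>i\<le>d. t i k * \<alpha> i)" if k: "k \<le> d" for k
    proof -
      have "(\<Sum>i\<le>d. t i k * \<alpha> i) = (\<Sum>i\<le>d. \<Sum>m\<le>d. t i k * S i m * u m)"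
        by (simp add: \<alpha>_def sum_distrib_left mult.assoc)
      also have "\<dots> = (\<Sum>m\<le>d. (\<Sum>i\<le>d. t i k * S i m) * u m)"
        by (subst sum.swap) (simp add: sum_distrib_right)
      also have "\<dots> = (\<Sum>m\<le>d. u m * (if m = k then 1 else 0))"
        by (intro sum.cong) (auto simp: S k)
      also have "\<dots> = u k" by (rule delta_sum[OF k])
      finally show ?thesis ..
    qed
    have "L u j = (\<Sum>k\<le>d. K j k * (\<Sum>i\<le>d. t i k * \<alpha> i))"
      unfolding LK using u by (intro sum.cong) auto
    also have "\<dots> = (\<Sum>i\<le>d. L (t i) j * \<alpha> i)"
      unfolding LK sum_distrib_left sum_distrib_right by (subst sum.swap) (simp add: mult.assoc)
    also have "\<dots> = (g * s j ^ 2 + w * s j + e) * (\<Sum>i\<le>d. t i j * \<alpha> i)"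
      by (simp add: L_t[OF j] sum_distrib_left mult.assoc)
    finally show ?thesis using u[OF j] by simp
  qed
  \<comment> \<open>Induction with two starting values. The degree 0 case is shared with
    \<open>t\<close>, and \<open>F1\<close> is the compatibility needed in degree 1.\<close>
  have claim: "i \<le> d \<Longrightarrow> (\<forall>j\<le>d. NA (t' i) j = x (int i) * t' i j + F' i * t' (i - 1) j)" for i
  proof (induction i rule: less_induct)
    case (less i)
    have t0: "t' 0 = t 0" by (rule ext) (simp add: t_def t'_def)
    have t1: "t' 1 = (\<lambda>j. t 1 j + (y 0 - y (int d)) * t 0 j)"
      by (rule ext) (simp add: t_def t'_def newton_Suc y'_def)
    consider "i = 0" | "i = 1" | "i \<ge> 2" by linarith
    thus ?case
    proof cases
      case 1
      thus ?thesis by (auto simp: t0 NA_t F0)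
    next
      case 2
      show ?thesis
      proof (intro allI impI)
        fix j assume j: "j \<le> d"
        have "NA (t' 1) j = x 1 * t 1 j + F 1 + (y 0 - y (int d)) * x 0"
          unfolding t1 by (simp add: NA_add NA_cmult NA_t[OF j] F0) (simp add: t_def)
        also have "F 1 = F' 1 + (x 1 - x 0) * (y 0 - y (int d))" unfolding F1[symmetric] by simp
        finally show "NA (t' i) j = x (int i) * t' i j + F' i * t' (i - 1) j"
          using 2 by (simp add: t1[simplified] t0) (simp add: t_def algebra_simps)
      qed
    next
      case 3
      define m where "m = i - 2"
      have i: "i = m + 2" using 3 by (simp add: m_def)
      show ?thesis
      proof (intro allI impI)
        fix j assume j: "j \<le> d"
        have IH: "NA (t' m) j = x (int m) * t' m j + F' m * t' (m - 1) j"
          "NA (t' (m + 1)) j = x (int (m + 1)) * t' (m + 1) j + F' (m + 1) * t' (m + 1 - 1) j"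
          using less.IH[of m] less.IH[of "m + 1"] less.prems i j by auto
        have 1: "NA (\<lambda>k. s k * t' m k) j = y' m * NA (t' m) j + NA (t' (m + 1)) j" for m
          by (simp add: zt' NA_add NA_cmult)
        have sq: "s k ^ 2 * t' m k = y' m * (s k * t' m k) + s k * t' (m + 1) k" for k
    proof -
      have "s k ^ 2 * t' m k = s k * (s k * t' m k)" by (simp add: power2_eq_square mult.assoc)
      also have "\<dots> = s k * (y' m * t' m k + t' (m + 1) k)" by (simp only: zt')
      also have "\<dots> = y' m * (s k * t' m k) + s k * t' (m + 1) k"
        by (simp only: distrib_left mult.left_commute)
      finally show ?thesis .
    qed
    have 2: "NA (\<lambda>k. s k ^ 2 * t' m k) j =
           y' m ^ 2 * NA (t' m) j + (y' m + y' (int m + 1)) * NA (t' (m + 1)) j + NA (t' (m + 2)) j"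
      unfolding sq NA_add NA_cmult 1 by (simp add: algebra_simps power2_eq_square)
        have eq: "L (t' m) j = (g * s j ^ 2 + w * s j + e) * t' m j" by (rule AW[OF j])
        have cancel: "u = v" if "A + (B + u) - C - D = R" "A + (B + v) - C - D = R" for A B C D R u v :: 'a
        proof -
          have "A + (B + u) - C - D = A + (B + v) - C - D" using that by simp
          thus ?thesis by simp
        qed
        have aw: "aw1 b g g' x y' F' m = w" "aw0 g y' x F' m = w * y' (int m) + e"
          using awF' less.prems i by auto
        \<comment> \<open>The unknown image of \<open>t' (m + 2)\<close> occurs in the relation with
          coefficient 1, so the actual and the predicted instance can be cancelled against each
          other.\<close>
        have "NA (t' (m + 2)) j = x (int (m + 2)) * t' (m + 2) j + F' (m + 2) * t' (m + 2 - 1) j"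
          by (rule cancel[OF eq[unfolded L_def 1 2 IH]
                askey_wilson_split[where z = "s j", OF x y' r' aw F0(3), folded t'_def]])
        thus "NA (t' i) j = x (int i) * t' i j + F' i * t' (i - 1) j" by (simp add: i)
      qed
    qed
  qed
  have t'_s: "t' i j = newton (\<lambda>h. s (d - h)) i (s j)" if "i \<le> d" for i j
    unfolding t'_def newton_def y'_def
  proof (intro prod.cong refl)
    fix h assume "h \<in> {..<i}"
    hence "int d - int h = int (d - h)" using that by simp
    thus "s j - y (int d - int h) = s j - s (d - h)" by (simp only: s(2) diff_le_self)
  qed
  show ?thesis
    unfolding newton_action_def
  proof (intro allI impI)
    fix i j assume ij: "i \<le> d" "j \<le> d"
    have "(\<Sum>k\<le>d. N (d - j) (d - k) * newton (\<lambda>h. s (d - h)) i (s (d - k))) = NA (t' i) (d - j)"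
      unfolding NA_def using sum_reverse[of "\<lambda>k. N (d - j) k * t' i k" d] ij by (simp add: t'_s)
    thus "(\<Sum>k\<le>d. N (d - j) (d - k) * newton (\<lambda>h. s (d - h)) i (s (d - k))) =
        x (int i) * newton (\<lambda>h. s (d - h)) i (s (d - j)) +
        F' i * newton (\<lambda>h. s (d - h)) (i - 1) (s (d - j))"
      using claim[OF ij(1)] ij by (simp add: t'_s)
  qed
qed

section \<open>The operator defined by a parameter array\<close>

lemma newton_action_exists:
  assumes s: "inj_on s {..d}"
  obtains N where "newton_action d N s u f"
proof -
  obtain S where S: "\<And>i j. i \<le> d \<Longrightarrow> j \<le> d \<Longrightarrow> (\<Sum>k\<le>d. S i k * newton s j (s k)) = (if i = j then 1 else 0)"
  proof (rule lower_triangular_inverse[of d "\<lambda>k i. newton s i (s k)"])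
    show "newton s i (s k) = 0" if "k < i" "i \<le> d" for k i
      using that by (simp add: newton_eq_0)
    show "newton s i (s i) \<noteq> 0" if "i \<le> d" for i
      using that newton_neq_0[OF s, of i i] by simp
  qed (use that in blast)
  define W where "W i j = u i * newton s i (s j) + f i * newton s (i - 1) (s j)" for i j
  define N where "N j k = (\<Sum>i\<le>d. W i j * S i k)" for j k
  have "newton_action d N s u f"
    unfolding newton_action_def
  proof (intro allI impI)
    fix i j assume ij: "i \<le> d" "j \<le> d"
    have "(\<Sum>k\<le>d. N j k * newton s i (s k)) = (\<Sum>k\<le>d. \<Sum>m\<le>d. W m j * (S m k * newton s i (s k)))"
      by (simp add: N_def sum_distrib_right mult.assoc)
    also have "\<dots> = (\<Sum>m\<le>d. W m j * (\<Sum>k\<le>d. S m k * newton s i (s k)))"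
      by (subst sum.swap) (simp add: sum_distrib_left)
    also have "\<dots> = (\<Sum>m\<le>d. W m j * (if m = i then 1 else 0))"
      using ij by (intro sum.cong) (auto simp: S)
    also have "\<dots> = W i j" by (rule delta_sum[OF ij(1)])
    finally show "(\<Sum>k\<le>d. N j k * newton s i (s k)) =
        u i * newton s i (s j) + f i * newton s (i - 1) (s j)" by (simp add: W_def)
  qed
  thus thesis by (rule that)
qed

lemma newton_action_cong:
  "newton_action d N s u f \<Longrightarrow> (\<And>i. i \<le> d \<Longrightarrow> u' i = u i) \<Longrightarrow> (\<And>i. i \<le> d \<Longrightarrow> f' i = f i) \<Longrightarrow>
    newton_action d N s u' f'"
  by (simp add: newton_action_def)

text \<open>Reversing \<open>y\<close> and the split sequence amounts to reversing \<open>x\<close>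
  and reading the positions backwards, because \<open>aw1\<close> is symmetric in its two
  neighbouring positions.\<close>

lemma aw1_reverse:
  assumes "i < d" "\<And>j. j \<le> d + 1 \<Longrightarrow> F' j = F (d + 1 - j)"
  shows "aw1 b g g' x (\<lambda>i. y (int d - i)) F' i = aw1 b g g' (\<lambda>i. x (int d - i)) y F (d - 1 - i)"
proof -
  define m where "m = d - 1 - i"
  have d: "d = m + i + 1" using assms(1) by (simp add: m_def)
  have F: "F' i = F (m + 2)" "F' (i + 1) = F (m + 1)" "F' (i + 2) = F m"
    using assms(2)[of i] assms(2)[of "i + 1"] assms(2)[of "i + 2"] d by simp_all
  have e: "int d - int i = int m + 1" "int d - (int i + 1) = int m"
    "int d - int m = int i + 1" "int d - (int m + 1) = int i" using d by auto
  show ?thesis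
    unfolding m_def[symmetric] aw1_def F e by (simp add: algebra_simps)
qed

text \<open>The value \<open>y 0 - y 1 - k\<close> is the multiplier for the opposite order: with
  \<open>k = phi 1 / (th 0 - th d)\<close> it equals \<open>vphi 1 / (th d - th 0)\<close>. So both
  orders have the same constant \<open>w\<close>.\<close>

lemma aw1_split_formula_reverse:
  assumes y: "recurrent b g' y"
  shows "aw1 b g g' (\<lambda>i. x (int d - i)) y
      (split_formula d (\<lambda>i. x (int d - i)) y (y 0 - y 1 - k)) 0 =
    aw1 b g g' x y (split_formula d x y k) 0"
proof -
  have y2: "y 2 = g' + b * y 1 - y 0" using recurrent_next2[OF y, of 0] by simp
  have s: "dsum d x 1 = x 0 - x d" "dsum d x 2 = x 0 - x d + (x 1 - x (int d - 1))"
    "dsum d (\<lambda>i. x (int d - i)) 1 = x d - x 0"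
    "dsum d (\<lambda>i. x (int d - i)) 2 = x d - x 0 + (x (int d - 1) - x 1)"
    by (simp_all add: dsum_def numeral_2_eq_2)
  show ?thesis
    unfolding aw1_def split_formula_def
    by (simp add: s y2 s(1,3)[simplified] s(2,4)[unfolded numeral_2_eq_2]) (simp add: algebra_simps)
qed

text \<open>The defining equation expresses the two split sequences through each other, which makes the
  simplifier loop.\<close>

declare parameter_array.simps [simp del] entries_given_by.simps [simp del]

lemma parameter_arrayD:
  assumes "parameter_array d (th, ths, vphi, phi)"
  shows "scalar_seq 0 d th" "scalar_seq 0 d ths" "scalar_seq 1 d vphi" "scalar_seq 1 d phi"
    and "1 \<le> i \<Longrightarrow> i \<le> d \<Longrightarrow> vphi i \<noteq> 0" "1 \<le> i \<Longrightarrow> i \<le> d \<Longrightarrow> phi i \<noteq> 0"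
    and "i \<le> d \<Longrightarrow> j \<le> d \<Longrightarrow> i \<noteq> j \<Longrightarrow> th i \<noteq> th j" "i \<le> d \<Longrightarrow> j \<le> d \<Longrightarrow> i \<noteq> j \<Longrightarrow> ths i \<noteq> ths j"
    and "1 \<le> i \<Longrightarrow> i \<le> d \<Longrightarrow> vphi i = phi 1 * (\<Sum>h\<in>{0..i-1}. (th h - th (d-h)) / (th 0 - th d))
      + (ths i - ths 0) * (th (i-1) - th d)"
    and "1 \<le> i \<Longrightarrow> i \<le> d \<Longrightarrow> phi i = vphi 1 * (\<Sum>h\<in>{0..i-1}. (th h - th (d-h)) / (th 0 - th d))
      + (ths i - ths 0) * (th (d-i+1) - th 0)"
    and "\<exists>c. \<forall>i\<in>{2..d-1}. (th (i-2) - th (i+1)) / (th (i-1) - th i) = c \<and>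
        (ths (i-2) - ths (i+1)) / (ths (i-1) - ths i) = c"
proof -
  note pa = assms[unfolded parameter_array.simps]
  have i: "1 \<le> i \<Longrightarrow> i \<le> d \<Longrightarrow> i \<in> {1..d}" by simp
  show "scalar_seq 0 d th" "scalar_seq 0 d ths" "scalar_seq 1 d vphi" "scalar_seq 1 d phi"
    "\<exists>c. \<forall>i\<in>{2..d-1}. (th (i-2) - th (i+1)) / (th (i-1) - th i) = c \<and>
        (ths (i-2) - ths (i+1)) / (ths (i-1) - ths i) = c"
    "i \<le> d \<Longrightarrow> j \<le> d \<Longrightarrow> i \<noteq> j \<Longrightarrow> th i \<noteq> th j" "i \<le> d \<Longrightarrow> j \<le> d \<Longrightarrow> i \<noteq> j \<Longrightarrow> ths i \<noteq> ths j"
    "1 \<le> i \<Longrightarrow> i \<le> d \<Longrightarrow> vphi i \<noteq> 0" "1 \<le> i \<Longrightarrow> i \<le> d \<Longrightarrow> phi i \<noteq> 0"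
    using pa i by blast+
  have "\<forall>i\<in>{1..d}. vphi i = phi 1 * (\<Sum>h\<in>{0..i-1}. (th h - th (d-h)) / (th 0 - th d))
      + (ths i - ths 0) * (th (i-1) - th d)"
    using pa by (elim conjE)
  from bspec[OF this i]
  show "1 \<le> i \<Longrightarrow> i \<le> d \<Longrightarrow> vphi i = phi 1 * (\<Sum>h\<in>{0..i-1}. (th h - th (d-h)) / (th 0 - th d))
      + (ths i - ths 0) * (th (i-1) - th d)" .
  have "\<forall>i\<in>{1..d}. phi i = vphi 1 * (\<Sum>h\<in>{0..i-1}. (th h - th (d-h)) / (th 0 - th d))
      + (ths i - ths 0) * (th (d-i+1) - th 0)"
    using pa by (elim conjE)
  from bspec[OF this i]
  show "1 \<le> i \<Longrightarrow> i \<le> d \<Longrightarrow> phi i = vphi 1 * (\<Sum>h\<in>{0..i-1}. (th h - th (d-h)) / (th 0 - th d))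
      + (ths i - ths 0) * (th (d-i+1) - th 0)" .
qed

text \<open>With the eigenvalue sequences extended by their recurrence, the split sequences of the
  array are values of \<open>split_formula\<close>, which gives the Askey-Wilson constants. It
  remains to see that both orders of the dual eigenvalues have the same \<open>w\<close> and
  \<open>e\<close> and compatible first terms.\<close>

lemma parameter_array_newton_action:
  assumes pa: "parameter_array d (th, ths, vphi, phi)" and d: "d \<ge> 1"
  obtains N where "newton_action d N ths th vphi"
    "newton_action d (\<lambda>j k. N (d - j) (d - k)) (\<lambda>h. ths (d - h)) th (\<lambda>i. phi (d + 1 - i))"
proof -
  note PA = parameter_arrayD[OF pa]
  have seq: "vphi 0 = 0" "phi 0 = 0" "vphi (Suc d) = 0" "phi (Suc d) = 0"
    using PA(3,4) by (simp_all add: scalar_seq_def)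
  have neq: "th i \<noteq> th j" "ths i \<noteq> ths j" if "i \<le> d" "j \<le> d" "i \<noteq> j" for i j
    using PA(7,8)[OF that] .
  have inj: "inj_on th {..d}" "inj_on ths {..d}"
    by (rule inj_onI, metis neq(1) atMost_iff) (rule inj_onI, metis neq(2) atMost_iff)
  note vphi = PA(9) and phi = PA(10)
  obtain c where c: "\<forall>i\<in>{2..d-1}. (th (i-2) - th (i+1)) / (th (i-1) - th i) = c \<and>
        (ths (i-2) - ths (i+1)) / (ths (i-1) - ths i) = c" using PA(11) by blast
  have four: "th i - th (i + 3) = c * (th (i + 1) - th (i + 2))"
    "ths i - ths (i + 3) = c * (ths (i + 1) - ths (i + 2))" if "i + 3 \<le> d" for i
  proof -
    have i: "i + 2 \<in> {2..d-1}" "i + 2 - 2 = i" "i + 2 - 1 = i + 1" "i + 2 + 1 = i + 3" using that by auto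
    have n: "th (i + 1) - th (i + 2) \<noteq> 0" "ths (i + 1) - ths (i + 2) \<noteq> 0"
      using neq[of "i + 1" "i + 2"] that by auto
    show "th i - th (i + 3) = c * (th (i + 1) - th (i + 2))"
      "ths i - ths (i + 3) = c * (ths (i + 1) - ths (i + 2))"
      using bspec[OF c i(1)] n unfolding i by (simp_all only: nonzero_divide_eq_eq[OF n(1)] nonzero_divide_eq_eq[OF n(2)])
  qed
  define b where "b = c - 1"
  obtain g x where x: "recurrent b g x" "\<And>i. i \<le> d \<Longrightarrow> x (int i) = th i"
    using recurrent_extension[OF four_term_recurrence[of d th c, OF four(1)]] unfolding b_def by blast
  obtain g' y where y: "recurrent b g' y" "\<And>i. i \<le> d \<Longrightarrow> y (int i) = ths i"
    using recurrent_extension[OF four_term_recurrence[of d ths c, OF four(2)]] unfolding b_def by blast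
  define x' where "x' i = x (int d - i)" for i
  have x': "recurrent b g x'" unfolding x'_def by (rule recurrent_reverse[OF x(1)])
  have x'_th: "x' (int i) = th (d - i)" if "i \<le> d" for i
    using x(2)[of "d - i"] that by (simp add: x'_def of_nat_diff)
  define k where "k = phi 1 / (th 0 - th d)"
  define F where "F = split_formula d x y k"
  define G where "G = split_formula d x' y (y 0 - y 1 - k)"
  have th0d: "th 0 - th d \<noteq> 0" "th d - th 0 \<noteq> 0" using neq(1)[of 0 d] d by auto
  have F: "F i = vphi i" if i: "i \<le> d + 1" for i
  proof -
    consider "i = 0" | "i = Suc d" | "1 \<le> i \<and> i \<le> d" using i by linarith
    thus ?thesis
    proof cases
      case 3
      thus ?thesis using vphi[of i] unfolding F_def k_def
        by (simp add: split_formula_eq[of d x th y ths] x(2) y(2))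
    qed (simp_all add: F_def split_formula_def seq)
  qed
  have v1: "vphi 1 = phi 1 + (ths 1 - ths 0) * (th 0 - th d)" using vphi[of 1] d th0d by simp
  have k': "y 0 - y 1 - k = vphi 1 / (th (d - 0) - th (d - d))"
  proof -
    have "vphi 1 / (th 0 - th d) = k + (ths 1 - ths 0)"
      unfolding v1 k_def using th0d by (simp add: add_divide_distrib)
    moreover have "vphi 1 / (th d - th 0) = - (vphi 1 / (th 0 - th d))"
      by (metis divide_minus_right minus_diff_eq)
    ultimately show ?thesis using y(2)[of 0] y(2)[of 1] d by simp
  qed
  have G: "G i = phi i" if i: "i \<le> d + 1" for i
  proof -
    consider "i = 0" | "i = Suc d" | "1 \<le> i \<and> i \<le> d" using i by linarith
    thus ?thesis
    proof cases
      case 3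
      have "G i = vphi 1 * (\<Sum>h\<in>{0..i-1}. (th (d - h) - th (d - (d - h))) / (th (d - 0) - th (d - d)))
          + (ths i - ths 0) * (th (d - (i - 1)) - th (d - d))"
        unfolding G_def k'
        by (rule split_formula_eq[of d x' "\<lambda>i. th (d - i)" y ths]) (use 3 x'_th y(2) in auto)
      also have "(\<Sum>h\<in>{0..i-1}. (th (d - h) - th (d - (d - h))) / (th (d - 0) - th (d - d))) =
          (\<Sum>h\<in>{0..i-1}. (th h - th (d - h)) / (th 0 - th d))"
      proof (intro sum.cong refl)
        fix h assume "h \<in> {0..i-1}"
        hence "d - (d - h) = h" using 3 by auto
        thus "(th (d - h) - th (d - (d - h))) / (th (d - 0) - th (d - d)) = (th h - th (d - h)) / (th 0 - th d)"
          by simp (metis minus_diff_eq minus_divide_divide)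
      qed
      also have "d - (i - 1) = d - i + 1" using 3 by auto
      finally show ?thesis using phi[of i] 3 by simp
    qed (simp_all add: G_def split_formula_def seq x'_def)
  qed
  define w where "w = aw1 b g g' x y F 0"
  have awF: "aw1 b g g' x y F i = w" for i
    unfolding w_def F_def by (rule aw1_split_formula[OF x(1) y(1)])
  have awG: "aw1 b g g' x' y G i = w" for i
  proof -
    have "aw1 b g g' x' y G i = aw1 b g g' x' y G 0"
      unfolding G_def by (rule aw1_split_formula[OF x' y(1)])
    also have "\<dots> = w"
      unfolding G_def w_def F_def x'_def by (rule aw1_split_formula_reverse[OF y(1)])
    finally show ?thesis .
  qed
  define y' where "y' i = y (int d - i)" for i
  have y': "recurrent b g' y'" unfolding y'_def by (rule recurrent_reverse[OF y(1)])
  \<comment> \<open>Reversing the dual eigenvalues turns the first split sequence into the second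
    one read backwards.\<close>
  define F' where "F' i = phi (d + 1 - i)" for i
  have awF': "aw1 b g g' x y' F' i = w" if "i < d" for i
  proof -
    have "aw1 b g g' x y' F' i = aw1 b g g' x' y G (d - 1 - i)"
      unfolding y'_def x'_def using that by (rule aw1_reverse) (simp add: F'_def G)
    thus ?thesis by (simp add: awG)
  qed
  define e where "e = aw0 g y x F 0 - w * y 0"
  have aw0F: "aw0 g y x F i = w * y (int i) + e" for i
  proof (induction i)
    case (Suc i)
    have "aw0 g y x F (Suc i) - aw0 g y x F i = (y (int i + 1) - y (int i)) * w"
      using aw0_Suc[OF y(1), of g x F i] awF by (simp add: aw1_symmetric[of b g' g y x])
    thus ?case using Suc by (simp add: algebra_simps add.commute)
  qed (simp add: e_def)
  define e' where "e' = aw0 g y' x F' 0 - w * y' 0"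
  have aw0F': "aw0 g y' x F' i = w * y' (int i) + e'" if "i \<le> d" for i
    using that
  proof (induction i)
    case (Suc i)
    have "aw0 g y' x F' (Suc i) - aw0 g y' x F' i = (y' (int i + 1) - y' (int i)) * w"
      using aw0_Suc[OF y', of g x F' i] awF'[of i] Suc.prems by (simp add: aw1_symmetric[of b g' g y' x])
    thus ?case using Suc by (simp add: algebra_simps add.commute)
  qed (simp add: e'_def)
  \<comment> \<open>The affine functions are compared at the common point \<open>y 0\<close>, which
    has index 0 in \<open>y\<close> and index \<open>d\<close> in \<open>y'\<close>.\<close>
  have "e' = e"
  proof -
    have "aw0 g y' x F' d = phi 1 * (y 0 - y (-1)) + x d * (y 0 - y 1) * (y 0 - y (-1)) - g * y 0 ^ 2"
      by (simp add: aw0_def y'_def F'_def seq)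
    moreover have "aw0 g y x F 0 = vphi 1 * (y 0 - y (-1)) + x 0 * (y 0 - y (-1)) * (y 0 - y 1) - g * y 0 ^ 2"
      using F[of 0] F[of 1] d by (simp add: aw0_def seq)
    moreover have "vphi 1 = phi 1 + (y 1 - y 0) * (x 0 - x d)"
      using v1 y(2)[of 0] y(2)[of 1] x(2)[of 0] x(2)[of d] d by simp
    ultimately have "aw0 g y' x F' d = aw0 g y x F 0" by (simp only:) (simp add: algebra_simps)
    moreover have "y' (int d) = y 0" by (simp add: y'_def)
    ultimately have "aw0 g y x F 0 = w * y 0 + e'" using aw0F'[of d] by simp
    thus ?thesis by (simp add: e_def)
  qed
  obtain N where N: "newton_action d N ths (\<lambda>i. x (int i)) F"
    using newton_action_exists[OF inj(2)] by blast
  have F1: "F 1 - F' 1 = (x 1 - x 0) * (y 0 - y (int d))"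
  proof -
    have Gd: "F' 1 = G d" using G[of d] by (simp add: F'_def)
    have "dsum d x' d = x d - x 0" using dsum_d[of d x'] by (simp add: x'_def)
    hence "G d = (y 0 - y 1 - k) * (x d - x 0) + (y d - y 0) * (x 1 - x 0)"
      by (simp add: G_def split_formula_def) (simp add: x'_def)
    moreover have "F 1 = k * (x 0 - x d) + (y 1 - y 0) * (x 0 - x d)"
      by (simp add: F_def split_formula_def dsum_def)
    ultimately show ?thesis unfolding Gd by (simp only:) (simp add: algebra_simps)
  qed
  have "newton_action d (\<lambda>j k. N (d - j) (d - k)) (\<lambda>h. ths (d - h)) (\<lambda>i. x (int i)) F'"
    by (rule newton_action_reverse[OF x(1) y(1) inj(2) y(2) N _ _ _ awF aw0F awF'[unfolded y'_def]
          aw0F'[unfolded y'_def \<open>e' = e\<close>] F1])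
       (simp_all add: F seq F'_def)
  from newton_action_cong[OF N, of th vphi] newton_action_cong[OF this, of th "\<lambda>i. phi (d + 1 - i)"]
  show thesis by (intro that[of N]) (simp_all add: x(2) F F'_def)
qed

section \<open>The matrix entries\<close>

definition diag_entries :: "nat \<Rightarrow> (nat \<Rightarrow> nat \<Rightarrow> 'a::field) \<Rightarrow> (nat \<Rightarrow> 'a) \<Rightarrow> (nat \<Rightarrow> 'a) \<Rightarrow> (nat \<Rightarrow> 'a) \<Rightarrow> bool" where
  "diag_entries d A th ths f \<longleftrightarrow>
     (\<forall>i\<le>d. A i i = th i + f i / (ths i - ths (i - 1)) + f (i + 1) / (ths i - ths (i + 1)))"

definition offdiag_entries :: "nat \<Rightarrow> (nat \<Rightarrow> nat \<Rightarrow> 'a::field) \<Rightarrow> (nat \<Rightarrow> 'a) \<Rightarrow> (nat \<Rightarrow> 'a) \<Rightarrow> (nat \<Rightarrow> 'a) \<Rightarrow> bool" where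
  "offdiag_entries d A ths f f' \<longleftrightarrow> (\<forall>i\<in>{1..d}. A i (i-1) * A (i-1) i = f i * f' i
        * ((\<Prod>h\<in>{0..<i-1}. ths (i-1) - ths h) / (\<Prod>h\<in>{0..i-1}. ths i - ths h))
        * ((\<Prod>h\<in>{i+1..d}. ths i - ths h) / (\<Prod>h\<in>{i..d}. ths (i-1) - ths h)))"

text \<open>Row \<open>i\<close> determines \<open>f (i + 1)\<close> from \<open>f i\<close>. This
  identifies split sequences obtained in different ways from the same diagonal.\<close>

lemma diag_entries_unique:
  assumes "inj_on ths {..d}" "diag_entries d A th ths f" "diag_entries d A th ths g" "f 0 = g 0"
  shows "i \<le> d \<Longrightarrow> f i = g i"
proof (induction i)
  case (Suc i)
  have "A i i = th i + f i / (ths i - ths (i - 1)) + f (i + 1) / (ths i - ths (i + 1))"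
    "A i i = th i + g i / (ths i - ths (i - 1)) + g (i + 1) / (ths i - ths (i + 1))"
    using assms(2,3) Suc.prems by (simp_all add: diag_entries_def)
  hence "f (i + 1) / (ths i - ths (i + 1)) = g (i + 1) / (ths i - ths (i + 1))"
    using Suc by auto
  moreover have "ths i - ths (i + 1) \<noteq> 0" using assms(1) Suc.prems by (force simp: inj_on_def)
  ultimately show ?case by auto
qed (use assms(4) in simp)

lemma newton_reverse:
  assumes "m \<le> d + 1"
  shows "newton (\<lambda>h. s (d - h)) (d + 1 - m) x = (\<Prod>h\<in>{m..d}. x - s h)"
  unfolding newton_def
  by (rule prod.reindex_bij_witness[of _ "\<lambda>h. d - h" "\<lambda>h. d - h"]) (use assms in auto)

lemma prod_diff_neq_0:
  fixes s :: "nat \<Rightarrow> 'a::field"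
  assumes "inj_on s {..d}" "i \<le> d" "H \<subseteq> {..d} - {i}"
  shows "(\<Prod>h\<in>H. s i - s h) \<noteq> 0"
proof -
  have "finite H" using assms(3) by (rule finite_subset) simp
  moreover have "s i - s h \<noteq> 0" if "h \<in> H" for h
    using that assms by (auto simp: inj_on_def)
  ultimately show ?thesis by simp
qed

text \<open>The entries above the diagonal are read from the Newton basis, those below from the
  reversed one, where row \<open>i\<close> sits at position \<open>d - i\<close>; the quotients of
  Newton values are the products in the formula.\<close>

lemma offdiag_entriesI:
  fixes s :: "nat \<Rightarrow> 'a::field"
  assumes s: "inj_on s {..d}"
    and N: "\<And>j. j < d \<Longrightarrow> N j (Suc j) * newton s (Suc j) (s (Suc j)) = f (Suc j) * newton s j (s j)"
    and N': "\<And>i. i < d \<Longrightarrow> N (d - i) (d - Suc i) * newton (\<lambda>h. s (d - h)) (Suc i) (s (d - Suc i)) =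
      f' (Suc i) * newton (\<lambda>h. s (d - h)) i (s (d - i))"
  shows "offdiag_entries d N s f (\<lambda>i. f' (d + 1 - i))"
  unfolding offdiag_entries_def
proof
  fix i assume "i \<in> {1..d}"
  then obtain j where i: "i = Suc j" and j: "j < d" by (cases i) auto
  let ?a = "\<Prod>h\<in>{0..<i-1}. s (i-1) - s h" and ?b = "\<Prod>h\<in>{0..i-1}. s i - s h"
  let ?c = "\<Prod>h\<in>{i+1..d}. s i - s h" and ?e = "\<Prod>h\<in>{i..d}. s (i-1) - s h"
  have nz: "?b \<noteq> 0" "?e \<noteq> 0"
    by (rule prod_diff_neq_0[OF s]; use i j in auto)+
  have "N (i - 1) i * ?b = f i * ?a"
    using N[OF j] i by (simp add: newton_def atLeast0LessThan lessThan_Suc_atMost atLeast0AtMost)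
  moreover have "N i (i - 1) * ?e = f' (d + 1 - i) * ?c"
  proof -
    have "newton (\<lambda>h. s (d - h)) (Suc (d - i)) (s j) = ?e"
    proof -
      have "Suc (d - i) = d + 1 - i" "i \<le> d + 1" "i - 1 = j" using i j by auto
      thus ?thesis using newton_reverse[of i d s "s j"] by simp
    qed
    moreover have "newton (\<lambda>h. s (d - h)) (d - i) (s i) = ?c"
      using newton_reverse[of "i + 1" d s "s i"] i j by simp
    moreover have "d - (d - i) = i" "d - Suc (d - i) = j" "Suc (d - i) = d + 1 - i" using i j by auto
    ultimately show ?thesis using N'[of "d - i"] i j by simp
  qed
  ultimately have "N (i - 1) i = f i * ?a / ?b" "N i (i - 1) = f' (d + 1 - i) * ?c / ?e"
    using nz by (simp_all add: field_simps)
  thus "N i (i-1) * N (i-1) i = f i * f' (d + 1 - i) * (?a / ?b) * (?c / ?e)" by (simp add: mult_ac)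
qed

text \<open>The components satisfy a three-term recurrence that can be solved for the next one, so
  the component at 0 determines all. Hence eigenvectors can be scaled to start with 1.\<close>

lemma left_eigenvector_eq_0:
  assumes X: "irreducible_tridiagonal d X"
    and q: "\<And>j. j \<le> d \<Longrightarrow> (\<Sum>k\<le>d. q k * X k j) = t * (q j :: 'a::field)" and q0: "q 0 = 0"
  shows "j \<le> d \<Longrightarrow> q j = 0"
proof (induction j rule: less_induct)
  case (less j)
  show ?case
  proof (cases j)
    case (Suc i)
    have i: "i \<le> d" "i < d" using Suc less.prems by auto
    have IH: "q i = 0" "i > 0 \<Longrightarrow> q (i - 1) = 0" using less.IH[of i] less.IH[of "i - 1"] Suc i by auto
    have "t * q i = (if i = 0 then 0 else q (i - 1) * X (i - 1) i) +
      (q i * X i i + (if i < d then q (Suc i) * X (Suc i) i else 0))"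
      unfolding q[OF i(1), symmetric] using i
      by (intro sum_near_diagonal) (auto simp: irreducible_tridiagonalD(1)[OF X])
    hence "q (Suc i) * X (Suc i) i = 0" using IH i by (auto split: if_splits)
    thus ?thesis using irreducible_tridiagonalD(3)[OF X i(2)] Suc by simp
  qed (simp add: q0)
qed

text \<open>The diagonalisation of \<open>A\<close>, where \<open>A*\<close> is the diagonal matrix of the \<open>ths i\<close> and
  \<open>B\<close> represents \<open>A*\<close> in the eigenbasis of \<open>A\<close> formed by the columns of \<open>P\<close>.\<close>

locale leonard_data =
  fixes d :: nat and th ths :: "nat \<Rightarrow> 'a::field" and A B P Q :: "nat \<Rightarrow> nat \<Rightarrow> 'a"
  assumes th: "inj_on th {..d}" and ths: "inj_on ths {..d}"
    and A: "irreducible_tridiagonal d A" and B: "irreducible_tridiagonal d B"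
    and PQ: "i \<le> d \<Longrightarrow> j \<le> d \<Longrightarrow> (\<Sum>k\<le>d. P i k * Q k j) = (if i = j then 1 else 0)"
    and QP: "i \<le> d \<Longrightarrow> j \<le> d \<Longrightarrow> (\<Sum>k\<le>d. Q i k * P k j) = (if i = j then 1 else 0)"
    and AP: "i \<le> d \<Longrightarrow> j \<le> d \<Longrightarrow> (\<Sum>k\<le>d. A i k * P k j) = P i j * th j"
    and QA: "i \<le> d \<Longrightarrow> j \<le> d \<Longrightarrow> (\<Sum>k\<le>d. Q i k * A k j) = th i * Q i j"
    and PB: "i \<le> d \<Longrightarrow> j \<le> d \<Longrightarrow> (\<Sum>k\<le>d. P i k * B k j) = ths i * P i j"
    and BQ: "i \<le> d \<Longrightarrow> j \<le> d \<Longrightarrow> (\<Sum>k\<le>d. B i k * Q k j) = Q i j * ths j"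
begin

lemma Q_0: "i \<le> d \<Longrightarrow> Q i 0 \<noteq> 0"
proof
  assume i: "i \<le> d" and Q0: "Q i 0 = 0"
  from left_eigenvector_eq_0[where q = "Q i", OF A QA[OF i] Q0] have "Q i j = 0" if "j \<le> d" for j using that by simp
  thus False using QP[OF i i] by simp
qed

lemma P_0: "i \<le> d \<Longrightarrow> P i 0 \<noteq> 0"
proof
  assume i: "i \<le> d" and P0: "P i 0 = 0"
  from left_eigenvector_eq_0[where q = "P i", OF B PB[OF i] P0] have "P i j = 0" if "j \<le> d" for j using that by simp
  thus False using PQ[OF i i] by simp
qed

lemma irreducible_tridiagonal_conj:
  assumes "irreducible_tridiagonal d X" "\<And>i. i \<le> d \<Longrightarrow> (c i :: 'a) \<noteq> 0"
  shows "irreducible_tridiagonal d (\<lambda>i j. X i j * c j / c i)"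
  using assms by (auto simp: irreducible_tridiagonal_def)

text \<open>\<open>B'\<close> and \<open>A'\<close> are \<open>B\<close> and \<open>A\<close>
  conjugated by the diagonal matrices that scale the eigenvectors to first component 1, as the model
  requires. Products of opposite off-diagonal entries are unaffected.\<close>

definition B' :: "nat \<Rightarrow> nat \<Rightarrow> 'a" where "B' i j = B i j * Q j 0 / Q i 0"

definition A' :: "nat \<Rightarrow> nat \<Rightarrow> 'a" where "A' i j = A i j * P j 0 / P i 0"

sublocale M: leonard_model d th ths A B' "\<lambda>j h. Q h j / Q h 0"
proof
  show "irreducible_tridiagonal d B'"
    unfolding B'_def by (rule irreducible_tridiagonal_conj[OF B Q_0])
  show "(\<Sum>k\<le>d. Q h k / Q h 0 * A k j) = th h * (Q h j / Q h 0)" if "h \<le> d" "j \<le> d" for h j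
    using QA[OF that] by (simp add: sum_divide_distrib[symmetric])
  show "(\<Sum>k\<le>d. B' h k * (Q k j / Q k 0)) = ths j * (Q h j / Q h 0)" if "h \<le> d" "j \<le> d" for h j
  proof -
    have "(\<Sum>k\<le>d. B' h k * (Q k j / Q k 0)) = (\<Sum>k\<le>d. B h k * Q k j / Q h 0)"
      using Q_0 by (intro sum.cong) (auto simp: B'_def)
    thus ?thesis using BQ[OF that] by (simp add: sum_divide_distrib[symmetric] mult.commute)
  qed
qed (use th ths A Q_0 in auto)

sublocale D: leonard_model d ths th B A' "\<lambda>j h. P h j / P h 0"
proof
  show "irreducible_tridiagonal d A'"
    unfolding A'_def by (rule irreducible_tridiagonal_conj[OF A P_0])
  show "(\<Sum>k\<le>d. P h k / P h 0 * B k j) = ths h * (P h j / P h 0)" if "h \<le> d" "j \<le> d" for h j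
    using PB[OF that] by (simp add: sum_divide_distrib[symmetric])
  show "(\<Sum>k\<le>d. A' h k * (P k j / P k 0)) = th j * (P h j / P h 0)" if "h \<le> d" "j \<le> d" for h j
  proof -
    have "(\<Sum>k\<le>d. A' h k * (P k j / P k 0)) = (\<Sum>k\<le>d. A h k * P k j / P h 0)"
      using P_0 by (intro sum.cong) (auto simp: A'_def)
    thus ?thesis using AP[OF that] by (simp add: sum_divide_distrib[symmetric] mult.commute)
  qed
qed (use th ths B P_0 in auto)

abbreviation vphi :: "nat \<Rightarrow> 'a" where "vphi \<equiv> M.split_seq"
abbreviation phi :: "nat \<Rightarrow> 'a" where "phi \<equiv> M.split_rev"

lemma diag: "diag_entries d A th ths vphi"
  unfolding diag_entries_def using M.X_diag by blast

text \<open>The split sequences of the dual system are read off the superdiagonal of \<open>A'\<close>; comparing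
  diagonal entries identifies them with the split sequences themselves.\<close>

lemma offdiag: "offdiag_entries d A ths vphi phi"
proof -
  interpret MR: leonard_model d "\<lambda>h. th (d - h)" ths A "\<lambda>h k. B' (d - h) (d - k)" "\<lambda>j h. Q (d - h) j / Q (d - h) 0"
    by (rule M.reverse)
  interpret DR: leonard_model d "\<lambda>h. ths (d - h)" th B "\<lambda>h k. A' (d - h) (d - k)" "\<lambda>j h. P (d - h) j / P (d - h) 0"
    by (rule D.reverse)
  have A'_diag: "A' i i = A i i" if "i \<le> d" for i using P_0[OF that] by (simp add: A'_def)
  have 1: "vphi i = D.split_seq i" if "i \<le> d" for i
  proof (rule diag_entries_unique[OF ths diag _ _ that])
    show "diag_entries d A th ths D.split_seq"
      unfolding diag_entries_def using D.B_diag A'_diag by simp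
  qed simp
  have 2: "phi i = D.split_rev (d + 1 - i)" if "i \<le> d" for i
  proof (rule diag_entries_unique[OF ths _ _ _ that])
    show "diag_entries d A (\<lambda>h. th (d - h)) ths phi"
      unfolding diag_entries_def using MR.X_diag by blast
    show "diag_entries d A (\<lambda>h. th (d - h)) ths (\<lambda>i. D.split_rev (d + 1 - i))"
      unfolding diag_entries_def
    proof (intro allI impI)
      fix i assume i: "i \<le> d"
      have e: "A i i = th (d - i) + D.split_rev (d - i) / (ths i - ths (d - (d - i - 1)))
          + D.split_rev (d - i + 1) / (ths i - ths (d - (d - i + 1)))"
        using DR.B_diag[of "d - i"] A'_diag[OF i] i by simp
      have "D.split_rev (d - i) / (ths i - ths (d - (d - i - 1))) =
          D.split_rev (d + 1 - (i + 1)) / (ths i - ths (i + 1))"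
      proof (cases "i = d")
        case False
        hence "d - (d - i - 1) = i + 1" using i by simp
        thus ?thesis by simp
      qed simp
      moreover have "D.split_rev (d - i + 1) / (ths i - ths (d - (d - i + 1))) =
          D.split_rev (d + 1 - i) / (ths i - ths (i - 1))"
      proof (cases "i = 0")
        case False
        hence "d - (d - i + 1) = i - 1" "d - i + 1 = d + 1 - i" using i by auto
        thus ?thesis by simp
      qed simp
      ultimately show "A i i = th (d - i) + D.split_rev (d + 1 - i) / (ths i - ths (i - 1))
          + D.split_rev (d + 1 - (i + 1)) / (ths i - ths (i + 1))"
        using e by simp
    qed
  qed simp
  have "offdiag_entries d A' ths D.split_seq (\<lambda>i. D.split_rev (d + 1 - i))"
    by (rule offdiag_entriesI[OF ths D.split_seq_Suc DR.split_seq_Suc]) auto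
  moreover have "A' i (i - 1) * A' (i - 1) i = A i (i - 1) * A (i - 1) i" if "i \<in> {1..d}" for i
  proof -
    have "i \<le> d" "i - 1 \<le> d" using that by auto
    thus ?thesis using P_0[of i] P_0[of "i - 1"] by (simp add: A'_def)
  qed
  ultimately show ?thesis
    unfolding offdiag_entries_def using 1 2 by simp
qed

text \<open>The formula for \<open>phi\<close> is that for \<open>vphi\<close> in the reversed
  system; reversing twice restores the original one.\<close>

lemma parameter_array:
  assumes "scalar_seq 0 d th" "scalar_seq 0 d ths"
  shows "parameter_array d (th, ths, vphi, phi)"
proof -
  interpret MR: leonard_model d "\<lambda>h. th (d - h)" ths A "\<lambda>h k. B' (d - h) (d - k)" "\<lambda>j h. Q (d - h) j / Q (d - h) 0"
    by (rule M.reverse)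
  have rev2: "split_sequence d (\<lambda>h. th (d - (d - h))) (\<lambda>h k. B' (d - (d - h)) (d - (d - k))) i = vphi i" for i
    unfolding split_sequence_def newton_def by (cases i) (auto intro!: arg_cong2[where f = "(/)"] prod.cong)
  obtain b g g' where bg: "\<And>i. i + 2 \<le> d \<Longrightarrow> th i - b * th (i + 1) + th (i + 2) = g"
    "\<And>i. i + 2 \<le> d \<Longrightarrow> ths i - b * ths (i + 1) + ths (i + 2) = g'"
    by (rule M.eigenvalue_recurrence) blast
  have four: "(t (i-2) - t (i+1)) / (t (i-1) - t i) = b + 1"
    if i: "i \<in> {2..d-1}" and t: "inj_on t {..d}" "\<And>i. i + 2 \<le> d \<Longrightarrow> t i - b * t (i + 1) + t (i + 2) = g"
    for i g and t :: "nat \<Rightarrow> 'a"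
  proof -
    define m where "m = i - 2"
    have i': "i = m + 2" "m + 3 \<le> d" using i by (auto simp: m_def)
    have "t (m + 1) - t (m + 2) \<noteq> 0" using t(1) i' by (force simp: inj_on_def)
    moreover have "t m - t (m + 3) = (b + 1) * (t (m + 1) - t (m + 2))"
    proof -
      have "t m - b * t (m + 1) + t (m + 2) = t (m + 1) - b * t (m + 2) + t (m + 3)"
        using t(2)[of m] t(2)[of "m + 1"] i' by (simp add: eval_nat_numeral)
      thus ?thesis by (simp add: algebra_simps)
    qed
    moreover have "i - 2 = m" "i + 1 = m + 3" "i - 1 = m + 1" using i' by auto
    ultimately show ?thesis by (simp only: i') (simp add: eval_nat_numeral)
  qed
  have "phi i = vphi 1 * (\<Sum>h\<in>{0..i-1}. (th h - th (d-h)) / (th 0 - th d))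
      + (ths i - ths 0) * (th (d-i+1) - th 0)" if i: "i \<in> {1..d}" for i
  proof -
    have "phi i = vphi 1 * (\<Sum>h\<in>{0..i-1}. (th (d - h) - th (d - (d - h))) / (th (d - 0) - th (d - d)))
      + (ths i - ths 0) * (th (d - (i - 1)) - th (d - d))"
      using i by (intro MR.split_seq_formula[unfolded rev2]) auto
    also have "(\<Sum>h\<in>{0..i-1}. (th (d - h) - th (d - (d - h))) / (th (d - 0) - th (d - d))) =
        (\<Sum>h\<in>{0..i-1}. (th h - th (d - h)) / (th 0 - th d))"
    proof (intro sum.cong refl)
      fix h assume "h \<in> {0..i-1}"
      hence "d - (d - h) = h" using i by auto
      thus "(th (d - h) - th (d - (d - h))) / (th (d - 0) - th (d - d)) = (th h - th (d - h)) / (th 0 - th d)"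
        by simp (metis minus_diff_eq minus_divide_divide)
    qed
    also have "d - (i - 1) = d - i + 1" using i by auto
    finally show ?thesis by simp
  qed
  moreover have "vphi i = phi 1 * (\<Sum>h\<in>{0..i-1}. (th h - th (d-h)) / (th 0 - th d))
      + (ths i - ths 0) * (th (i-1) - th d)" if i: "i \<in> {1..d}" for i
    using M.split_seq_formula[of i] i by simp
  moreover have "\<exists>c. \<forall>i\<in>{2..d-1}. (th (i-2) - th (i+1)) / (th (i-1) - th i) = c \<and>
        (ths (i-2) - ths (i+1)) / (ths (i-1) - ths i) = c"
    using four[OF _ th bg(1)] four[OF _ ths bg(2)] by blast
  moreover have "scalar_seq 1 d vphi" "scalar_seq 1 d phi"
    by (auto simp: scalar_seq_def split_sequence_def)
  moreover have "vphi i \<noteq> 0 \<and> phi i \<noteq> 0" if "i \<in> {1..d}" for i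
    using M.split_seq_neq_0[of i] MR.split_seq_neq_0[of i] that by auto
  moreover have "th i \<noteq> th j \<and> ths i \<noteq> ths j" if "i \<le> d" "j \<le> d" "i \<noteq> j" for i j
    using M.s_neq[OF that] M.s'_neq[OF that] by simp
  ultimately show ?thesis
    unfolding parameter_array.simps using assms by blast
qed

end

definition diagm :: "nat \<Rightarrow> (nat \<Rightarrow> 'a::zero) \<Rightarrow> 'a mat" where
  "diagm d t = mat (Suc d) (Suc d) (\<lambda>(i, j). if i = j then t i else 0)"

lemma diagm_carrier [simp]: "diagm d t \<in> carrier_mat (Suc d) (Suc d)"
  by (simp add: diagm_def)

lemma mult_diagm:
  fixes X :: "'a::comm_semiring_1 mat"
  assumes "X \<in> carrier_mat (Suc d) (Suc d)" "i \<le> d" "j \<le> d"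
  shows "(X * diagm d t) $$ (i, j) = X $$ (i, j) * t j"
    and "(diagm d t * X) $$ (i, j) = t i * X $$ (i, j)"
proof -
  have "(X * diagm d t) $$ (i, j) = (\<Sum>k\<le>d. X $$ (i, k) * t k * (if k = j then 1 else 0))"
    unfolding index_mult_mat_sum[OF assms(1) diagm_carrier assms(2,3)]
    using assms by (intro sum.cong) (auto simp: diagm_def)
  thus "(X * diagm d t) $$ (i, j) = X $$ (i, j) * t j" using delta_sum[OF assms(3)] by simp
  have "(diagm d t * X) $$ (i, j) = (\<Sum>k\<le>d. t k * X $$ (k, j) * (if k = i then 1 else 0))"
    unfolding index_mult_mat_sum[OF diagm_carrier assms]
    using assms by (intro sum.cong) (auto simp: diagm_def)
  thus "(diagm d t * X) $$ (i, j) = t i * X $$ (i, j)" using delta_sum[OF assms(2)] by simp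
qed

lemma leonard_data_mat:
  fixes A P Q :: "'a::field mat"
  assumes A: "A \<in> carrier_mat (Suc d) (Suc d)" and P: "P \<in> carrier_mat (Suc d) (Suc d)"
    and Q: "Q \<in> carrier_mat (Suc d) (Suc d)"
    and PQ: "P * Q = 1\<^sub>m (Suc d)" and QP: "Q * P = 1\<^sub>m (Suc d)" and AP: "A * P = P * diagm d th"
    and "inj_on th {..d}" "inj_on ths {..d}" "irreducible_tridiagonal d (\<lambda>i j. A $$ (i, j))"
    and B: "irreducible_tridiagonal d (\<lambda>i j. (Q * diagm d ths * P) $$ (i, j))"
  shows "leonard_data d th ths (\<lambda>i j. A $$ (i, j)) (\<lambda>i j. (Q * diagm d ths * P) $$ (i, j))
    (\<lambda>i j. P $$ (i, j)) (\<lambda>i j. Q $$ (i, j))"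
proof -
  let ?n = "Suc d" and ?D = "diagm d th" and ?S = "diagm d ths"
  have D: "?D \<in> carrier_mat ?n ?n" and S: "?S \<in> carrier_mat ?n ?n" by simp_all
  have Bc: "Q * ?S * P \<in> carrier_mat ?n ?n" using P Q S by (metis mult_carrier_mat)
  have "Q * A = Q * A * (P * Q)" using A Q by (simp add: PQ)
  also have "\<dots> = Q * (A * P) * Q" using A P Q by (simp add: assoc_mult_mat[of _ ?n ?n _ ?n _ ?n])
  also have "\<dots> = (Q * P) * ?D * Q"
    using A P Q D unfolding AP by (simp add: assoc_mult_mat[of _ ?n ?n _ ?n _ ?n])
  also have "\<dots> = ?D * Q" unfolding QP left_mult_one_mat[OF D] ..
  finally have QA: "Q * A = ?D * Q" .
  have SP: "?S * P \<in> carrier_mat ?n ?n" using S P by (metis mult_carrier_mat)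
  have PB: "P * (Q * ?S * P) = ?S * P"
    unfolding assoc_mult_mat[OF Q S P] assoc_mult_mat[OF P Q SP, symmetric] PQ
    by (rule left_mult_one_mat[OF SP])
  have QS: "Q * ?S \<in> carrier_mat ?n ?n" using S Q by (metis mult_carrier_mat)
  have BQ: "Q * ?S * P * Q = Q * ?S"
    unfolding assoc_mult_mat[OF QS P Q] PQ by (rule right_mult_one_mat[OF QS])
  show ?thesis
  proof
    fix i j assume ij: "i \<le> d" "j \<le> d"
    show "(\<Sum>k\<le>d. P $$ (i, k) * Q $$ (k, j)) = (if i = j then 1 else 0)"
      using index_mult_mat_sum[OF P Q ij] ij by (simp add: PQ)
    show "(\<Sum>k\<le>d. Q $$ (i, k) * P $$ (k, j)) = (if i = j then 1 else 0)"
      using index_mult_mat_sum[OF Q P ij] ij by (simp add: QP)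
    show "(\<Sum>k\<le>d. A $$ (i, k) * P $$ (k, j)) = P $$ (i, j) * th j"
      using index_mult_mat_sum[OF A P ij] mult_diagm(1)[OF P ij] by (simp add: AP)
    show "(\<Sum>k\<le>d. Q $$ (i, k) * A $$ (k, j)) = th i * Q $$ (i, j)"
      using index_mult_mat_sum[OF Q A ij] mult_diagm(2)[OF Q ij] by (simp add: QA)
    show "(\<Sum>k\<le>d. P $$ (i, k) * (Q * ?S * P) $$ (k, j)) = ths i * P $$ (i, j)"
      using index_mult_mat_sum[OF P Bc ij] mult_diagm(2)[OF P ij] by (simp add: PB)
    show "(\<Sum>k\<le>d. (Q * ?S * P) $$ (i, k) * Q $$ (k, j)) = Q $$ (i, j) * ths j"
      using index_mult_mat_sum[OF Bc Q ij] mult_diagm(1)[OF Q ij] by (simp add: BQ)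
  qed fact+
qed

text \<open>Conjugation by a diagonal matrix makes an irreducible tridiagonal matrix symmetric. The
  resulting bilinear form is diagonal in the eigenbasis, so that \<open>B\<close> is symmetrizable as well.\<close>

lemma dual_symmetrizable:
  fixes A B P Q :: "nat \<Rightarrow> nat \<Rightarrow> 'a::field"
  assumes A: "irreducible_tridiagonal d A" and th: "inj_on th {..d}"
    and PQ: "\<And>i j. i \<le> d \<Longrightarrow> j \<le> d \<Longrightarrow> (\<Sum>k\<le>d. Q i k * P k j) = (if i = j then 1 else 0)"
    and RL: "\<And>i j. i \<le> d \<Longrightarrow> j \<le> d \<Longrightarrow> (\<Sum>k\<le>d. P i k * Q k j) = (if i = j then 1 else 0)"
    and AP: "\<And>i j. i \<le> d \<Longrightarrow> j \<le> d \<Longrightarrow> (\<Sum>k\<le>d. A i k * P k j) = P i j * th j"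
    and PB: "\<And>i j. i \<le> d \<Longrightarrow> j \<le> d \<Longrightarrow> (\<Sum>k\<le>d. P i k * B k j) = ths i * P i j"
    and ij: "i \<le> d" "j \<le> d"
  shows "B i j = 0 \<longleftrightarrow> B j i = 0"
proof -
  \<comment> \<open>Weights of a diagonal form for which \<open>A\<close> is self-adjoint; they
    exist because the entries next to the diagonal are nonzero.\<close>
  define K where "K = rec_nat 1 (\<lambda>j c. c * A j (Suc j) / A (Suc j) j)"
  have K_Suc: "K (Suc j) * A (Suc j) j = K j * A j (Suc j)" if "j < d" for j
    using irreducible_tridiagonalD(3)[OF A that] by (simp add: K_def)
  have K0: "K j \<noteq> 0" if "j \<le> d" for j
    using that
  proof (induction j)
    case (Suc j)
    thus ?case using K_Suc[of j] irreducible_tridiagonalD(2,3)[OF A, of j] by auto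
  qed (simp add: K_def)
  have sym: "K m * A m k = K k * A k m" if "m \<le> d" "k \<le> d" for m k
  proof -
    consider "m = k" | "k = Suc m" | "m = Suc k" | "\<bar>int m - int k\<bar> > 1" by linarith
    thus ?thesis
    proof cases
      case 4
      hence "\<bar>int k - int m\<bar> > 1" by simp
      thus ?thesis using irreducible_tridiagonalD(1)[OF A] that 4 by simp
    qed (use K_Suc[of m] K_Suc[of k] that in auto)
  qed
  \<comment> \<open>Gram matrix of the eigenvectors. Distinct eigenvalues make it diagonal, and no
    diagonal entry is 0 because the form is nondegenerate and the eigenvectors span.\<close>
  define G where "G i j = (\<Sum>m\<le>d. P m i * K m * P m j)" for i j
  have G_off: "G i j = 0" if ij: "i \<le> d" "j \<le> d" and ne: "i \<noteq> j" for i j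
  proof -
    have "th j * G i j = (\<Sum>m\<le>d. th j * (P m i * K m * P m j))"
      by (simp add: G_def sum_distrib_left)
    also have "\<dots> = (\<Sum>m\<le>d. P m i * K m * (\<Sum>k\<le>d. A m k * P k j))"
      by (intro sum.cong) (auto simp: AP ij)
    also have "\<dots> = (\<Sum>m\<le>d. \<Sum>k\<le>d. P m i * (K m * A m k) * P k j)"
      by (simp add: sum_distrib_left mult.assoc)
    also have "\<dots> = (\<Sum>m\<le>d. \<Sum>k\<le>d. P m i * (K k * A k m) * P k j)"
      by (intro sum.cong refl) (simp add: sym)
    also have "\<dots> = (\<Sum>k\<le>d. \<Sum>m\<le>d. A k m * P m i * (K k * P k j))"
      by (subst sum.swap) (simp add: mult_ac)
    also have "\<dots> = (\<Sum>k\<le>d. (\<Sum>m\<le>d. A k m * P m i) * (K k * P k j))"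
      by (simp add: sum_distrib_right)
    also have "\<dots> = th i * G i j"
      unfolding G_def sum_distrib_left by (intro sum.cong) (auto simp: AP ij)
    finally have "(th j - th i) * G i j = 0" by (simp add: left_diff_distrib)
    moreover have "th j \<noteq> th i" using th ij ne by (auto simp: inj_on_def)
    ultimately show ?thesis by simp
  qed
  have G_diag: "G i i \<noteq> 0" if i: "i \<le> d" for i
  proof
    assume "G i i = 0"
    hence G0: "G i j = 0" if "j \<le> d" for j using G_off[OF i that] by (cases "i = j") auto
    have "P m i = 0" if m: "m \<le> d" for m
    proof -
      have "(\<Sum>j\<le>d. G i j * Q j m) = (\<Sum>j\<le>d. \<Sum>k\<le>d. P k i * K k * (P k j * Q j m))"
        by (simp add: G_def sum_distrib_right mult.assoc)
      also have "\<dots> = (\<Sum>k\<le>d. P k i * K k * (\<Sum>j\<le>d. P k j * Q j m))"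
        by (subst sum.swap) (simp add: sum_distrib_left)
      also have "\<dots> = (\<Sum>k\<le>d. P k i * K k * (if k = m then 1 else 0))"
        by (intro sum.cong) (auto simp: RL m)
      also have "\<dots> = P m i * K m" by (rule delta_sum[OF m])
      finally show ?thesis using G0 K0[OF m] by simp
    qed
    hence "(\<Sum>k\<le>d. Q i k * P k i) = 0" by simp
    thus False using PQ[OF i i] by simp
  qed
  have GB: "G i i * B i j = (\<Sum>m\<le>d. P m i * K m * ths m * P m j)" if ij: "i \<le> d" "j \<le> d" for i j
  proof -
    have "(\<Sum>m\<le>d. P m i * K m * ths m * P m j) = (\<Sum>m\<le>d. P m i * K m * (\<Sum>k\<le>d. P m k * B k j))"
      by (intro sum.cong) (auto simp: PB ij mult.assoc)
    also have "\<dots> = (\<Sum>k\<le>d. G i k * B k j)"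
      unfolding G_def sum_distrib_left sum_distrib_right by (subst sum.swap) (simp add: mult.assoc)
    also have "\<dots> = (\<Sum>k\<le>d. G i i * B k j * (if k = i then 1 else 0))"
      by (intro sum.cong) (use G_off ij in auto)
    also have "\<dots> = G i i * B i j" by (rule delta_sum[OF ij(1)])
    finally show ?thesis by simp
  qed
  have "G i i * B i j = G j j * B j i"
    unfolding GB[OF ij] GB[OF ij(2,1)] by (intro sum.cong) (auto simp: mult_ac)
  thus ?thesis using G_diag ij by (metis mult_eq_0_iff)
qed

text \<open>Eigenvectors of the upper bidiagonal matrix with diagonal \<open>th\<close> and superdiagonal
  \<open>f\<close>, and their dual basis.\<close>

lemma bidiagonal_eigenvectors:
  fixes th f :: "nat \<Rightarrow> 'a::field"
  assumes th: "inj_on th {..d}" and f: "f 0 = 0" "f (Suc d) = 0"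
  obtains R S where
    "\<And>k i. i < k \<Longrightarrow> R k i = 0" "\<And>i. R i i = 1" "\<And>h k. k < h \<Longrightarrow> S h k = 0" "\<And>h. S h h = 1"
    "\<And>k i. k \<le> d \<Longrightarrow> i \<le> d \<Longrightarrow> th k * R k i + f (Suc k) * R (Suc k) i = th i * R k i"
    "\<And>h i. h \<le> d \<Longrightarrow> i \<le> d \<Longrightarrow> (\<Sum>k\<le>d. S h k * R k i) = (if h = i then 1 else 0)"
proof -
  \<comment> \<open>The eigenvector equations solved step by step, away from the diagonal entry
    1.\<close>
  define R where "R k i = (if k \<le> i then \<Prod>m\<in>{k<..i}. f m / (th i - th (m - 1)) else 0)" for k i
  define S where "S h k = (if h \<le> k then \<Prod>m\<in>{h<..k}. f m / (th h - th m) else 0)" for h k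
  have ne: "th i - th j \<noteq> 0" if "i \<le> d" "j \<le> d" "i \<noteq> j" for i j
    using th that by (auto simp: inj_on_def)
  have R: "th k * R k i + f (Suc k) * R (Suc k) i = th i * R k i" if ki: "k \<le> d" "i \<le> d" for k i
  proof (cases "k < i")
    case True
    have "{k<..i} = insert (Suc k) {Suc k<..i}" using True by auto
    hence "R k i = f (Suc k) / (th i - th k) * R (Suc k) i" using True by (simp add: R_def)
    hence "R k i * (th i - th k) = f (Suc k) * R (Suc k) i" using ne[of i k] True ki by simp
    thus ?thesis by (simp add: algebra_simps)
  next
    case False
    hence "R (Suc k) i = 0" by (simp add: R_def)
    moreover have "th k * R k i = th i * R k i" using False by (cases "k = i") (simp_all add: R_def)
    ultimately show ?thesis by simp
  qed
  have S: "th k * S h k + f k * S h (k - 1) = th h * S h k" if hk: "h \<le> d" "k \<le> d" for h k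
  proof (cases "h < k")
    case True
    then obtain m where m: "k = Suc m" "h \<le> m" by (cases k) auto
    have "{h<..k} = insert k {h<..m}" using m by auto
    hence "S h k = f k / (th h - th k) * S h m" using m by (simp add: S_def)
    hence "S h k * (th h - th k) = f k * S h m" using ne[of h k] True hk by simp
    thus ?thesis using m by (simp add: algebra_simps)
  next
    case False
    have "f k * S h (k - 1) = 0" using False f by (cases k) (auto simp: S_def)
    moreover have "th k * S h k = th h * S h k" using False by (cases "k = h") (simp_all add: S_def)
    ultimately show ?thesis by auto
  qed
  have "(\<Sum>k\<le>d. S h k * R k i) = (if h = i then 1 else 0)" if hi: "h \<le> d" "i \<le> d" for h i
  proof (cases "h = i")
    case True
    have "(\<Sum>k\<le>d. S h k * R k i) = (\<Sum>k\<in>{i}. S h k * R k i)"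
      by (rule sum.mono_neutral_right) (use hi True in \<open>auto simp: S_def R_def\<close>)
    thus ?thesis using True by (simp add: S_def R_def)
  next
    case False
    \<comment> \<open>The superdiagonal part; shifting its index moves the matrix from the left
      eigenvector \<open>S h\<close> to the right eigenvector given by column \<open>i\<close> of
      \<open>R\<close>, so that their pairing is 0 for distinct eigenvalues.\<close>
    define g where "g k = f k * S h (k - 1) * R k i" for k
    have "th h * (\<Sum>k\<le>d. S h k * R k i) = (\<Sum>k\<le>d. (th k * S h k + f k * S h (k - 1)) * R k i)"
      unfolding sum_distrib_left
    proof (intro sum.cong refl)
      fix k assume "k \<in> {..d}"
      hence k: "k \<le> d" by simp
      show "th h * (S h k * R k i) = (th k * S h k + f k * S h (k - 1)) * R k i"
        unfolding S[OF hi(1) k] by (simp add: mult.assoc)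
    qed
    also have "\<dots> = (\<Sum>k\<le>d. th k * S h k * R k i) + (\<Sum>k\<le>d. g k)"
      by (simp add: g_def distrib_right sum.distrib)
    finally have 1: "th h * (\<Sum>k\<le>d. S h k * R k i) = (\<Sum>k\<le>d. th k * S h k * R k i) + (\<Sum>k\<le>d. g k)" .
    have "th i * (\<Sum>k\<le>d. S h k * R k i) = (\<Sum>k\<le>d. S h k * (th i * R k i))"
      by (simp add: sum_distrib_left mult_ac)
    also have "\<dots> = (\<Sum>k\<le>d. S h k * (th k * R k i + f (Suc k) * R (Suc k) i))"
      by (intro sum.cong) (auto simp: R hi)
    also have "\<dots> = (\<Sum>k\<le>d. th k * S h k * R k i) + (\<Sum>k\<le>d. g (Suc k))"
      by (simp add: g_def distrib_left sum.distrib mult_ac)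
    also have "(\<Sum>k\<le>d. g (Suc k)) = (\<Sum>k\<le>d. g k)"
      using sum.atMost_Suc_shift[of g d] f by (simp add: g_def)
    finally have "th i * (\<Sum>k\<le>d. S h k * R k i) = th h * (\<Sum>k\<le>d. S h k * R k i)" using 1 by simp
    hence "(th h - th i) * (\<Sum>k\<le>d. S h k * R k i) = 0" by (auto simp: left_diff_distrib)
    thus ?thesis using ne[OF hi False] False by simp
  qed
  thus thesis using R by (intro that[of R S]) (auto simp: R_def S_def)
qed

section \<open>From a parameter array to a Leonard system\<close>

lemma nonzero_offdiag_product:
  assumes pa: "parameter_array d (th, ths, vphi, phi)" and ths: "inj_on ths {..d}"
    and A: "offdiag_entries d A ths vphi phi" and i: "i < d"
  shows "A (Suc i) i * A i (Suc i) \<noteq> 0"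
proof -
  let ?j = "Suc i"
  have "vphi ?j \<noteq> 0" "phi ?j \<noteq> 0" using parameter_arrayD(5,6)[OF pa, of ?j] i by auto
  moreover have "(\<Prod>h\<in>{0..<?j-1}. ths (?j-1) - ths h) \<noteq> 0" "(\<Prod>h\<in>{0..?j-1}. ths ?j - ths h) \<noteq> 0"
    "(\<Prod>h\<in>{?j+1..d}. ths ?j - ths h) \<noteq> 0" "(\<Prod>h\<in>{?j..d}. ths (?j-1) - ths h) \<noteq> 0"
    by (rule prod_diff_neq_0[OF ths]; use i in auto)+
  moreover have "?j \<in> {1..d}" using i by simp
  ultimately show ?thesis using A unfolding offdiag_entries_def by fastforce
qed

text \<open>\<open>N\<close> is conjugate to \<open>A\<close> by the diagonal matrix of the \<open>c i\<close>.  In the Newton basis \<open>Y\<close>, rescaled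
  accordingly, \<open>A\<close> and \<open>A*\<close> become the bidiagonal matrices \<open>U\<close> and \<open>L\<close>; this gives the entries of \<open>B\<close>
  below the diagonal, and symmetrizability gives the others.\<close>

lemma leonard_data_of_entries:
  fixes A :: "'a::field mat"
  assumes A: "A \<in> carrier_mat (Suc d) (Suc d)"
    and tri: "\<And>i j. i \<le> d \<Longrightarrow> j \<le> d \<Longrightarrow> \<bar>int i - int j\<bar> > 1 \<Longrightarrow> A $$ (i, j) = 0"
    and pa: "parameter_array d (th, ths, vphi, phi)"
    and diag: "diag_entries d (\<lambda>i j. A $$ (i, j)) th ths vphi"
    and off: "offdiag_entries d (\<lambda>i j. A $$ (i, j)) ths vphi phi"
  obtains P Q where "P \<in> carrier_mat (Suc d) (Suc d)" "Q \<in> carrier_mat (Suc d) (Suc d)"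
    "P * Q = 1\<^sub>m (Suc d)" "Q * P = 1\<^sub>m (Suc d)" "A * P = P * diagm d th"
    "irreducible_tridiagonal d (\<lambda>i j. A $$ (i, j))"
    "irreducible_tridiagonal d (\<lambda>i j. (Q * diagm d ths * P) $$ (i, j))"
proof -
  note PA = parameter_arrayD[OF pa]
  let ?n = "Suc d"
  have th: "inj_on th {..d}" and ths: "inj_on ths {..d}"
    by (rule inj_onI, metis PA(7) atMost_iff) (rule inj_onI, metis PA(8) atMost_iff)
  have seq: "vphi 0 = 0" "vphi (Suc d) = 0" "phi (Suc d) = 0" using PA(3,4) by (auto simp: scalar_seq_def)
  have off_nz: "A $$ (Suc i, i) * A $$ (i, Suc i) \<noteq> 0" if "i < d" for i
    by (rule nonzero_offdiag_product[OF pa ths off that])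
  have irrA: "irreducible_tridiagonal d (\<lambda>i j. A $$ (i, j))"
    unfolding irreducible_tridiagonal_def
  proof (intro allI impI conjI)
    fix i j assume ij: "i \<le> d" "j \<le> d" "\<bar>int i - int j\<bar> = 1"
    hence "j = Suc i \<and> i < d \<or> i = Suc j \<and> j < d" by linarith
    thus "A $$ (i, j) \<noteq> 0" using off_nz[of i] off_nz[of j] by auto
  qed (rule tri)
  show thesis
  proof (cases "d = 0")
    case True
    have "A = diagm d th"
      using diag True seq by (intro eq_matI_le[OF A]) (auto simp: diag_entries_def diagm_def)
    moreover have "diagm d th * 1\<^sub>m ?n = 1\<^sub>m ?n * diagm d th"
      by (simp only: right_mult_one_mat[OF diagm_carrier] left_mult_one_mat[OF diagm_carrier])
    ultimately show thesis using A irrA True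
      by (intro that[of "1\<^sub>m ?n" "1\<^sub>m ?n"]) (auto simp: irreducible_tridiagonal_def)
  next
    case False
    hence d: "d \<ge> 1" by simp
    obtain N where N: "newton_action d N ths th vphi"
      and N': "newton_action d (\<lambda>j k. N (d - j) (d - k)) (\<lambda>h. ths (d - h)) th (\<lambda>i. phi (d + 1 - i))"
      using parameter_array_newton_action[OF pa d] by blast
    have ths': "inj_on (\<lambda>h. ths (d - h)) {..d}" by (rule inj_on_reverse[OF ths])
    have N_diag: "N i i = A $$ (i, i)" if "i \<le> d" for i
      using newton_action_diag[OF N ths that seq(1,2)] diag that by (simp add: diag_entries_def)
    have "offdiag_entries d N ths vphi (\<lambda>i. phi (d + 1 - (d + 1 - i)))"
      by (rule offdiag_entriesI[OF ths, where N = N and f' = "\<lambda>i. phi (d + 1 - i)"])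
         (use newton_action_super[OF N ths] newton_action_super[OF N' ths'] in auto)
    moreover have "d + 1 - (d + 1 - i) = i" if "i \<in> {1..d}" for i using that by auto
    ultimately have "N i (i - 1) * N (i - 1) i = A $$ (i, i - 1) * A $$ (i - 1, i)" if "i \<in> {1..d}" for i
      using off that by (simp add: offdiag_entries_def)
    hence N_off: "N (Suc i) i * N i (Suc i) = A $$ (Suc i, i) * A $$ (i, Suc i)" if "i < d" for i
      using that by (metis One_nat_def Suc_leI atLeastAtMost_iff diff_Suc_1 le_add1 plus_1_eq_Suc)
    have N_tri: "N i j = 0" if "i \<le> d" "j \<le> d" "\<bar>int i - int j\<bar> > 1" for i j
    proof (cases "i < j")
      case True
      thus ?thesis using that by (intro newton_action_upper[OF N ths]) auto
    next
      case False
      have "N (d - (d - i)) (d - (d - j)) = 0"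
        using that False by (intro newton_action_upper[OF N' ths']) auto
      thus ?thesis using that by simp
    qed
    \<comment> \<open>Fixed by matching the superdiagonal of \<open>A\<close> with that of the
      conjugate of \<open>N\<close>; the subdiagonals then match because the products of opposite
      entries agree.\<close>
    define c where "c = rec_nat 1 (\<lambda>j c. c * A $$ (j, Suc j) / N j (Suc j))"
    have c_Suc: "c (Suc j) = c j * A $$ (j, Suc j) / N j (Suc j)" for j by (simp add: c_def)
    have c0: "c j \<noteq> 0" if "j \<le> d" for j
      using that
    proof (induction j)
      case (Suc j)
      thus ?case using off_nz[of j] N_off[of j] by (auto simp: c_Suc)
    qed (simp add: c_def)
    have conj: "A $$ (i, j) = N i j * c j / c i" if ij: "i \<le> d" "j \<le> d" for i j
    proof -
      consider "i = j" | "j = Suc i" | "i = Suc j" | "\<bar>int i - int j\<bar> > 1" by linarith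
      thus ?thesis
      proof cases
        case 1
        thus ?thesis using N_diag ij c0 by simp
      next
        case 2
        thus ?thesis using off_nz[of i] N_off[of i] ij c0[of i] by (auto simp: c_Suc)
      next
        case 3
        hence "N j i \<noteq> 0" "A $$ (j, i) \<noteq> 0" "N i j * N j i = A $$ (i, j) * A $$ (j, i)"
          using off_nz[of j] N_off[of j] ij by auto
        moreover have "c i = c j * A $$ (j, i) / N j i" using 3 c_Suc by simp
        ultimately have ci: "c i * N j i = c j * A $$ (j, i)" "N j i \<noteq> 0"
          and off: "N i j * N j i = A $$ (i, j) * A $$ (j, i)" by auto
        have "A $$ (i, j) * c i * N j i = A $$ (i, j) * (c j * A $$ (j, i))"
          by (simp add: ci(1)[symmetric])
        also have "\<dots> = c j * (N i j * N j i)" unfolding off by (simp add: mult_ac)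
        finally have "A $$ (i, j) * c i = N i j * c j" using ci(2) by (simp add: mult_ac)
        thus ?thesis using c0[OF ij(1)] by (simp add: field_simps)
      qed (use tri[OF ij] N_tri[OF ij] in auto)
    qed
    define Y where "Y = mat ?n ?n (\<lambda>(j, i). newton ths i (ths j) / c j)"
    define U where "U = mat ?n ?n (\<lambda>(k, i). if k = i then th i else if Suc k = i then vphi i else 0)"
    define L where "L = mat ?n ?n (\<lambda>(k, i). if k = i then ths i else if k = Suc i then 1 else 0 :: 'a)"
    let ?D = "diagm d th" and ?E = "diagm d ths"
    obtain R S where R: "\<And>k i. i < k \<Longrightarrow> R k i = 0" "\<And>i. R i i = 1"
      and S: "\<And>h k. k < h \<Longrightarrow> S h k = 0" "\<And>h. S h h = 1"
      and UR: "\<And>k i. k \<le> d \<Longrightarrow> i \<le> d \<Longrightarrow> th k * R k i + vphi (Suc k) * R (Suc k) i = th i * R k i"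
      and SR: "\<And>h i. h \<le> d \<Longrightarrow> i \<le> d \<Longrightarrow> (\<Sum>k\<le>d. S h k * R k i) = (if h = i then 1 else 0)"
      by (rule bidiagonal_eigenvectors[OF th seq(1,2)]) blast
    obtain Z' where Z': "\<And>i j. i \<le> d \<Longrightarrow> j \<le> d \<Longrightarrow> (\<Sum>k\<le>d. newton ths k (ths i) / c i * Z' k j) = (if i = j then 1 else 0)"
      "\<And>i j. i \<le> d \<Longrightarrow> j \<le> d \<Longrightarrow> (\<Sum>k\<le>d. Z' i k * (newton ths j (ths k) / c k)) = (if i = j then 1 else 0)"
    proof (rule lower_triangular_inverse[of d "\<lambda>j i. newton ths i (ths j) / c j"])
      show "newton ths i (ths i) / c i \<noteq> 0" if "i \<le> d" for i
        using newton_neq_0[OF ths, of i i] c0 that by simp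
    qed (auto simp: newton_eq_0)
    define Rm where "Rm = mat ?n ?n (\<lambda>(i, j). R i j)"
    define Sm where "Sm = mat ?n ?n (\<lambda>(i, j). S i j)"
    define Z where "Z = mat ?n ?n (\<lambda>(i, j). Z' i j)"
    note defs = Y_def U_def L_def Rm_def Sm_def Z_def
    have carr: "Y \<in> carrier_mat ?n ?n" "U \<in> carrier_mat ?n ?n" "L \<in> carrier_mat ?n ?n"
      "Rm \<in> carrier_mat ?n ?n" "Sm \<in> carrier_mat ?n ?n" "Z \<in> carrier_mat ?n ?n"
      "?D \<in> carrier_mat ?n ?n" "?E \<in> carrier_mat ?n ?n"
      by (simp_all add: defs)
    note mc = mult_carrier_mat[of _ ?n ?n _ ?n]
    have AY: "A * Y = Y * U"
    proof (rule eq_matI_le)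
      fix j i assume ij: "j \<le> d" "i \<le> d"
      have "(A * Y) $$ (j, i) = (\<Sum>k\<le>d. A $$ (j, k) * (newton ths i (ths k) / c k))"
        unfolding index_mult_mat_sum[OF A carr(1) ij] using ij by (intro sum.cong) (auto simp: Y_def)
      also have "\<dots> = (\<Sum>k\<le>d. N j k * newton ths i (ths k) / c j)"
        by (intro sum.cong refl) (use conj ij c0 in simp)
      also have "\<dots> = (th i * newton ths i (ths j) + vphi i * newton ths (i - 1) (ths j)) / c j"
        using newton_actionD[OF N ij(2,1)] by (simp add: sum_divide_distrib[symmetric])
      also have "\<dots> = (\<Sum>k\<le>d. Y $$ (j, k) * U $$ (k, i))"
      proof -
        have s: "(\<Sum>k\<le>d. Y $$ (j, k) * U $$ (k, i)) =
            (if i = 0 then 0 else Y $$ (j, i - 1) * U $$ (i - 1, i)) +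
            (Y $$ (j, i) * U $$ (i, i) + (if i < d then Y $$ (j, Suc i) * U $$ (Suc i, i) else 0))"
          using ij by (intro sum_near_diagonal) (auto simp: U_def)
        show ?thesis unfolding s
          using ij seq by (cases i) (auto simp: U_def Y_def add_divide_distrib mult.commute)
      qed
      also have "\<dots> = (Y * U) $$ (j, i)" using ij by (simp add: index_mult_mat_sum[OF carr(1,2)])
      finally show "(A * Y) $$ (j, i) = (Y * U) $$ (j, i)" .
    qed (use A carr in \<open>auto intro!: mc\<close>)
    have EY: "?E * Y = Y * L"
    proof (rule eq_matI_le)
      fix j i assume ij: "j \<le> d" "i \<le> d"
      have "(\<Sum>k\<le>d. Y $$ (j, k) * L $$ (k, i)) =
          (if i = 0 then 0 else Y $$ (j, i - 1) * L $$ (i - 1, i)) +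
          (Y $$ (j, i) * L $$ (i, i) + (if i < d then Y $$ (j, Suc i) * L $$ (Suc i, i) else 0))"
        using ij by (intro sum_near_diagonal) (auto simp: L_def)
      also have "\<dots> = newton ths i (ths j) / c j * ths i + newton ths (Suc i) (ths j) / c j"
      proof (cases "i = d")
        case True
        thus ?thesis using ij newton_eq_0[of j "Suc d" ths] by (auto simp: L_def Y_def)
      qed (use ij in \<open>auto simp: L_def Y_def\<close>)
      also have "\<dots> = ths j * Y $$ (j, i)" using ij by (simp add: Y_def newton_Suc ring_distribs diff_divide_distrib)
      finally show "(?E * Y) $$ (j, i) = (Y * L) $$ (j, i)"
        using ij by (simp add: mult_diagm(2)[OF carr(1)] index_mult_mat_sum[OF carr(1,3)])
    qed (use carr in \<open>auto intro!: mc\<close>)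
    have UR': "U * Rm = Rm * ?D"
    proof (rule eq_matI_le)
      fix k i assume ki: "k \<le> d" "i \<le> d"
      have "(\<Sum>m\<le>d. U $$ (k, m) * Rm $$ (m, i)) =
          (if k = 0 then 0 else U $$ (k, k - 1) * Rm $$ (k - 1, i)) +
          (U $$ (k, k) * Rm $$ (k, i) + (if k < d then U $$ (k, Suc k) * Rm $$ (Suc k, i) else 0))"
        using ki by (intro sum_near_diagonal) (auto simp: U_def)
      also have "\<dots> = th k * R k i + vphi (Suc k) * R (Suc k) i"
        using ki seq by (cases "k = d") (auto simp: U_def Rm_def)
      finally have "(U * Rm) $$ (k, i) = th i * R k i"
        unfolding index_mult_mat_sum[OF carr(2,4) ki] UR[OF ki] .
      thus "(U * Rm) $$ (k, i) = (Rm * ?D) $$ (k, i)"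
        unfolding mult_diagm(1)[OF carr(4) ki] using ki by (simp add: Rm_def mult.commute)
    qed (use carr in \<open>auto intro!: mc\<close>)
    have SR': "Sm * Rm = 1\<^sub>m ?n"
    proof (rule eq_matI_le)
      fix i j assume ij: "i \<le> d" "j \<le> d"
      show "(Sm * Rm) $$ (i, j) = 1\<^sub>m ?n $$ (i, j)"
        unfolding index_mult_mat_sum[OF carr(5,4) ij] using SR[OF ij] ij by (simp add: Sm_def Rm_def)
    qed (use carr in \<open>auto intro!: mc\<close>)
    have ZY: "Z * Y = 1\<^sub>m ?n"
    proof (rule eq_matI_le)
      fix i j assume ij: "i \<le> d" "j \<le> d"
      show "(Z * Y) $$ (i, j) = 1\<^sub>m ?n $$ (i, j)"
        unfolding index_mult_mat_sum[OF carr(6,1) ij] using Z'(2)[OF ij] ij by (simp add: Z_def Y_def)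
    qed (use carr in \<open>auto intro!: mc\<close>)
    define P where "P = Y * Rm"
    define Q where "Q = Sm * Z"
    have PQc: "P \<in> carrier_mat ?n ?n" "Q \<in> carrier_mat ?n ?n"
      unfolding P_def Q_def by (rule mc; rule carr)+
    note assoc = assoc_mult_mat[of _ ?n ?n _ ?n _ ?n]
    have "Q * P = Sm * (Z * (Y * Rm))"
      unfolding P_def Q_def by (rule assoc) (use carr in \<open>auto intro!: mc\<close>)
    also have "Z * (Y * Rm) = Rm" using carr ZY by (simp add: assoc[symmetric])
    finally have QP: "Q * P = 1\<^sub>m ?n" using SR' by simp
    have PQ: "P * Q = 1\<^sub>m ?n" by (rule mat_mult_left_right_inverse[OF PQc(2,1) QP])
    have "A * P = A * Y * Rm" unfolding P_def by (rule assoc[symmetric]) (use A carr in auto)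
    also have "\<dots> = Y * (U * Rm)" unfolding AY by (rule assoc) (use carr in auto)
    also have "\<dots> = P * ?D" unfolding P_def UR' by (rule assoc[symmetric]) (use carr in auto)
    finally have AP: "A * P = P * ?D" .
    define B where "B = Q * ?E * P"
    have Bc: "B \<in> carrier_mat ?n ?n" unfolding B_def using PQc carr by (auto intro!: mc)
    have "?E * P = Y * L * Rm"
      unfolding P_def EY[symmetric] by (rule assoc[symmetric]) (use carr in auto)
    also have "\<dots> = Y * (L * Rm)" by (rule assoc) (use carr in auto)
    finally have EP: "?E * P = Y * (L * Rm)" .
    have LRc: "L * Rm \<in> carrier_mat ?n ?n" using carr by (auto intro!: mc)
    have "B = Q * (?E * P)" unfolding B_def by (rule assoc) (use PQc carr in auto)
    also have "\<dots> = Sm * (Z * (Y * (L * Rm)))"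
      unfolding EP Q_def by (rule assoc) (use carr LRc in \<open>auto intro!: mc\<close>)
    also have "Z * (Y * (L * Rm)) = Z * Y * (L * Rm)" by (rule assoc[symmetric]) (use carr LRc in auto)
    also have "\<dots> = L * Rm" unfolding ZY by (rule left_mult_one_mat[OF LRc])
    \<comment> \<open>Upper unitriangular times lower bidiagonal times upper unitriangular: nothing
      below the subdiagonal, and ones on it.\<close>
    finally have B: "B = Sm * (L * Rm)" .
    have LR: "(L * Rm) $$ (k, i) = ths k * R k i + (if k = 0 then 0 else R (k - 1) i)"
      if ki: "k \<le> d" "i \<le> d" for k i
    proof -
      have "(L * Rm) $$ (k, i) = (if k = 0 then 0 else L $$ (k, k - 1) * Rm $$ (k - 1, i)) +
          (L $$ (k, k) * Rm $$ (k, i) + (if k < d then L $$ (k, Suc k) * Rm $$ (Suc k, i) else 0))"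
        unfolding index_mult_mat_sum[OF carr(3,4) ki]
        using ki by (intro sum_near_diagonal) (auto simp: L_def)
      thus ?thesis using ki by (auto simp: L_def Rm_def)
    qed
    have Bsum: "B $$ (h, i) = (\<Sum>k\<le>d. S h k * (ths k * R k i + (if k = 0 then 0 else R (k - 1) i)))"
      if "h \<le> d" "i \<le> d" for h i
      unfolding B index_mult_mat_sum[OF carr(5) LRc that]
      using that by (intro sum.cong) (auto simp: Sm_def LR)
    have B_low: "B $$ (h, i) = 0" if hi: "h \<le> d" "i \<le> d" "Suc i < h" for h i
      unfolding Bsum[OF hi(1,2)]
    proof (intro sum.neutral ballI)
      fix k assume "k \<in> {..d}"
      show "S h k * (ths k * R k i + (if k = 0 then 0 else R (k - 1) i)) = 0"
        using S(1)[of k h] R(1)[of i k] R(1)[of i "k - 1"] hi(3) by (cases "k < h") auto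
    qed
    have B_sub: "B $$ (Suc i, i) \<noteq> 0" if i: "i < d" for i
    proof -
      have "B $$ (Suc i, i) = (\<Sum>k\<in>{Suc i}. S (Suc i) k * (ths k * R k i + (if k = 0 then 0 else R (k - 1) i)))"
        unfolding Bsum[OF Suc_leI[OF i] less_imp_le[OF i]]
      proof (rule sum.mono_neutral_right)
        show "\<forall>k\<in>{..d} - {Suc i}. S (Suc i) k * (ths k * R k i + (if k = 0 then 0 else R (k - 1) i)) = 0"
        proof
          fix k assume "k \<in> {..d} - {Suc i}"
          hence "k < Suc i \<or> i < k \<and> i < k - 1" by auto
          thus "S (Suc i) k * (ths k * R k i + (if k = 0 then 0 else R (k - 1) i)) = 0"
            using S(1)[of k "Suc i"] R(1)[of i k] R(1)[of i "k - 1"] by auto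
        qed
      qed (use i in auto)
      thus ?thesis using R S by simp
    qed
    have sym: "B $$ (i, j) = 0 \<longleftrightarrow> B $$ (j, i) = 0" if ij: "i \<le> d" "j \<le> d" for i j
    proof (rule dual_symmetrizable[OF irrA th, where P = "\<lambda>i j. P $$ (i, j)" and Q = "\<lambda>i j. Q $$ (i, j)" and ths = ths])
      fix i j assume ij: "i \<le> d" "j \<le> d"
      show "(\<Sum>k\<le>d. Q $$ (i, k) * P $$ (k, j)) = (if i = j then 1 else 0)"
        using index_mult_mat_sum[OF PQc(2,1) ij] ij by (simp add: QP)
      show "(\<Sum>k\<le>d. P $$ (i, k) * Q $$ (k, j)) = (if i = j then 1 else 0)"
        using index_mult_mat_sum[OF PQc ij] ij by (simp add: PQ)
      show "(\<Sum>k\<le>d. A $$ (i, k) * P $$ (k, j)) = P $$ (i, j) * th j"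
        using index_mult_mat_sum[OF A PQc(1) ij] mult_diagm(1)[OF PQc(1) ij] by (simp add: AP)
      have EPc: "?E * P \<in> carrier_mat ?n ?n" using PQc carr by (auto intro!: mc)
      have "P * B = ?E * P"
        unfolding B_def assoc[OF PQc(2) carr(8) PQc(1)] assoc[OF PQc EPc, symmetric] PQ
        by (rule left_mult_one_mat[OF EPc])
      thus "(\<Sum>k\<le>d. P $$ (i, k) * B $$ (k, j)) = ths i * P $$ (i, j)"
        using index_mult_mat_sum[OF PQc(1) Bc ij] mult_diagm(2)[OF PQc(1) ij] by simp
    qed (rule ij)+
    have "irreducible_tridiagonal d (\<lambda>i j. B $$ (i, j))"
      unfolding irreducible_tridiagonal_def
    proof (intro allI impI conjI)
      fix i j assume ij: "i \<le> d" "j \<le> d" "1 < \<bar>int i - int j\<bar>"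
      hence "Suc j < i \<or> Suc i < j" by linarith
      thus "B $$ (i, j) = 0" using B_low[of i j] B_low[of j i] sym[of i j] ij by auto
    next
      fix i j assume ij: "i \<le> d" "j \<le> d" "\<bar>int i - int j\<bar> = 1"
      hence "j = Suc i \<and> i < d \<or> i = Suc j \<and> j < d" by linarith
      thus "B $$ (i, j) \<noteq> 0" using B_sub[of i] B_sub[of j] sym[of i j] ij by auto
    qed
    thus thesis using PQc PQ QP AP irrA by (intro that) (auto simp: B_def)
  qed
qed

section \<open>Diagonalisation and primitive idempotents\<close>

definition diagonalizes :: "nat \<Rightarrow> 'a::field mat \<Rightarrow> (nat \<Rightarrow> 'a) \<Rightarrow> 'a mat \<Rightarrow> 'a mat \<Rightarrow> bool" where
  "diagonalizes d A th P Q \<longleftrightarrow>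
     A \<in> carrier_mat (Suc d) (Suc d) \<and> P \<in> carrier_mat (Suc d) (Suc d) \<and> Q \<in> carrier_mat (Suc d) (Suc d) \<and>
     P * Q = 1\<^sub>m (Suc d) \<and> Q * P = 1\<^sub>m (Suc d) \<and> A * P = P * diagm d th \<and> inj_on th {..d}"

lemma diagonalizesD:
  assumes "diagonalizes d A th P Q"
  shows "A \<in> carrier_mat (Suc d) (Suc d)" "P \<in> carrier_mat (Suc d) (Suc d)"
    "Q \<in> carrier_mat (Suc d) (Suc d)" "P * Q = 1\<^sub>m (Suc d)" "Q * P = 1\<^sub>m (Suc d)"
    "A * P = P * diagm d th" "inj_on th {..d}"
  using assms by (auto simp: diagonalizes_def)

lemma diagonalizes_delta:
  assumes "diagonalizes d A th P Q" "i \<le> d" "j \<le> d"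
  shows "(\<Sum>k\<le>d. P $$ (i, k) * Q $$ (k, j)) = (if i = j then 1 else 0)"
    and "(\<Sum>k\<le>d. Q $$ (i, k) * P $$ (k, j)) = (if i = j then 1 else 0)"
    and "(\<Sum>k\<le>d. A $$ (i, k) * P $$ (k, j)) = P $$ (i, j) * th j"
  using index_mult_mat_sum[OF diagonalizesD(2,3)[OF assms(1)] assms(2,3)]
    index_mult_mat_sum[OF diagonalizesD(3,2)[OF assms(1)] assms(2,3)]
    index_mult_mat_sum[OF diagonalizesD(1,2)[OF assms(1)] assms(2,3)]
    mult_diagm(1)[OF diagonalizesD(2)[OF assms(1)] assms(2,3), of th]
    diagonalizesD(4-6)[OF assms(1)] assms(2,3) by auto

lemma eigenvectors_independent:
  fixes v :: "nat \<Rightarrow> nat \<Rightarrow> 'a::field"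
  assumes "finite I" "inj_on th I"
    and "\<And>i j. i \<in> I \<Longrightarrow> j \<le> d \<Longrightarrow> (\<Sum>k\<le>d. A j k * v i k) = th i * v i j"
    and "\<And>i. i \<in> I \<Longrightarrow> \<exists>j\<le>d. v i j \<noteq> 0"
    and "\<And>j. j \<le> d \<Longrightarrow> (\<Sum>i\<in>I. x i * v i j) = 0" "i \<in> I"
  shows "x i = 0"
  using assms
proof (induction I arbitrary: x i rule: finite_induct)
  case (insert m I)
  have sum0: "x m * v m j + (\<Sum>i\<in>I. x i * v i j) = 0" if "j \<le> d" for j
    using insert.prems(4)[OF that] insert.hyps by simp
  have ev: "(\<Sum>k\<le>d. A j k * v i k) = th i * v i j" if "i \<in> insert m I" "j \<le> d" for i j
    using insert.prems(2) that by blast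
  have "(\<Sum>i\<in>I. (x i * (th i - th m)) * v i j) = 0" if j: "j \<le> d" for j
  proof -
    have "0 = (\<Sum>k\<le>d. A j k * (x m * v m k + (\<Sum>i\<in>I. x i * v i k)))"
      by (rule sym, rule sum.neutral) (use sum0 in auto)
    also have "\<dots> = x m * (\<Sum>k\<le>d. A j k * v m k) + (\<Sum>k\<le>d. \<Sum>i\<in>I. x i * (A j k * v i k))"
      by (simp add: distrib_left sum.distrib sum_distrib_left mult_ac)
    also have "(\<Sum>k\<le>d. \<Sum>i\<in>I. x i * (A j k * v i k)) = (\<Sum>i\<in>I. x i * (\<Sum>k\<le>d. A j k * v i k))"
      by (subst sum.swap) (simp add: sum_distrib_left)
    also have "\<dots> = (\<Sum>i\<in>I. x i * (th i * v i j))"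
      by (intro sum.cong refl) (simp add: ev j)
    also have "(\<Sum>k\<le>d. A j k * v m k) = th m * v m j" using ev j by simp
    finally have "x m * (th m * v m j) + (\<Sum>i\<in>I. x i * (th i * v i j)) = 0" by simp
    moreover have "th m * (x m * v m j + (\<Sum>i\<in>I. x i * v i j)) = 0" using sum0[OF j] by simp
    ultimately have "(\<Sum>i\<in>I. x i * (th i * v i j)) - th m * (\<Sum>i\<in>I. x i * v i j) = 0"
      by (simp add: algebra_simps add_eq_0_iff)
    thus ?thesis by (simp add: sum_distrib_left sum_subtractf[symmetric] algebra_simps)
  qed
  hence "x i * (th i - th m) = 0" if "i \<in> I" for i
    using that insert.IH[of "\<lambda>i. x i * (th i - th m)" i] insert.prems(1-3) by (auto simp: inj_on_def)
  moreover have "th i \<noteq> th m" if "i \<in> I" for i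
    using insert.prems(1) insert.hyps(2) that by (auto simp: inj_on_def)
  ultimately have xI: "x i = 0" if "i \<in> I" for i using that by auto
  obtain j where "j \<le> d" "v m j \<noteq> 0" using insert.prems(3) by auto
  hence "x m = 0" using sum0[of j] xI by simp
  thus ?case using xI insert.prems(5) by auto
qed simp

lemma diagonalizes_exists:
  assumes A: "A \<in> carrier_mat (Suc d) (Suc d)" and th: "inj_on th {..d}"
    and ev: "\<And>i. i \<le> d \<Longrightarrow> eigenvalue A (th i)"
  obtains P Q where "diagonalizes d A th P Q"
proof -
  let ?n = "Suc d"
  have "\<forall>i. \<exists>v. i \<le> d \<longrightarrow> eigenvector A v (th i)" using ev by (auto simp: eigenvalue_def)
  then obtain v where v: "\<And>i. i \<le> d \<Longrightarrow> eigenvector A (v i) (th i)" by metis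
  have vc: "v i \<in> carrier_vec ?n" "v i \<noteq> 0\<^sub>v ?n" "A *\<^sub>v v i = th i \<cdot>\<^sub>v v i" if "i \<le> d" for i
    using v[OF that] A by (auto simp: eigenvector_def)
  define P where "P = mat ?n ?n (\<lambda>(j, i). v i $ j)"
  have P: "P \<in> carrier_mat ?n ?n" by (simp add: P_def)
  have Av: "(\<Sum>k\<le>d. A $$ (j, k) * v i $ k) = th i * v i $ j" if "i \<le> d" "j \<le> d" for i j
  proof -
    have "(A *\<^sub>v v i) $ j = (\<Sum>k\<le>d. A $$ (j, k) * v i $ k)"
      by (rule index_mult_mat_vec_sum[OF A vc(1)[OF that(1)] that(2)])
    thus ?thesis using vc(1,3)[OF that(1)] that(2) by simp
  qed
  have vnz: "\<exists>j\<le>d. v i $ j \<noteq> 0" if "i \<le> d" for i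
  proof (rule ccontr)
    assume "\<not> ?thesis"
    hence "v i = 0\<^sub>v ?n" using vc(1)[OF that] by (intro eq_vecI) auto
    thus False using vc(2)[OF that] by simp
  qed
  have "det P \<noteq> 0"
  proof
    assume "det P = 0"
    then obtain x where x: "x \<in> carrier_vec ?n" "x \<noteq> 0\<^sub>v ?n" "P *\<^sub>v x = 0\<^sub>v ?n"
      using det_0_iff_vec_prod_zero_field[OF P] by auto
    have x0: "(\<Sum>i\<le>d. x $ i * v i $ j) = 0" if "j \<le> d" for j
    proof -
      have "(P *\<^sub>v x) $ j = (\<Sum>i\<le>d. x $ i * v i $ j)"
        unfolding index_mult_mat_vec_sum[OF P x(1) that]
        using that by (intro sum.cong) (auto simp: P_def)
      thus ?thesis using x(3) that by simp
    qed
    have "x $ i = 0" if "i \<le> d" for i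
    proof (rule eigenvectors_independent[of "{..d}" th d "\<lambda>j k. A $$ (j, k)" "\<lambda>i k. v i $ k"])
      show "(\<Sum>k\<le>d. A $$ (j, k) * v i $ k) = th i * v i $ j" if "i \<in> {..d}" "j \<le> d" for i j
        using Av that by simp
      show "\<exists>j\<le>d. v i $ j \<noteq> 0" if "i \<in> {..d}" for i using vnz that by simp
    qed (use th that x0 in simp_all)
    hence "x = 0\<^sub>v ?n" using x(1) by (intro eq_vecI) auto
    thus False using x(2) by simp
  qed
  from det_non_zero_imp_unit[OF P this, of "()"]
  obtain Q where Q: "Q \<in> carrier_mat ?n ?n" "Q * P = 1\<^sub>m ?n" "P * Q = 1\<^sub>m ?n"
    unfolding Units_def ring_mat_simps by auto
  have "A * P = P * diagm d th"
  proof (rule eq_matI_le)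
    fix j i assume ij: "j \<le> d" "i \<le> d"
    show "(A * P) $$ (j, i) = (P * diagm d th) $$ (j, i)"
      unfolding index_mult_mat_sum[OF A P ij] mult_diagm(1)[OF P ij]
      using Av[OF ij(2,1)] ij by (simp add: P_def mult.commute)
  qed (use A P in \<open>auto intro!: mult_carrier_mat[of _ ?n ?n _ ?n]\<close>)
  thus thesis using A P Q th by (intro that) (auto simp: diagonalizes_def)
qed

lemma diagonalizes_diagm:
  "inj_on t {..d} \<Longrightarrow> diagonalizes d (diagm d t) t (1\<^sub>m (Suc d)) (1\<^sub>m (Suc d))"
  unfolding diagonalizes_def
  by (simp add: right_mult_one_mat[OF diagm_carrier] left_mult_one_mat[OF diagm_carrier])

lemma eigenvalue_diagm:
  fixes t :: "nat \<Rightarrow> 'a::field"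
  shows "eigenvalue (diagm d t) x \<longleftrightarrow> x \<in> t ` {..d}"
proof -
  let ?n = "Suc d"
  have mv: "(diagm d t *\<^sub>v v) $ i = t i * v $ i" if "v \<in> carrier_vec ?n" "i \<le> d" for v i
  proof -
    have "(diagm d t *\<^sub>v v) $ i = (\<Sum>k\<le>d. t k * v $ k * (if k = i then 1 else 0))"
      unfolding index_mult_mat_vec_sum[OF diagm_carrier that]
      using that by (intro sum.cong) (auto simp: diagm_def)
    thus ?thesis using delta_sum[OF that(2)] by simp
  qed
  show ?thesis
  proof
    assume "eigenvalue (diagm d t) x"
    then obtain v where v: "v \<in> carrier_vec ?n" "v \<noteq> 0\<^sub>v ?n" "diagm d t *\<^sub>v v = x \<cdot>\<^sub>v v"
      by (auto simp: eigenvalue_def eigenvector_def diagm_def)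
    have "\<exists>i\<le>d. v $ i \<noteq> 0"
    proof (rule ccontr)
      assume "\<not> ?thesis"
      hence "v = 0\<^sub>v ?n" using v(1) by (intro eq_vecI) auto
      thus False using v(2) by simp
    qed
    then obtain i where i: "i \<le> d" "v $ i \<noteq> 0" by blast
    have "t i * v $ i = x * v $ i" using mv[OF v(1) i(1)] v(1,3) i(1) by auto
    hence "x = t i" using i(2) by simp
    thus "x \<in> t ` {..d}" using i(1) by simp
  next
    assume "x \<in> t ` {..d}"
    then obtain i where i: "i \<le> d" "x = t i" by auto
    have "diagm d t *\<^sub>v unit_vec ?n i = x \<cdot>\<^sub>v unit_vec ?n i"
    proof (rule eq_vecI)
      fix j assume "j < dim_vec (x \<cdot>\<^sub>v unit_vec ?n i)"
      thus "(diagm d t *\<^sub>v unit_vec ?n i) $ j = (x \<cdot>\<^sub>v unit_vec ?n i) $ j"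
        using mv[of "unit_vec ?n i" j] i by (auto simp: unit_vec_def)
    qed (simp add: diagm_def)
    moreover have "unit_vec ?n i \<noteq> (0\<^sub>v ?n :: 'a vec)" using i by simp
    ultimately show "eigenvalue (diagm d t) x"
      unfolding eigenvalue_def eigenvector_def by (intro exI[of _ "unit_vec ?n i"]) (auto simp: diagm_def)
  qed
qed

lemma diagonalizes_eq:
  assumes "diagonalizes d A th P Q"
  shows "A = P * diagm d th * Q"
proof -
  note D = diagonalizesD[OF assms]
  have "P * diagm d th * Q = A * (P * Q)"
    unfolding D(6)[symmetric] by (rule assoc_mult_mat) (use D in auto)
  thus ?thesis using D by simp
qed

lemma diagonalizes_eigenvalues:
  assumes "diagonalizes d A th P Q"
  shows "{t. eigenvalue A t} = th ` {..d}"
proof -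
  note D = diagonalizesD[OF assms]
  have "similar_mat A (diagm d th)"
    unfolding similar_mat_def similar_mat_wit_def Let_def
    using D diagonalizes_eq[OF assms] by (intro exI[of _ P] exI[of _ Q]) auto
  hence "char_poly A = char_poly (diagm d th)" by (rule char_poly_similar)
  hence "eigenvalue A t \<longleftrightarrow> eigenvalue (diagm d th) t" for t
    using eigenvalue_root_char_poly[OF D(1)] eigenvalue_root_char_poly[OF diagm_carrier, of d th] by simp
  thus ?thesis by (auto simp: eigenvalue_diagm)
qed

lemma diagonalizes_multiplicity_free: "diagonalizes d A th P Q \<Longrightarrow> multiplicity_free d A"
  using diagonalizes_eigenvalues[of d A th P Q] diagonalizesD(1,7)[of d A th P Q]
  by (simp add: multiplicity_free_def card_image)

definition unit_diag :: "nat \<Rightarrow> nat \<Rightarrow> 'a::field mat" where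
  "unit_diag d i = diagm d (\<lambda>k. if k = i then 1 else 0)"

lemma conj_diagm_mult:
  assumes D: "diagonalizes d A th P Q"
  shows "(P * diagm d s * Q) * (P * diagm d t * Q) = P * diagm d (\<lambda>k. s k * t k) * Q"
proof -
  note D = diagonalizesD[OF assms]
  let ?n = "Suc d"
  note assoc = assoc_mult_mat[of _ ?n ?n _ ?n _ ?n] and mc = mult_carrier_mat[of _ ?n ?n _ ?n]
  have DD: "diagm d s * diagm d t = diagm d (\<lambda>k. s k * t k)"
  proof (rule eq_matI_le)
    fix i j assume ij: "i \<le> d" "j \<le> d"
    show "(diagm d s * diagm d t) $$ (i, j) = diagm d (\<lambda>k. s k * t k) $$ (i, j)"
      unfolding mult_diagm(1)[OF diagm_carrier ij] using ij by (simp add: diagm_def)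
  qed (auto intro!: mc)
  have tQ: "diagm d t * Q \<in> carrier_mat ?n ?n" and Ps: "P * diagm d s \<in> carrier_mat ?n ?n"
    using D by (auto intro!: mc)
  have "(P * diagm d s * Q) * (P * diagm d t * Q) = P * diagm d s * (Q * (P * (diagm d t * Q)))"
  proof -
    have "P * diagm d t * Q = P * (diagm d t * Q)" by (rule assoc) (use D in auto)
    moreover have "P * diagm d s * Q * (P * (diagm d t * Q)) = P * diagm d s * (Q * (P * (diagm d t * Q)))"
      by (rule assoc) (use D Ps tQ in \<open>auto intro!: mc\<close>)
    ultimately show ?thesis by simp
  qed
  also have "Q * (P * (diagm d t * Q)) = Q * P * (diagm d t * Q)"
    by (rule assoc[symmetric]) (use D tQ in auto)
  also have "\<dots> = diagm d t * Q" unfolding D(5) by (rule left_mult_one_mat[OF tQ])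
  also have "P * diagm d s * (diagm d t * Q) = P * (diagm d s * (diagm d t * Q))"
    by (rule assoc) (use D tQ in auto)
  also have "diagm d s * (diagm d t * Q) = diagm d s * diagm d t * Q"
    by (rule assoc[symmetric]) (use D in auto)
  also have "P * (diagm d s * diagm d t * Q) = P * diagm d (\<lambda>k. s k * t k) * Q"
    unfolding DD by (rule assoc[symmetric]) (use D in auto)
  finally show ?thesis .
qed

lemma conj_diagm_index:
  fixes P Q :: "'a::field mat"
  assumes "P \<in> carrier_mat (Suc d) (Suc d)" "Q \<in> carrier_mat (Suc d) (Suc d)" "i \<le> d" "j \<le> d"
  shows "(P * diagm d t * Q) $$ (i, j) = (\<Sum>k\<le>d. P $$ (i, k) * t k * Q $$ (k, j))"
proof -
  have c: "P * diagm d t \<in> carrier_mat (Suc d) (Suc d)"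
    using assms by (auto intro!: mult_carrier_mat[of _ "Suc d" "Suc d"])
  show ?thesis
    unfolding index_mult_mat_sum[OF c assms(2-4)]
    by (intro sum.cong) (auto simp: mult_diagm(1)[OF assms(1,3)])
qed

text \<open>In the eigenbasis every factor is diagonal, and the product of the diagonals is the
  Lagrange polynomial of \<open>th i\<close>, which is 1 at \<open>th i\<close> and 0 at the other
  eigenvalues.\<close>

lemma primitive_idempotent_eq:
  assumes D: "diagonalizes d A th P Q" and i: "i \<le> d"
  shows "primitive_idempotent d A th i = P * unit_diag d i * Q"
proof -
  note D' = diagonalizesD[OF D]
  let ?n = "Suc d"
  have fac: "inverse c \<cdot>\<^sub>m (A - x \<cdot>\<^sub>m 1\<^sub>m ?n) = P * diagm d (\<lambda>k. inverse c * (th k - x)) * Q" for c x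
  proof (rule eq_matI_le)
    fix a b assume ab: "a \<le> d" "b \<le> d"
    have "A $$ (a, b) = (\<Sum>k\<le>d. P $$ (a, k) * th k * Q $$ (k, b))"
      using conj_diagm_index[OF D'(2,3) ab, of th] diagonalizes_eq[OF D] by simp
    moreover have "(if a = b then x else 0) = x * (\<Sum>k\<le>d. P $$ (a, k) * Q $$ (k, b))"
      using diagonalizes_delta(1)[OF D ab] by simp
    ultimately have "A $$ (a, b) - (if a = b then x else 0) = (\<Sum>k\<le>d. P $$ (a, k) * (th k - x) * Q $$ (k, b))"
      by (simp add: sum_distrib_left sum_subtractf[symmetric] algebra_simps)
    moreover have "(inverse c \<cdot>\<^sub>m (A - x \<cdot>\<^sub>m 1\<^sub>m ?n)) $$ (a, b) = inverse c * (A $$ (a, b) - (if a = b then x else 0))"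
      using ab D'(1) by simp
    ultimately show "(inverse c \<cdot>\<^sub>m (A - x \<cdot>\<^sub>m 1\<^sub>m ?n)) $$ (a, b) = (P * diagm d (\<lambda>k. inverse c * (th k - x)) * Q) $$ (a, b)"
      unfolding conj_diagm_index[OF D'(2,3) ab] by (simp add: sum_distrib_left mult_ac)
  qed (use D' in \<open>auto intro!: mult_carrier_mat[of _ ?n ?n _ ?n]\<close>)
  let ?w = "\<lambda>j k. inverse (th i - th j) * (th k - th j)"
  have one: "1\<^sub>m ?n = P * diagm d (\<lambda>k. 1) * Q"
  proof -
    have "diagm d (\<lambda>k. 1) = (1\<^sub>m ?n :: 'a mat)" by (rule eq_matI_le) (auto simp: diagm_def)
    thus ?thesis using D' by simp
  qed
  have prod: "foldr (\<lambda>j M. (inverse (th i - th j) \<cdot>\<^sub>m (A - th j \<cdot>\<^sub>m 1\<^sub>m ?n)) * M) js (1\<^sub>m ?n) =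
      P * diagm d (\<lambda>k. prod_list (map (\<lambda>j. ?w j k) js)) * Q" for js
  proof (induction js)
    case (Cons j js)
    thus ?case by (simp add: fac conj_diagm_mult[OF D])
  qed (simp add: one)
  have "diagm d (\<lambda>k. prod_list (map (\<lambda>j. ?w j k) (filter (\<lambda>j. j \<noteq> i) [0..<d+1]))) = unit_diag d i"
  proof (rule eq_matI_le)
    fix a b assume ab: "a \<le> d" "b \<le> d"
    have ne: "th i - th j \<noteq> 0" if "j \<le> d" "j \<noteq> i" for j using D'(7) i that by (auto simp: inj_on_def)
    have "prod_list (map (\<lambda>j. ?w j b) (filter (\<lambda>j. j \<noteq> i) [0..<d+1])) = (if b = i then 1 else 0)"
    proof (cases "b = i")
      case True
      have "map (\<lambda>j. ?w j b) (filter (\<lambda>j. j \<noteq> i) [0..<d+1]) = map (\<lambda>j. 1) (filter (\<lambda>j. j \<noteq> i) [0..<d+1])"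
        using ne True by (intro map_cong refl) (auto simp del: upt_Suc)
      moreover have "prod_list (map (\<lambda>j. 1) xs) = (1 :: 'a)" for xs :: "nat list" by (induction xs) auto
      ultimately show ?thesis unfolding if_P[OF True] by (simp only:)
    next
      case False
      hence "0 \<in> set (map (\<lambda>j. ?w j b) (filter (\<lambda>j. j \<noteq> i) [0..<d+1]))"
        using ab unfolding set_map by (intro image_eqI[of _ _ b]) (auto simp del: upt_Suc)
      thus ?thesis unfolding if_not_P[OF False] prod_list_zero_iff .
    qed
    thus "diagm d (\<lambda>k. prod_list (map (\<lambda>j. ?w j k) (filter (\<lambda>j. j \<noteq> i) [0..<d+1]))) $$ (a, b) = unit_diag d i $$ (a, b)"
      using ab by (simp add: diagm_def unit_diag_def)
  qed (auto simp: unit_diag_def)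
  thus ?thesis unfolding primitive_idempotent_def using prod by simp
qed

lemma diagonalizes_eigenvalue_sequence:
  assumes "diagonalizes d A th P Q" "scalar_seq 0 d th"
  shows "eigenvalue_sequence d A (primitive_idempotent d A th) th"
  unfolding eigenvalue_sequence_def diagonalizes_eigenvalues[OF assms(1)]
  using assms(2) diagonalizesD(7)[OF assms(1)] by (auto simp: bij_betw_def atLeast0AtMost)

lemma eigenvalue_sequence_diagonalizes:
  assumes "A \<in> carrier_mat (Suc d) (Suc d)" "eigenvalue_sequence d A E th"
  obtains P Q where "diagonalizes d A th P Q"
proof (rule diagonalizes_exists[OF assms(1)])
  have "bij_betw th {..d} {t. eigenvalue A t}"
    using assms(2) by (simp add: eigenvalue_sequence_def atLeast0AtMost)
  thus "inj_on th {..d}" "\<And>i. i \<le> d \<Longrightarrow> eigenvalue A (th i)"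
    by (auto simp: bij_betw_def)
qed (use that in blast)

lemma eigenvalue_sequence_idempotent:
  assumes "diagonalizes d A th P Q" "eigenvalue_sequence d A E th" "i \<le> d"
  shows "E i = P * unit_diag d i * Q"
  using assms primitive_idempotent_eq[OF assms(1,3)] by (simp add: eigenvalue_sequence_def)

lemma unit_diag_index: "a \<le> d \<Longrightarrow> b \<le> d \<Longrightarrow> i \<le> d \<Longrightarrow>
    P \<in> carrier_mat (Suc d) (Suc d) \<Longrightarrow> Q \<in> carrier_mat (Suc d) (Suc d) \<Longrightarrow>
    (P * unit_diag d i * Q) $$ (a, b) = P $$ (a, i) * Q $$ (i, b)"
proof -
  assume a: "a \<le> d" "b \<le> d" "i \<le> d" and c: "P \<in> carrier_mat (Suc d) (Suc d)" "Q \<in> carrier_mat (Suc d) (Suc d)"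
  have "(P * unit_diag d i * Q) $$ (a, b) = (\<Sum>k\<le>d. P $$ (a, k) * Q $$ (k, b) * (if k = i then 1 else 0))"
    unfolding unit_diag_def conj_diagm_index[OF c a(1,2)] by (intro sum.cong) auto
  thus ?thesis using delta_sum[OF a(3)] by simp
qed

lemma diagonalizes_nonzero:
  assumes "diagonalizes d A th P Q" "i \<le> d"
  shows "\<exists>j\<le>d. P $$ (j, i) \<noteq> 0" "\<exists>j\<le>d. Q $$ (i, j) \<noteq> 0"
proof -
  have "(\<Sum>k\<le>d. Q $$ (i, k) * P $$ (k, i)) \<noteq> 0" using diagonalizes_delta(2)[OF assms(1,2,2)] by simp
  then obtain k where "k \<in> {..d}" "Q $$ (i, k) * P $$ (k, i) \<noteq> 0" by (rule sum.not_neutral_contains_not_neutral)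
  thus "\<exists>j\<le>d. P $$ (j, i) \<noteq> 0" "\<exists>j\<le>d. Q $$ (i, j) \<noteq> 0" by auto
qed

text \<open>The product is column \<open>i\<close> of \<open>P\<close> times row \<open>j\<close> of
  \<open>Q\<close>, scaled by the entry \<open>(i, j)\<close> of \<open>Q * X * P\<close>; the
  column and the row are nonzero.\<close>

lemma unit_diag_sandwich:
  assumes D: "diagonalizes d A th P Q" and X: "X \<in> carrier_mat (Suc d) (Suc d)" and ij: "i \<le> d" "j \<le> d"
  shows "(P * unit_diag d i * Q) * X * (P * unit_diag d j * Q) = 0\<^sub>m (Suc d) (Suc d) \<longleftrightarrow>
    (Q * X * P) $$ (i, j) = 0"
proof -
  note D' = diagonalizesD[OF D]
  let ?n = "Suc d"
  note mc = mult_carrier_mat[of _ ?n ?n _ ?n]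
  have u: "P * unit_diag d i * Q \<in> carrier_mat ?n ?n" for i
    unfolding unit_diag_def using D' by (auto intro!: mc)
  have QX: "Q * X \<in> carrier_mat ?n ?n" using D' X by (auto intro!: mc)
  have uX: "P * unit_diag d i * Q * X \<in> carrier_mat ?n ?n" by (rule mc[OF u X])
  have uX_index: "(P * unit_diag d i * Q * X) $$ (a, b) = P $$ (a, i) * (Q * X) $$ (i, b)"
    if "a \<le> d" "b \<le> d" for a b
    unfolding index_mult_mat_sum[OF u X that] index_mult_mat_sum[OF D'(3) X ij(1) that(2)] sum_distrib_left
    by (intro sum.cong) (auto simp: unit_diag_index[OF that(1) _ ij(1) D'(2,3)] mult.assoc)
  have idx: "((P * unit_diag d i * Q) * X * (P * unit_diag d j * Q)) $$ (a, b) =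
      P $$ (a, i) * (Q * X * P) $$ (i, j) * Q $$ (j, b)" if "a \<le> d" "b \<le> d" for a b
    unfolding index_mult_mat_sum[OF uX u that] index_mult_mat_sum[OF QX D'(2) ij] sum_distrib_left sum_distrib_right
    by (intro sum.cong) (auto simp: unit_diag_index[OF _ that(2) ij(2) D'(2,3)] uX_index[OF that(1)] mult.assoc)
  show ?thesis
  proof
    assume z: "(P * unit_diag d i * Q) * X * (P * unit_diag d j * Q) = 0\<^sub>m ?n ?n"
    obtain a b where ab: "a \<le> d" "P $$ (a, i) \<noteq> 0" "b \<le> d" "Q $$ (j, b) \<noteq> 0"
      using diagonalizes_nonzero(1)[OF D ij(1)] diagonalizes_nonzero(2)[OF D ij(2)] by blast
    thus "(Q * X * P) $$ (i, j) = 0" using idx[OF ab(1,3)] z by simp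
  next
    assume "(Q * X * P) $$ (i, j) = 0"
    thus "(P * unit_diag d i * Q) * X * (P * unit_diag d j * Q) = 0\<^sub>m ?n ?n"
      using idx by (intro eq_matI_le[OF mc[OF uX u]]) auto
  qed
qed

text \<open>Translates the conditions on idempotents into the shape of the other matrix in the
  eigenbasis, so that the rest of the proof can work with matrix entries.\<close>

lemma idempotent_sequence_iff:
  assumes D: "diagonalizes d A th P Q" and E: "eigenvalue_sequence d A E th"
    and X: "X \<in> carrier_mat (Suc d) (Suc d)"
  shows "idempotent_sequence d A X E \<longleftrightarrow> irreducible_tridiagonal d (\<lambda>i j. (Q * X * P) $$ (i, j))"
proof -
  have "E i * X * E j = 0\<^sub>m (d + 1) (d + 1) \<longleftrightarrow> (Q * X * P) $$ (i, j) = 0" if "i \<le> d" "j \<le> d" for i j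
    using unit_diag_sandwich[OF D X that] eigenvalue_sequence_idempotent[OF D E] that by simp
  thus ?thesis
    unfolding idempotent_sequence_def irreducible_tridiagonal_def using E by blast
qed

section \<open>Orderings of the eigenvalues\<close>

lemma diagonalizes_permute:
  assumes D: "diagonalizes d A th P Q" and s: "bij_betw \<sigma> {..d} {..d}" and th': "\<And>i. i \<le> d \<Longrightarrow> th' i = th (\<sigma> i)"
  defines "P' \<equiv> mat (Suc d) (Suc d) (\<lambda>(j, i). P $$ (j, \<sigma> i))"
    and "Q' \<equiv> mat (Suc d) (Suc d) (\<lambda>(i, j). Q $$ (\<sigma> i, j))"
  shows "diagonalizes d A th' P' Q'"
    and "X \<in> carrier_mat (Suc d) (Suc d) \<Longrightarrow> i \<le> d \<Longrightarrow> j \<le> d \<Longrightarrow>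
      (Q' * X * P') $$ (i, j) = (Q * X * P) $$ (\<sigma> i, \<sigma> j)"
proof -
  note D' = diagonalizesD[OF D]
  let ?n = "Suc d"
  note mc = mult_carrier_mat[of _ ?n ?n _ ?n]
  have c: "P' \<in> carrier_mat ?n ?n" "Q' \<in> carrier_mat ?n ?n" by (simp_all add: P'_def Q'_def)
  have sd: "\<sigma> i \<le> d" if "i \<le> d" for i using s that by (auto simp: bij_betw_def)
  have s_eq: "\<sigma> i = \<sigma> j \<longleftrightarrow> i = j" if "i \<le> d" "j \<le> d" for i j
    using s that by (auto simp: bij_betw_def inj_on_def)
  have QP: "Q' * P' = 1\<^sub>m ?n"
  proof (rule eq_matI_le)
    fix i j assume ij: "i \<le> d" "j \<le> d"
    show "(Q' * P') $$ (i, j) = 1\<^sub>m ?n $$ (i, j)"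
      unfolding index_mult_mat_sum[OF c(2,1) ij]
      using diagonalizes_delta(2)[OF D sd[OF ij(1)] sd[OF ij(2)]] ij s_eq by (simp add: P'_def Q'_def)
  qed (use c in \<open>auto intro!: mc\<close>)
  have AP: "A * P' = P' * diagm d th'"
  proof (rule eq_matI_le)
    fix i j assume ij: "i \<le> d" "j \<le> d"
    show "(A * P') $$ (i, j) = (P' * diagm d th') $$ (i, j)"
      unfolding index_mult_mat_sum[OF D'(1) c(1) ij] mult_diagm(1)[OF c(1) ij]
      using diagonalizes_delta(3)[OF D ij(1) sd[OF ij(2)]] ij th' by (simp add: P'_def)
  qed (use c D' in \<open>auto intro!: mc\<close>)
  have "inj_on th' {..d}"
  proof (rule inj_onI)
    fix x y assume xy: "x \<in> {..d}" "y \<in> {..d}" "th' x = th' y"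
    hence "th (\<sigma> x) = th (\<sigma> y)" using th' by simp
    hence "\<sigma> x = \<sigma> y" using inj_onD[OF D'(7)] sd xy by simp
    thus "x = y" using s_eq xy by simp
  qed
  thus "diagonalizes d A th' P' Q'"
    unfolding diagonalizes_def using D'(1) c QP AP mat_mult_left_right_inverse[OF c(2,1) QP] by simp
  show "(Q' * X * P') $$ (i, j) = (Q * X * P) $$ (\<sigma> i, \<sigma> j)"
    if X: "X \<in> carrier_mat ?n ?n" and ij: "i \<le> d" "j \<le> d"
  proof -
    have QX: "Q * X \<in> carrier_mat ?n ?n" "Q' * X \<in> carrier_mat ?n ?n" using D' c X by (auto intro!: mc)
    have "(Q' * X) $$ (i, k) = (Q * X) $$ (\<sigma> i, k)" if k: "k \<le> d" for k
      unfolding index_mult_mat_sum[OF D'(3) X sd[OF ij(1)] k] index_mult_mat_sum[OF c(2) X ij(1) k]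
      using ij by (intro sum.cong) (auto simp: Q'_def)
    thus ?thesis
      unfolding index_mult_mat_sum[OF QX(1) D'(2) sd[OF ij(1)] sd[OF ij(2)]] index_mult_mat_sum[OF QX(2) c(1) ij]
      using ij by (intro sum.cong) (auto simp: P'_def)
  qed
qed

lemma enumerations_permute:
  fixes t t' :: "nat \<Rightarrow> 'a"
  assumes "inj_on t {..d}" "inj_on t' {..d}" "t' ` {..d} = t ` {..d}"
  obtains \<sigma> where "bij_betw \<sigma> {..d} {..d}" "\<And>i. i \<le> d \<Longrightarrow> t' i = t (\<sigma> i)"
proof -
  have b: "bij_betw t {..d} (t ` {..d})" "bij_betw t' {..d} (t ` {..d})"
    using assms by (auto simp: bij_betw_def)
  have "bij_betw (the_inv_into {..d} t \<circ> t') {..d} {..d}"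
    by (rule bij_betw_trans[OF b(2) bij_betw_the_inv_into[OF b(1)]])
  moreover have "t' i = t ((the_inv_into {..d} t \<circ> t') i)" if "i \<le> d" for i
  proof -
    have "t' i \<in> t ` {..d}" using assms(3) that by blast
    thus ?thesis using f_the_inv_into_f[OF assms(1)] by simp
  qed
  ultimately show thesis by (rule that)
qed

text \<open>By injectivity a walk with steps of length 1 cannot turn back, so its first step fixes
  the direction; staying within \<open>0, ..., d\<close> fixes the starting point.\<close>

lemma path_automorphism:
  assumes s: "bij_betw \<sigma> {..d} {..d}"
    and adj: "\<And>i. i < d \<Longrightarrow> \<bar>int (\<sigma> i) - int (\<sigma> (Suc i))\<bar> \<le> 1"
  shows "(\<forall>i\<le>d. \<sigma> i = i) \<or> (\<forall>i\<le>d. \<sigma> i = d - i)"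
proof (cases "d = 0")
  case True
  thus ?thesis using s by (auto simp: bij_betw_def)
next
  case False
  have le: "\<sigma> i \<le> d" if "i \<le> d" for i using s that by (auto simp: bij_betw_def)
  have ne: "\<sigma> i \<noteq> \<sigma> j" if "i \<le> d" "j \<le> d" "i \<noteq> j" for i j
    using s that by (auto simp: bij_betw_def inj_on_def)
  have step: "\<sigma> (Suc i) = \<sigma> i + 1 \<or> \<sigma> (Suc i) + 1 = \<sigma> i" if "i < d" for i
    using adj[OF that] ne[of i "Suc i"] that by auto
  from step[of 0] False consider "\<sigma> 1 = \<sigma> 0 + 1" | "\<sigma> 1 + 1 = \<sigma> 0" by auto
  thus ?thesis
  proof cases
    case 1
    have inc: "\<sigma> i = \<sigma> 0 + i" if "i \<le> d" for i
      using that
    proof (induction i rule: less_induct)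
      case (less i)
      show ?case
      proof (cases "i \<le> 1")
        case True
        hence "i = 0 \<or> i = 1" by auto
        thus ?thesis using 1 by (elim disjE) simp_all
      next
        case False
        define m where "m = i - 2"
        have i: "i = Suc (Suc m)" using False by (simp add: m_def)
        have "\<sigma> m = \<sigma> 0 + m" "\<sigma> (Suc m) = \<sigma> 0 + Suc m"
          by (rule less.IH; use less.prems i in simp)+
        moreover have "\<sigma> i = \<sigma> (Suc m) + 1 \<or> \<sigma> i + 1 = \<sigma> (Suc m)" "\<sigma> m \<noteq> \<sigma> i"
          using step[of "Suc m"] ne[of m i] less.prems i by simp_all
        ultimately show ?thesis using i by linarith
      qed
    qed
    have "\<sigma> 0 = 0" using inc[of d] le[of d] by linarith
    hence "\<sigma> i = i" if "i \<le> d" for i using inc[OF that] by linarith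
    thus ?thesis by blast
  next
    case 2
    have dec: "\<sigma> i + i = \<sigma> 0" if "i \<le> d" for i
      using that
    proof (induction i rule: less_induct)
      case (less i)
      show ?case
      proof (cases "i \<le> 1")
        case True
        hence "i = 0 \<or> i = 1" by auto
        thus ?thesis using 2 by (elim disjE) simp_all
      next
        case False
        define m where "m = i - 2"
        have i: "i = Suc (Suc m)" using False by (simp add: m_def)
        have "\<sigma> m + m = \<sigma> 0" "\<sigma> (Suc m) + Suc m = \<sigma> 0"
          by (rule less.IH; use less.prems i in simp)+
        moreover have "\<sigma> i = \<sigma> (Suc m) + 1 \<or> \<sigma> i + 1 = \<sigma> (Suc m)" "\<sigma> m \<noteq> \<sigma> i"
          using step[of "Suc m"] ne[of m i] less.prems i by simp_all
        ultimately show ?thesis using i by linarith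
      qed
    qed
    have "\<sigma> 0 = d" using dec[of d] le[of 0] by linarith
    hence "\<sigma> i = d - i" if "i \<le> d" for i using dec[OF that] by linarith
    thus ?thesis by blast
  qed
qed

text \<open>The nonzero entries of the permuted matrix at neighbouring indices can only come from
  neighbouring indices of \<open>X\<close>. Besides limiting the orderings, this yields
  irreducibility of a matrix known only to be tridiagonal in the given order.\<close>

lemma irreducible_tridiagonal_permuted:
  assumes X: "\<And>i j. i \<le> d \<Longrightarrow> j \<le> d \<Longrightarrow> \<bar>int i - int j\<bar> > 1 \<Longrightarrow> X i j = 0"
    and Y: "irreducible_tridiagonal d (\<lambda>i j. X (\<sigma> i) (\<sigma> j))" and s: "bij_betw \<sigma> {..d} {..d}"
  shows "(\<forall>i\<le>d. \<sigma> i = i) \<or> (\<forall>i\<le>d. \<sigma> i = d - i)" "irreducible_tridiagonal d X"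
proof -
  have le: "\<sigma> i \<le> d" if "i \<le> d" for i using s that by (auto simp: bij_betw_def)
  show a: "(\<forall>i\<le>d. \<sigma> i = i) \<or> (\<forall>i\<le>d. \<sigma> i = d - i)"
  proof (rule path_automorphism[OF s])
    fix i assume i: "i < d"
    hence "X (\<sigma> i) (\<sigma> (Suc i)) \<noteq> 0" by (rule irreducible_tridiagonalD(2)[OF Y])
    thus "\<bar>int (\<sigma> i) - int (\<sigma> (Suc i))\<bar> \<le> 1" using X[OF le le, of i "Suc i"] i by force
  qed
  thus "irreducible_tridiagonal d X"
  proof
    assume "\<forall>i\<le>d. \<sigma> i = i"
    thus ?thesis using Y by (simp add: irreducible_tridiagonal_def)
  next
    assume r: "\<forall>i\<le>d. \<sigma> i = d - i"
    have "irreducible_tridiagonal d (\<lambda>i j. X (\<sigma> (d - i)) (\<sigma> (d - j)))"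
      by (rule irreducible_tridiagonal_reverse[OF Y])
    thus ?thesis using r by (simp add: irreducible_tridiagonal_def)
  qed
qed

section \<open>Split sequences\<close>

text \<open>The coordinates of \<open>u\<close> in the eigenbasis are the entries of
  \<open>Q u\<close>, and \<open>E h\<close> projects onto coordinate \<open>h\<close>. This makes
  split spaces accessible to calculation.\<close>

lemma image_sum_iff:
  assumes D: "diagonalizes d A th P Q" and E: "\<And>h. h \<le> d \<Longrightarrow> E h = P * unit_diag d h * Q"
    and I: "I \<subseteq> {..d}"
  shows "u \<in> image_sum d E I \<longleftrightarrow>
    u \<in> carrier_vec (Suc d) \<and> (\<forall>h\<le>d. h \<notin> I \<longrightarrow> (\<Sum>j\<le>d. Q $$ (h, j) * u $ j) = 0)"
proof -
  note D' = diagonalizesD[OF D]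
  let ?n = "Suc d"
  have fin: "finite I" using I by (rule finite_subset) simp
  have Ec: "E h \<in> carrier_mat ?n ?n" if "h \<le> d" for h
    unfolding E[OF that] unit_diag_def using D' by (auto intro!: mult_carrier_mat[of _ ?n ?n _ ?n])
  have Ev: "(E h *\<^sub>v v) $ j = P $$ (j, h) * (\<Sum>k\<le>d. Q $$ (h, k) * v $ k)"
    if "h \<le> d" "v \<in> carrier_vec ?n" "j \<le> d" for h v j
  proof -
    have "(E h *\<^sub>v v) $ j = (\<Sum>k\<le>d. E h $$ (j, k) * v $ k)"
      using Ec[OF that(1)] that(2,3)
      by (auto simp: scalar_prod_def lessThan_Suc_atMost[symmetric] atLeast0LessThan intro!: sum.cong)
    also have "\<dots> = (\<Sum>k\<le>d. P $$ (j, h) * (Q $$ (h, k) * v $ k))"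
      by (intro sum.cong) (auto simp: E[OF that(1)] unit_diag_index[OF that(3) _ that(1) D'(2,3)] mult.assoc)
    finally show ?thesis by (simp add: sum_distrib_left)
  qed
  have fs: "finsum_vec TYPE('a) ?n (\<lambda>h. E h *\<^sub>v v h) I $ j =
      (\<Sum>h\<in>I. P $$ (j, h) * (\<Sum>k\<le>d. Q $$ (h, k) * v h $ k))"
    if v: "\<forall>h\<in>I. v h \<in> carrier_vec ?n" and j: "j \<le> d" for v j
  proof -
    have "(\<lambda>h. E h *\<^sub>v v h) \<in> I \<rightarrow> carrier_vec ?n" using v I Ec by (auto intro!: mult_mat_vec_carrier)
    hence "finsum_vec TYPE('a) ?n (\<lambda>h. E h *\<^sub>v v h) I $ j = (\<Sum>h\<in>I. (E h *\<^sub>v v h) $ j)"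
      using index_finsum_vec[OF fin, of j ?n "\<lambda>h. E h *\<^sub>v v h"] j by simp
    thus ?thesis using v I j Ev by (auto intro!: sum.cong)
  qed
  have fc: "finsum_vec TYPE('a) ?n (\<lambda>h. E h *\<^sub>v v h) I \<in> carrier_vec ?n"
    if "\<forall>h\<in>I. v h \<in> carrier_vec ?n" for v
    by (rule finsum_vec_closed) (use that I Ec in \<open>auto intro!: mult_mat_vec_carrier\<close>)
  show ?thesis
  proof
    assume "u \<in> image_sum d E I"
    then obtain v where v: "\<forall>h\<in>I. v h \<in> carrier_vec ?n"
      and u: "u = finsum_vec TYPE('a) ?n (\<lambda>h. E h *\<^sub>v v h) I" by (auto simp: image_sum_def)
    have "(\<Sum>j\<le>d. Q $$ (h, j) * u $ j) = 0" if h: "h \<le> d" "h \<notin> I" for h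
    proof -
      define y where "y h = (\<Sum>k\<le>d. Q $$ (h, k) * v h $ k)" for h
      have "(\<Sum>j\<le>d. Q $$ (h, j) * u $ j) = (\<Sum>j\<le>d. Q $$ (h, j) * (\<Sum>m\<in>I. P $$ (j, m) * y m))"
        by (intro sum.cong) (auto simp: u fs[OF v] y_def)
      also have "\<dots> = (\<Sum>m\<in>I. (\<Sum>j\<le>d. Q $$ (h, j) * P $$ (j, m)) * y m)"
        unfolding sum_distrib_left sum_distrib_right by (subst sum.swap) (simp add: mult.assoc)
      also have "\<dots> = 0"
        using h I by (intro sum.neutral) (auto simp: diagonalizes_delta(2)[OF D])
      finally show ?thesis .
    qed
    thus "u \<in> carrier_vec ?n \<and> (\<forall>h\<le>d. h \<notin> I \<longrightarrow> (\<Sum>j\<le>d. Q $$ (h, j) * u $ j) = 0)"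
      using fc[OF v] u by simp
  next
    assume u: "u \<in> carrier_vec ?n \<and> (\<forall>h\<le>d. h \<notin> I \<longrightarrow> (\<Sum>j\<le>d. Q $$ (h, j) * u $ j) = 0)"
    hence uc: "\<forall>h\<in>I. u \<in> carrier_vec ?n" by simp
    have "u = finsum_vec TYPE('a) ?n (\<lambda>h. E h *\<^sub>v u) I"
    proof (rule eq_vecI)
      fix j assume "j < dim_vec (finsum_vec TYPE('a) ?n (\<lambda>h. E h *\<^sub>v u) I)"
      hence j: "j \<le> d" using fc[OF uc] by simp
      have "(\<Sum>h\<in>I. P $$ (j, h) * (\<Sum>k\<le>d. Q $$ (h, k) * u $ k)) =
          (\<Sum>h\<le>d. P $$ (j, h) * (\<Sum>k\<le>d. Q $$ (h, k) * u $ k))"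
        using u I by (intro sum.mono_neutral_left) auto
      also have "\<dots> = (\<Sum>k\<le>d. (\<Sum>h\<le>d. P $$ (j, h) * Q $$ (h, k)) * u $ k)"
        unfolding sum_distrib_left sum_distrib_right by (subst sum.swap) (simp add: mult.assoc)
      also have "\<dots> = (\<Sum>k\<le>d. u $ k * (if k = j then 1 else 0))"
        by (intro sum.cong) (auto simp: diagonalizes_delta(1)[OF D j])
      also have "\<dots> = u $ j" by (rule delta_sum[OF j])
      finally show "u $ j = finsum_vec TYPE('a) ?n (\<lambda>h. E h *\<^sub>v u) I $ j" using fs[OF uc j] by simp
    qed (use u fc[OF uc] in simp)
    thus "u \<in> image_sum d E I" using u unfolding image_sum_def by auto
  qed
qed

context leonard_data
begin

text \<open>The two conditions on \<open>u\<close> say that it lies in the split space of index \<open>i\<close>.\<close>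

lemma split_space_eigen:
  assumes i: "1 \<le> i" "i \<le> d" and u: "\<And>j. i < j \<Longrightarrow> j \<le> d \<Longrightarrow> u j = 0"
    and Qu: "\<And>h. h < i \<Longrightarrow> (\<Sum>j\<le>d. Q h j * u j) = 0" and m: "m \<le> d"
  defines "w \<equiv> \<lambda>k. (ths k - ths i) * u k"
  shows "(\<Sum>k\<le>d. A m k * w k) - th (i - 1) * w m = vphi i * u m"
proof -
  \<comment> \<open>The coordinates of \<open>u\<close> in the eigenbasis of \<open>A\<close>, seen
    as a function on the eigenvalues. Support in \<open>0, ..., i\<close> bounds its degree by
    \<open>i\<close>, and the other condition gives zeros at the first \<open>i\<close> points, so
    it is a multiple of the Newton polynomial.\<close>
  define x where "x h = (\<Sum>j\<le>d. Q h j * u j) / Q h 0" for h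
  have Qx: "(\<Sum>j\<le>d. Q h j * u j) = Q h 0 * x h" if "h \<le> d" for h using Q_0[OF that] by (simp add: x_def)
  have "\<exists>c. lead d th i (\<lambda>h. \<Sum>j\<le>k. u j * (Q h j / Q h 0)) c" if "k \<le> i" for k
    using that
  proof (induction k)
    case 0
    have "lead d th 0 (\<lambda>_. u 0) (u 0)" by (rule lead_const)
    hence "lead d th i (\<lambda>_. u 0) 0" using i by (intro lead_weaken) auto
    hence "lead d th i (\<lambda>h. \<Sum>j\<le>0. u j * (Q h j / Q h 0)) 0"
      by (rule lead_cong) (simp add: Q_0)
    thus ?case by blast
  next
    case (Suc k)
    then obtain c where c: "lead d th i (\<lambda>h. \<Sum>j\<le>k. u j * (Q h j / Q h 0)) c" by auto
    obtain c' where c': "lead d th (Suc k) (\<lambda>h. Q h (Suc k) / Q h 0) c'"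
      using M.p_lead[of "Suc k"] Suc.prems i by auto
    have "\<exists>c'. lead d th i (\<lambda>h. Q h (Suc k) / Q h 0) c'"
      using c' lead_weaken[OF c', of i] Suc.prems by (cases "Suc k = i") auto
    then obtain c'' where "lead d th i (\<lambda>h. Q h (Suc k) / Q h 0) c''" ..
    from lead_add[OF c lead_cmult[OF this, of "u (Suc k)"]] show ?case by auto
  qed
  then obtain c where c: "lead d th i (\<lambda>h. \<Sum>j\<le>i. u j * (Q h j / Q h 0)) c" by blast
  have "lead d th i x c"
  proof (rule lead_cong[OF c])
    fix h assume "h \<le> d"
    have "(\<Sum>j\<le>d. Q h j * u j) = (\<Sum>j\<le>i. Q h j * u j)"
      using i u by (intro sum.mono_neutral_right) auto
    thus "x h = (\<Sum>j\<le>i. u j * (Q h j / Q h 0))"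
      by (simp add: x_def sum_divide_distrib mult.commute)
  qed
  hence x: "x h = c * newton th i (th h)" if "h \<le> d" for h
    using lead_eq_newton[OF th i(2) _ _ that] Qu by (simp add: x_def)
  have Qths: "(\<Sum>j\<le>d. Q h j * (ths j * u j)) = Q h 0 * M.ap x h" if h: "h \<le> d" for h
  proof -
    have "(\<Sum>j\<le>d. Q h j * (ths j * u j)) = (\<Sum>j\<le>d. (\<Sum>k\<le>d. B h k * Q k j) * u j)"
      by (intro sum.cong) (auto simp: BQ h mult.assoc)
    also have "\<dots> = (\<Sum>k\<le>d. B h k * (\<Sum>j\<le>d. Q k j * u j))"
      unfolding sum_distrib_left sum_distrib_right by (subst sum.swap) (simp add: mult.assoc)
    also have "\<dots> = (\<Sum>k\<le>d. B h k * (Q k 0 * x k))" by (intro sum.cong) (auto simp: Qx)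
    also have "\<dots> = Q h 0 * M.ap x h"
      using Q_0[OF h] by (simp add: M.ap_def B'_def sum_distrib_left mult_ac)
    finally show ?thesis .
  qed
  have Qw: "(\<Sum>j\<le>d. Q h j * w j) = Q h 0 * (c * (vphi i * newton th (i - 1) (th h)))" if h: "h \<le> d" for h
  proof -
    have "M.ap x h = c * (ths i * newton th i (th h) + vphi i * newton th (i - 1) (th h))"
      using M.ap_cong[of x "\<lambda>h. c * newton th i (th h)" h] M.ap_cmult[of c "\<lambda>h. newton th i (th h)" h]
        M.ap_newton[OF i(2) h] x by simp
    moreover have "(\<Sum>j\<le>d. Q h j * w j) = (\<Sum>j\<le>d. Q h j * (ths j * u j)) - ths i * (\<Sum>j\<le>d. Q h j * u j)"
      by (simp add: w_def sum_distrib_left sum_subtractf[symmetric] algebra_simps)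
    ultimately show ?thesis using Qths[OF h] Qx[OF h] x[OF h] by (simp add: algebra_simps)
  qed
  have Qz: "(\<Sum>j\<le>d. Q h j * ((\<Sum>k\<le>d. A j k * w k) - th (i - 1) * w j)) = vphi i * (\<Sum>j\<le>d. Q h j * u j)"
    if h: "h \<le> d" for h
  proof -
    have "(\<Sum>j\<le>d. Q h j * (\<Sum>k\<le>d. A j k * w k)) = (\<Sum>k\<le>d. (\<Sum>j\<le>d. Q h j * A j k) * w k)"
      unfolding sum_distrib_left sum_distrib_right by (subst sum.swap) (simp add: mult.assoc)
    also have "\<dots> = th h * (\<Sum>k\<le>d. Q h k * w k)"
      unfolding sum_distrib_left by (intro sum.cong) (auto simp: QA h mult.assoc)
    finally have "(\<Sum>j\<le>d. Q h j * ((\<Sum>k\<le>d. A j k * w k) - th (i - 1) * w j)) =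
        (th h - th (i - 1)) * (\<Sum>k\<le>d. Q h k * w k)"
      by (simp add: right_diff_distrib left_diff_distrib sum_subtractf sum_distrib_left mult_ac)
    also have "newton th i (th h) = newton th (i - 1) (th h) * (th h - th (i - 1))"
      using newton_Suc[of th "i - 1" "th h"] i by simp
    hence "(th h - th (i - 1)) * (\<Sum>k\<le>d. Q h k * w k) = vphi i * (Q h 0 * x h)"
      using Qw[OF h] x[OF h] by (simp add: mult_ac)
    finally show ?thesis using Qx[OF h] by simp
  qed
  define z where "z j = (\<Sum>k\<le>d. A j k * w k) - th (i - 1) * w j" for j
  have inv: "(\<Sum>h\<le>d. P m h * (\<Sum>j\<le>d. Q h j * f j)) = f m" for f
  proof -
    have "(\<Sum>h\<le>d. P m h * (\<Sum>j\<le>d. Q h j * f j)) = (\<Sum>j\<le>d. (\<Sum>h\<le>d. P m h * Q h j) * f j)"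
      unfolding sum_distrib_left sum_distrib_right by (subst sum.swap) (simp add: mult.assoc)
    also have "\<dots> = (\<Sum>j\<le>d. f j * (if j = m then 1 else 0))"
      by (intro sum.cong) (auto simp: PQ m)
    finally show ?thesis using delta_sum[OF m] by simp
  qed
  have "z m = (\<Sum>h\<le>d. P m h * (\<Sum>j\<le>d. Q h j * z j))" by (simp add: inv)
  also have "\<dots> = (\<Sum>h\<le>d. vphi i * (P m h * (\<Sum>j\<le>d. Q h j * u j)))"
    using Qz[folded z_def] by (intro sum.cong) (auto simp: mult.left_commute)
  also have "\<dots> = vphi i * u m" by (simp add: sum_distrib_left[symmetric] inv)
  finally show ?thesis by (simp add: z_def)
qed

text \<open>The coefficients of the Newton polynomial of degree \<open>i\<close> in the basis
  \<open>Q h j / Q h 0\<close> form such a vector.\<close>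

lemma split_space_exists:
  assumes i: "i \<le> d"
  obtains u where "\<And>j. i < j \<Longrightarrow> u j = 0" "\<And>h. h < i \<Longrightarrow> (\<Sum>j\<le>d. Q h j * u j) = 0" "\<exists>j\<le>d. u j \<noteq> 0"
proof -
  obtain \<alpha> where \<alpha>: "\<And>h. h \<le> d \<Longrightarrow> newton th i (th h) = (\<Sum>j\<le>i. \<alpha> j * (Q h j / Q h 0))"
    using M.lead_expand[OF i lead_newton] by blast
  define u where "u j = (if j \<le> i then \<alpha> j else 0)" for j
  have Qu: "(\<Sum>j\<le>d. Q h j * u j) = Q h 0 * newton th i (th h)" if h: "h \<le> d" for h
  proof -
    have "(\<Sum>j\<le>d. Q h j * u j) = (\<Sum>j\<le>i. Q h j * u j)"
      using i by (intro sum.mono_neutral_right) (auto simp: u_def)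
    also have "\<dots> = Q h 0 * (\<Sum>j\<le>i. \<alpha> j * (Q h j / Q h 0))"
      unfolding sum_distrib_left using Q_0[OF h] by (intro sum.cong) (auto simp: u_def)
    finally show ?thesis using \<alpha>[OF h] by simp
  qed
  show thesis
  proof (rule that)
    show "(\<Sum>j\<le>d. Q h j * u j) = 0" if "h < i" for h
      using Qu[of h] that i by (simp add: newton_eq_0)
    show "\<exists>j\<le>d. u j \<noteq> 0"
    proof (rule ccontr)
      assume "\<not> ?thesis"
      hence "(\<Sum>j\<le>d. Q i j * u j) = 0" by (intro sum.neutral) auto
      thus False using Qu[OF i] Q_0[OF i] newton_neq_0[OF th order_refl i] by simp
    qed
  qed (simp add: u_def)
qed

end

text \<open>\<open>A*\<close> is diagonal, so its idempotents are coordinate projections and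
  membership in the split space becomes the pair of conditions of \<open>split_space_eigen\<close>.
  The definition only asserts that some eigenvalue sequences exist; the uniqueness assumptions tie
  them to \<open>th\<close> and \<open>ths\<close>.\<close>

lemma first_split_sequence_iff:
  fixes A P Q :: "'a::field mat" and th ths :: "nat \<Rightarrow> 'a"
  assumes D: "diagonalizes d A th P Q"
    and L: "leonard_data d th ths (\<lambda>i j. A $$ (i, j)) B (\<lambda>i j. P $$ (i, j)) (\<lambda>i j. Q $$ (i, j))"
    and E: "eigenvalue_sequence d A E th" and Es: "eigenvalue_sequence d (diagm d ths) Es ths"
    and uniqE: "\<And>t. eigenvalue_sequence d A E t \<Longrightarrow> t = th"
    and uniqEs: "\<And>t. eigenvalue_sequence d (diagm d ths) Es t \<Longrightarrow> t = ths"
  shows "first_split_sequence d A (diagm d ths) E Es f \<longleftrightarrow>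
    f = split_sequence d th (leonard_data.B' B (\<lambda>i j. Q $$ (i, j)))"
proof -
  let ?n = "Suc d"
  interpret leonard_data d th ths "\<lambda>i j. A $$ (i, j)" B "\<lambda>i j. P $$ (i, j)" "\<lambda>i j. Q $$ (i, j)" by (rule L)
  note D' = diagonalizesD[OF D]
  have Ds: "diagonalizes d (diagm d ths) ths (1\<^sub>m ?n) (1\<^sub>m ?n)" by (rule diagonalizes_diagm[OF ths])
  have split: "u \<in> split_space d E Es i \<longleftrightarrow> u \<in> carrier_vec ?n \<and> (\<forall>j. i < j \<longrightarrow> j \<le> d \<longrightarrow> u $ j = 0) \<and>
      (\<forall>h<i. (\<Sum>j\<le>d. Q $$ (h, j) * u $ j) = 0)" if i: "i \<le> d" for u i
  proof -
    have "u \<in> image_sum d E {i..d} \<longleftrightarrow> u \<in> carrier_vec ?n \<and> (\<forall>h<i. (\<Sum>j\<le>d. Q $$ (h, j) * u $ j) = 0)"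
      using image_sum_iff[OF D eigenvalue_sequence_idempotent[OF D E], of "{i..d}" u] i by auto
    moreover have "u \<in> image_sum d Es {0..i} \<longleftrightarrow> u \<in> carrier_vec ?n \<and> (\<forall>j. i < j \<longrightarrow> j \<le> d \<longrightarrow> u $ j = 0)"
    proof -
      have "(\<Sum>j\<le>d. 1\<^sub>m ?n $$ (h, j) * u $ j) = u $ h" if "h \<le> d" for h
      proof -
        have "(\<Sum>j\<le>d. 1\<^sub>m ?n $$ (h, j) * u $ j) = (\<Sum>j\<le>d. u $ j * (if j = h then 1 else 0))"
          using that by (intro sum.cong) auto
        thus ?thesis using delta_sum[OF that] by simp
      qed
      thus ?thesis
        using image_sum_iff[OF Ds eigenvalue_sequence_idempotent[OF Ds Es], of "{0..i}" u] i by auto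
    qed
    ultimately show ?thesis by (auto simp: split_space_def)
  qed
  have ev: "(((A - th (i-1) \<cdot>\<^sub>m 1\<^sub>m (d+1)) * (diagm d ths - ths i \<cdot>\<^sub>m 1\<^sub>m (d+1))) *\<^sub>v u) = vphi i \<cdot>\<^sub>v u"
    if i: "i \<in> {1..d}" and u: "u \<in> split_space d E Es i" for i u
  proof -
    have u': "u \<in> carrier_vec ?n" "\<And>j. i < j \<Longrightarrow> j \<le> d \<Longrightarrow> u $ j = 0"
      "\<And>h. h < i \<Longrightarrow> (\<Sum>j\<le>d. Q $$ (h, j) * u $ j) = 0"
      using u i split[of i u] by auto
    define w where "w = (diagm d ths - ths i \<cdot>\<^sub>m 1\<^sub>m ?n) *\<^sub>v u"
    have c1: "diagm d ths - ths i \<cdot>\<^sub>m 1\<^sub>m ?n \<in> carrier_mat ?n ?n" by (simp add: minus_carrier_mat)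
    have c2: "A - th (i - 1) \<cdot>\<^sub>m 1\<^sub>m ?n \<in> carrier_mat ?n ?n" by (simp add: minus_carrier_mat)
    have wc: "w \<in> carrier_vec ?n" unfolding w_def using c1 u'(1) by (rule mult_mat_vec_carrier)
    have w: "w $ k = (ths k - ths i) * u $ k" if "k \<le> d" for k
    proof -
      have "w $ k = (\<Sum>l\<le>d. (ths l - ths i) * u $ l * (if l = k then 1 else 0))"
        unfolding w_def index_mult_mat_vec_sum[OF c1 u'(1) that]
        using that by (intro sum.cong) (auto simp: diagm_def)
      thus ?thesis using delta_sum[OF that] by simp
    qed
    have "(A - th (i - 1) \<cdot>\<^sub>m 1\<^sub>m ?n) *\<^sub>v w = vphi i \<cdot>\<^sub>v u"
    proof (rule eq_vecI)
      fix m assume "m < dim_vec (vphi i \<cdot>\<^sub>v u)"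
      hence m: "m \<le> d" using u'(1) by simp
      have "((A - th (i - 1) \<cdot>\<^sub>m 1\<^sub>m ?n) *\<^sub>v w) $ m =
          (\<Sum>l\<le>d. A $$ (m, l) * w $ l - th (i - 1) * w $ l * (if l = m then 1 else 0))"
        unfolding index_mult_mat_vec_sum[OF c2 wc m]
        using m D'(1) by (intro sum.cong) (auto simp: left_diff_distrib)
      also have "\<dots> = (\<Sum>l\<le>d. A $$ (m, l) * w $ l) - th (i - 1) * w $ m"
        unfolding sum_subtractf using delta_sum[OF m, of "\<lambda>l. th (i - 1) * w $ l"] by simp
      also have "\<dots> = (\<Sum>l\<le>d. A $$ (m, l) * ((ths l - ths i) * u $ l)) - th (i - 1) * ((ths m - ths i) * u $ m)"
        using m w by (intro arg_cong2[where f = minus] sum.cong) auto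
      also have "\<dots> = vphi i * u $ m"
        by (rule split_space_eigen) (use i u' m in auto)
      finally show "((A - th (i - 1) \<cdot>\<^sub>m 1\<^sub>m ?n) *\<^sub>v w) $ m = (vphi i \<cdot>\<^sub>v u) $ m" using m u'(1) by simp
    qed (use D'(1) u'(1) in simp)
    thus ?thesis unfolding w_def using assoc_mult_mat_vec[OF c2 c1 u'(1)] by simp
  qed
  have carrM: "(A - x \<cdot>\<^sub>m 1\<^sub>m (d+1)) * (diagm d ths - y \<cdot>\<^sub>m 1\<^sub>m (d+1)) \<in> carrier_mat ?n ?n" for x y
    by (rule mult_carrier_mat[of _ ?n ?n]) (simp_all add: minus_carrier_mat)
  show ?thesis
  proof
    assume f: "first_split_sequence d A (diagm d ths) E Es f"
    show "f = vphi"
    proof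
      fix i
      show "f i = vphi i"
      proof (cases "i \<in> {1..d}")
        case False
        have "scalar_seq 1 d f" using f by (simp add: first_split_sequence_def)
        thus ?thesis using False by (auto simp: scalar_seq_def split_sequence_def)
      next
        case True
        obtain u where u: "u \<in> split_space d E Es i"
          "eigenvector ((A - th (i-1) \<cdot>\<^sub>m 1\<^sub>m (d+1)) * (diagm d ths - ths i \<cdot>\<^sub>m 1\<^sub>m (d+1))) u (f i)"
          using f True uniqE uniqEs unfolding first_split_sequence_def by blast
        have eq: "u \<in> carrier_vec ?n" "u \<noteq> 0\<^sub>v ?n" "f i \<cdot>\<^sub>v u = vphi i \<cdot>\<^sub>v u"
          using u(2) ev[OF True u(1)] carrM[of "th (i-1)" "ths i"] unfolding eigenvector_def by auto
        have "\<exists>j\<le>d. u $ j \<noteq> 0"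
        proof (rule ccontr)
          assume "\<not> ?thesis"
          hence "u = 0\<^sub>v ?n" using eq(1) by (intro eq_vecI) auto
          thus False using eq(2) by simp
        qed
        then obtain j where j: "j \<le> d" "u $ j \<noteq> 0" by blast
        have "(f i \<cdot>\<^sub>v u) $ j = (vphi i \<cdot>\<^sub>v u) $ j" by (simp only: eq(3))
        thus ?thesis using j eq(1) by simp
      qed
    qed
  next
    assume f: "f = vphi"
    have "\<exists>u\<in>split_space d E Es i.
        eigenvector ((A - th (i-1) \<cdot>\<^sub>m 1\<^sub>m (d+1)) * (diagm d ths - ths i \<cdot>\<^sub>m 1\<^sub>m (d+1))) u (f i)"
      if i: "i \<in> {1..d}" for i
    proof -
      obtain u where u: "\<And>j. i < j \<Longrightarrow> u j = 0" "\<And>h. h < i \<Longrightarrow> (\<Sum>j\<le>d. Q $$ (h, j) * u j) = 0" "\<exists>j\<le>d. u j \<noteq> 0"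
        using split_space_exists[of i] i by auto
      define v where "v = vec ?n u"
      have v: "v \<in> split_space d E Es i"
        using i u by (auto simp: split v_def)
      have "v \<noteq> 0\<^sub>v ?n"
      proof
        assume v0: "v = 0\<^sub>v ?n"
        obtain j where j: "j \<le> d" "u j \<noteq> 0" using u(3) by blast
        have "v $ j = u j" using j by (simp add: v_def)
        thus False using v0 j by simp
      qed
      thus ?thesis
        using ev[OF i v] v carrM[of "th (i-1)" "ths i"] unfolding eigenvector_def f
        by (intro bexI[OF _ v]) (auto simp: v_def)
    qed
    moreover have "scalar_seq 1 d f" by (auto simp: f scalar_seq_def split_sequence_def)
    ultimately show "first_split_sequence d A (diagm d ths) E Es f"
      unfolding first_split_sequence_def using E Es by blast
  qed
qed

lemma irreducible_tridiagonal_cong: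
  "irreducible_tridiagonal d X \<Longrightarrow> (\<And>i j. i \<le> d \<Longrightarrow> j \<le> d \<Longrightarrow> X i j = Y i j) \<Longrightarrow>
    irreducible_tridiagonal d Y"
  by (simp add: irreducible_tridiagonal_def)

section \<open>Uniqueness of the parameter array up to reversal\<close>

lemma split_sequence_cong:
  assumes "\<And>i. i \<le> d \<Longrightarrow> s' i = s i" "\<And>i j. i \<le> d \<Longrightarrow> j \<le> d \<Longrightarrow> B' i j = B i j"
  shows "split_sequence d s' B' = split_sequence d s B"
proof
  fix i
  show "split_sequence d s' B' i = split_sequence d s B i"
  proof (cases "1 \<le> i \<and> i \<le> d")
    case True
    have "newton s' m (s' h) = newton s m (s h)" if "m \<le> d" "h \<le> d" for m h
      unfolding newton_def using that assms(1) by (intro prod.cong) auto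
    moreover have "i - 1 \<le> d" using True by linarith
    ultimately show ?thesis using True assms(2)[of "i - 1" i] by (simp add: split_sequence_def)
  qed (auto simp: split_sequence_def)
qed

context leonard_data
begin

lemma reverse:
  "leonard_data d (\<lambda>h. th (d - h)) ths A (\<lambda>i j. B (d - i) (d - j)) (\<lambda>j h. P j (d - h)) (\<lambda>h j. Q (d - h) j)"
proof
  fix i j assume ij: "i \<le> d" "j \<le> d"
  show "(\<Sum>k\<le>d. P i (d - k) * Q (d - k) j) = (if i = j then 1 else 0)"
    using sum_reverse[of "\<lambda>k. P i k * Q k j" d] PQ[OF ij] by simp
  show "(\<Sum>k\<le>d. Q (d - i) k * P k (d - j)) = (if i = j then 1 else 0)"
    using QP[of "d - i" "d - j"] ij by auto
  show "(\<Sum>k\<le>d. P i (d - k) * B (d - k) (d - j)) = ths i * P i (d - j)"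
    using sum_reverse[of "\<lambda>k. P i k * B k (d - j)" d] PB[of i "d - j"] ij by simp
  show "(\<Sum>k\<le>d. B (d - i) (d - k) * Q (d - k) j) = Q (d - i) j * ths j"
    using sum_reverse[of "\<lambda>k. B (d - i) k * Q k j" d] BQ[of "d - i" j] ij by simp
qed (simp_all add: th ths A B inj_on_reverse irreducible_tridiagonal_reverse AP QA)

lemma reverse_split:
  "split_sequence d (\<lambda>h. th (d - h)) (leonard_data.B' (\<lambda>i j. B (d - i) (d - j)) (\<lambda>h j. Q (d - h) j)) = phi"
  "split_sequence d (\<lambda>h. th (d - (d - h)))
     (\<lambda>h k. leonard_data.B' (\<lambda>i j. B (d - i) (d - j)) (\<lambda>h j. Q (d - h) j) (d - h) (d - k)) = vphi"
proof -
  interpret R: leonard_data d "\<lambda>h. th (d - h)" ths A "\<lambda>i j. B (d - i) (d - j)" "\<lambda>j h. P j (d - h)" "\<lambda>h j. Q (d - h) j"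
    by (rule reverse)
  show "split_sequence d (\<lambda>h. th (d - h)) R.B' = phi"
    by (rule split_sequence_cong) (simp_all add: R.B'_def B'_def)
  show "split_sequence d (\<lambda>h. th (d - (d - h))) (\<lambda>h k. R.B' (d - h) (d - k)) = vphi"
    by (rule split_sequence_cong) (simp_all add: R.B'_def B'_def)
qed

end

text \<open>\<open>E i\<close> is nonzero and satisfies \<open>A * E i = t i * E i\<close>, so it
  determines \<open>t i\<close>; beyond \<open>d\<close> the encoding prescribes 0.\<close>

lemma eigenvalue_sequence_unique:
  assumes A: "A \<in> carrier_mat (Suc d) (Suc d)"
    and E: "eigenvalue_sequence d A E t" "eigenvalue_sequence d A E t'"
  shows "t = t'"
proof
  fix i
  show "t i = t' i"
  proof (cases "i \<le> d")
    case False
    thus ?thesis using E by (simp add: eigenvalue_sequence_def scalar_seq_def)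
  next
    case i: True
    have eig: "(\<Sum>k\<le>d. A $$ (a, k) * E i $$ (k, b)) = t i * E i $$ (a, b)"
      if D: "diagonalizes d A t P Q" and Et: "eigenvalue_sequence d A E t" and ab: "a \<le> d" "b \<le> d"
      for t P Q a b
    proof -
      note D' = diagonalizesD[OF D]
      have e: "E i $$ (a, b) = P $$ (a, i) * Q $$ (i, b)" if "a \<le> d" for a
        using unit_diag_index[OF that ab(2) i D'(2,3)] eigenvalue_sequence_idempotent[OF D Et i] by simp
      have "(\<Sum>k\<le>d. A $$ (a, k) * E i $$ (k, b)) = (\<Sum>k\<le>d. A $$ (a, k) * P $$ (k, i)) * Q $$ (i, b)"
        unfolding sum_distrib_right by (intro sum.cong) (auto simp: e mult.assoc)
      thus ?thesis using diagonalizes_delta(3)[OF D ab(1) i] e[OF ab(1)] by simp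
    qed
    obtain P Q where D: "diagonalizes d A t P Q" by (rule eigenvalue_sequence_diagonalizes[OF A E(1)])
    obtain P' Q' where D': "diagonalizes d A t' P' Q'" by (rule eigenvalue_sequence_diagonalizes[OF A E(2)])
    obtain a b where ab: "a \<le> d" "P $$ (a, i) \<noteq> 0" "b \<le> d" "Q $$ (i, b) \<noteq> 0"
      using diagonalizes_nonzero[OF D i] by blast
    have "E i $$ (a, b) \<noteq> 0"
      using unit_diag_index[OF ab(1,3) i diagonalizesD(2,3)[OF D]] eigenvalue_sequence_idempotent[OF D E(1) i] ab by simp
    thus ?thesis using eig[OF D E(1) ab(1,3)] eig[OF D' E(2) ab(1,3)] by simp
  qed
qed

lemma eigenvalue_sequence_permute:
  assumes A: "A \<in> carrier_mat (Suc d) (Suc d)" and E: "eigenvalue_sequence d A E t"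
    and s: "bij_betw \<sigma> {..d} {..d}" and t': "\<And>i. i \<le> d \<Longrightarrow> t' i = t (\<sigma> i)" "scalar_seq 0 d t'"
  shows "eigenvalue_sequence d A (\<lambda>i. E (\<sigma> i)) t'"
proof -
  obtain P Q where D: "diagonalizes d A t P Q" by (rule eigenvalue_sequence_diagonalizes[OF A E])
  let ?P = "mat (Suc d) (Suc d) (\<lambda>(j, i). P $$ (j, \<sigma> i))" and ?Q = "mat (Suc d) (Suc d) (\<lambda>(i, j). Q $$ (\<sigma> i, j))"
  have D': "diagonalizes d A t' ?P ?Q" by (rule diagonalizes_permute(1)[OF D s t'(1)])
  have "E (\<sigma> i) = primitive_idempotent d A t' i" if i: "i \<le> d" for i
  proof -
    have si: "\<sigma> i \<le> d" using s i by (auto simp: bij_betw_def)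
    have c: "P * unit_diag d (\<sigma> i) * Q \<in> carrier_mat (Suc d) (Suc d)" "?P * unit_diag d i * ?Q \<in> carrier_mat (Suc d) (Suc d)"
      unfolding unit_diag_def using diagonalizesD(2,3)[OF D] by (auto intro!: mult_carrier_mat[of _ "Suc d" "Suc d" _ "Suc d"])
    have "P * unit_diag d (\<sigma> i) * Q = ?P * unit_diag d i * ?Q"
    proof (rule eq_matI_le[OF c])
      fix a b assume ab: "a \<le> d" "b \<le> d"
      show "(P * unit_diag d (\<sigma> i) * Q) $$ (a, b) = (?P * unit_diag d i * ?Q) $$ (a, b)"
        unfolding unit_diag_index[OF ab si diagonalizesD(2,3)[OF D]] unit_diag_index[OF ab i diagonalizesD(2,3)[OF D']]
        using ab i by simp
    qed
    thus ?thesis using primitive_idempotent_eq[OF D' i] eigenvalue_sequence_idempotent[OF D E si] by simp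
  qed
  moreover have "bij_betw t' {0..d} {t. eigenvalue A t}"
    using diagonalizes_eigenvalues[OF D'] diagonalizesD(7)[OF D'] by (auto simp: bij_betw_def atLeast0AtMost)
  ultimately show ?thesis using t'(2) by (simp add: eigenvalue_sequence_def)
qed

lemma bij_betw_reverse: "bij_betw (\<lambda>i. d - i) {..d} {..d::nat}"
  by (rule bij_betw_byWitness[of _ "\<lambda>i. d - i"]) auto

lemma entries_given_by_iff:
  "entries_given_by d A As (th, ths, vphi, phi) \<longleftrightarrow>
    diag_entries d (\<lambda>i j. A $$ (i, j)) th ths vphi \<and> offdiag_entries d (\<lambda>i j. A $$ (i, j)) ths vphi phi \<and>
    (\<forall>i\<le>d. As $$ (i, i) = ths i)"
  by (simp add: entries_given_by.simps diag_entries_def offdiag_entries_def)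

text \<open>The diagonal determines the first split sequence, and the off-diagonal products then
  determine the second, as the first and the products of differences are nonzero.\<close>

lemma entries_unique:
  assumes p: "parameter_array d (th, ths, f, g)" "entries_given_by d A As (th, ths, f, g)"
    and q: "parameter_array d (th, ths, f', g')" "entries_given_by d A As (th, ths, f', g')"
  shows "f = f'" "g = g'"
proof -
  note P = parameter_arrayD[OF p(1)] and Q = parameter_arrayD[OF q(1)]
  have ths: "inj_on ths {..d}" by (rule inj_onI, metis P(8) atMost_iff)
  have f: "f i = f' i" if "i \<le> d" for i
  proof (rule diag_entries_unique[OF ths _ _ _ that])
    show "diag_entries d (\<lambda>i j. A $$ (i, j)) th ths f" "diag_entries d (\<lambda>i j. A $$ (i, j)) th ths f'"
      using p(2) q(2) unfolding entries_given_by_iff by auto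
    show "f 0 = f' 0" using P(3) Q(3) by (simp add: scalar_seq_def)
  qed
  show "f = f'"
  proof
    fix i show "f i = f' i" using f[of i] P(3) Q(3) by (cases "i \<le> d") (auto simp: scalar_seq_def)
  qed
  show "g = g'"
  proof
    fix i
    show "g i = g' i"
    proof (cases "i \<in> {1..d}")
      case False
      thus ?thesis using P(4) Q(4) by (auto simp: scalar_seq_def)
    next
      case True
      let ?a = "(\<Prod>h\<in>{0..<i-1}. ths (i-1) - ths h) / (\<Prod>h\<in>{0..i-1}. ths i - ths h)"
      let ?b = "(\<Prod>h\<in>{i+1..d}. ths i - ths h) / (\<Prod>h\<in>{i..d}. ths (i-1) - ths h)"
      have "f i * g i * ?a * ?b = A $$ (i, i - 1) * A $$ (i - 1, i)"
        using p(2) True unfolding entries_given_by_iff offdiag_entries_def by simp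
      also have "\<dots> = f i * g' i * ?a * ?b"
        using q(2) True f[of i] unfolding entries_given_by_iff offdiag_entries_def by simp
      finally have "f i * g i * ?a * ?b = f i * g' i * ?a * ?b" .
      moreover have "(\<Prod>h\<in>{0..<i-1}. ths (i-1) - ths h) \<noteq> 0" "(\<Prod>h\<in>{0..i-1}. ths i - ths h) \<noteq> 0"
        "(\<Prod>h\<in>{i+1..d}. ths i - ths h) \<noteq> 0" "(\<Prod>h\<in>{i..d}. ths (i-1) - ths h) \<noteq> 0"
        by (rule prod_diff_neq_0[OF ths]; use True in auto)+
      hence "?a \<noteq> 0" "?b \<noteq> 0" by simp_all
      moreover have "f i \<noteq> 0" using P(5)[of i] True by simp
      ultimately show ?thesis by (metis mult_cancel_left mult_cancel_right)
    qed
  qed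
qed

section \<open>Arrays, diagonalisations and systems for a given pair\<close>

locale tridiagonal_diagonal =
  fixes d :: nat and A :: "'a::field mat" and \<alpha> :: "nat \<Rightarrow> 'a"
  assumes A: "A \<in> carrier_mat (Suc d) (Suc d)"
    and tri: "i \<le> d \<Longrightarrow> j \<le> d \<Longrightarrow> \<bar>int i - int j\<bar> > 1 \<Longrightarrow> A $$ (i, j) = 0"
    and \<alpha>: "scalar_seq 0 d \<alpha>"
begin

abbreviation As :: "'a mat" where "As \<equiv> diagm d \<alpha>"
abbreviation fA :: "nat \<Rightarrow> nat \<Rightarrow> 'a" where "fA \<equiv> \<lambda>i j. A $$ (i, j)"
abbreviation fB :: "'a mat \<Rightarrow> 'a mat \<Rightarrow> nat \<Rightarrow> nat \<Rightarrow> 'a" where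
  "fB P Q \<equiv> \<lambda>i j. (Q * As * P) $$ (i, j)"
abbreviation vphi :: "(nat \<Rightarrow> 'a) \<Rightarrow> 'a mat \<Rightarrow> 'a mat \<Rightarrow> nat \<Rightarrow> 'a" where
  "vphi th P Q \<equiv> split_sequence d th (leonard_data.B' (fB P Q) (\<lambda>i j. Q $$ (i, j)))"
abbreviation phi :: "(nat \<Rightarrow> 'a) \<Rightarrow> 'a mat \<Rightarrow> 'a mat \<Rightarrow> nat \<Rightarrow> 'a" where
  "phi th P Q \<equiv> split_sequence d (\<lambda>h. th (d - h))
     (\<lambda>h k. leonard_data.B' (fB P Q) (\<lambda>i j. Q $$ (i, j)) (d - h) (d - k))"
abbreviation rv :: "(nat \<Rightarrow> 'a) \<Rightarrow> nat \<Rightarrow> 'a" where "rv th \<equiv> \<lambda>i. if i \<le> d then th (d - i) else 0"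

text \<open>The link between arrays and systems: a diagonalisation of \<open>A\<close> whose order
  of eigenvalues makes \<open>A*\<close> irreducible tridiagonal. Each direction of the theorem
  passes through it.\<close>

definition data :: "(nat \<Rightarrow> 'a) \<Rightarrow> 'a mat \<Rightarrow> 'a mat \<Rightarrow> bool" where
  "data th P Q \<longleftrightarrow> scalar_seq 0 d th \<and> diagonalizes d A th P Q \<and>
     leonard_data d th \<alpha> fA (fB P Q) (\<lambda>i j. P $$ (i, j)) (\<lambda>i j. Q $$ (i, j))"

definition R :: "'a array set" where
  "R = {p. parameter_array d p \<and> entries_given_by d A As p}"

lemma R_dual: "(th, ths, f, g) \<in> R \<Longrightarrow> ths = \<alpha>"
proof
  fix i assume "(th, ths, f, g) \<in> R"
  hence "scalar_seq 0 d ths" "\<forall>i\<le>d. As $$ (i, i) = ths i"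
    using parameter_arrayD(2)[of d th ths f g] unfolding R_def mem_Collect_eq entries_given_by_iff by auto
  thus "ths i = \<alpha> i" using \<alpha> by (cases "i \<le> d") (auto simp: scalar_seq_def diagm_def)
qed

lemma dataI:
  assumes "scalar_seq 0 d th" "diagonalizes d A th P Q" "inj_on \<alpha> {..d}"
    "irreducible_tridiagonal d fA" "irreducible_tridiagonal d (fB P Q)"
  shows "data th P Q"
  unfolding data_def
  using assms leonard_data_mat[OF A diagonalizesD(2-7)[OF assms(2)] assms(3-5)] by simp

lemma data_R: "data th P Q \<Longrightarrow> (th, \<alpha>, vphi th P Q, phi th P Q) \<in> R"
proof -
  assume d: "data th P Q"
  then interpret L: leonard_data d th \<alpha> fA "fB P Q" "\<lambda>i j. P $$ (i, j)" "\<lambda>i j. Q $$ (i, j)"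
    by (simp add: data_def)
  have "scalar_seq 0 d th" using d by (simp add: data_def)
  from L.parameter_array[OF this \<alpha>] L.diag L.offdiag
  show ?thesis unfolding R_def mem_Collect_eq entries_given_by_iff by (simp add: diagm_def)
qed

text \<open>The diagonalisation is built from the array; its own split sequences satisfy the same
  entry formulas, so by \<open>entries_unique\<close> they are the given ones.\<close>

lemma R_data:
  assumes "(th, ths, f, g) \<in> R"
  obtains P Q where "data th P Q" "f = vphi th P Q" "g = phi th P Q"
proof -
  have ths: "ths = \<alpha>" by (rule R_dual[OF assms])
  have p: "parameter_array d (th, \<alpha>, f, g)" "entries_given_by d A As (th, \<alpha>, f, g)"
    using assms ths by (auto simp: R_def)
  have inj: "inj_on th {..d}" "inj_on \<alpha> {..d}"
    by (rule inj_onI, metis parameter_arrayD(7)[OF p(1)] atMost_iff)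
       (rule inj_onI, metis parameter_arrayD(8)[OF p(1)] atMost_iff)
  obtain P Q where PQ: "P \<in> carrier_mat (Suc d) (Suc d)" "Q \<in> carrier_mat (Suc d) (Suc d)"
    "P * Q = 1\<^sub>m (Suc d)" "Q * P = 1\<^sub>m (Suc d)" "A * P = P * diagm d th"
    "irreducible_tridiagonal d fA" "irreducible_tridiagonal d (fB P Q)"
    using p(2) unfolding entries_given_by_iff
    by (elim conjE) (rule leonard_data_of_entries[OF A tri p(1)], auto)
  have data: "data th P Q"
    by (rule dataI) (use PQ inj A parameter_arrayD(1)[OF p(1)] in \<open>auto simp: diagonalizes_def\<close>)
  from data_R[OF this] have q: "parameter_array d (th, \<alpha>, vphi th P Q, phi th P Q)"
    "entries_given_by d A As (th, \<alpha>, vphi th P Q, phi th P Q)" by (auto simp: R_def)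
  show thesis using that[OF data entries_unique[OF p q]] .
qed

lemma data_system:
  assumes "data th P Q"
  shows "leonard_system d A As (primitive_idempotent d A th) (primitive_idempotent d As \<alpha>)"
    and "eigenvalue_sequence d A (primitive_idempotent d A th) th"
    and "eigenvalue_sequence d As (primitive_idempotent d As \<alpha>) \<alpha>"
proof -
  interpret L: leonard_data d th \<alpha> fA "fB P Q" "\<lambda>i j. P $$ (i, j)" "\<lambda>i j. Q $$ (i, j)"
    using assms by (simp add: data_def)
  have D: "diagonalizes d A th P Q" and th: "scalar_seq 0 d th" using assms by (auto simp: data_def)
  have Ds: "diagonalizes d As \<alpha> (1\<^sub>m (Suc d)) (1\<^sub>m (Suc d))" by (rule diagonalizes_diagm[OF L.ths])
  show E: "eigenvalue_sequence d A (primitive_idempotent d A th) th"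
    by (rule diagonalizes_eigenvalue_sequence[OF D th])
  show Es: "eigenvalue_sequence d As (primitive_idempotent d As \<alpha>) \<alpha>"
    by (rule diagonalizes_eigenvalue_sequence[OF Ds \<alpha>])
  have "1\<^sub>m (Suc d) * A * 1\<^sub>m (Suc d) = A" using A by simp
  thus "leonard_system d A As (primitive_idempotent d A th) (primitive_idempotent d As \<alpha>)"
    unfolding leonard_system_def idempotent_sequence_iff[OF D E diagm_carrier] idempotent_sequence_iff[OF Ds Es A]
    using diagonalizes_multiplicity_free[OF D] diagonalizes_multiplicity_free[OF Ds] L.A L.B by simp
qed

lemma system_data:
  assumes "leonard_system d A As E Es" "eigenvalue_sequence d A E th" "eigenvalue_sequence d As Es \<alpha>"
  obtains P Q where "data th P Q"
proof -
  obtain P Q where D: "diagonalizes d A th P Q" by (rule eigenvalue_sequence_diagonalizes[OF A assms(2)])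
  have inj: "inj_on \<alpha> {..d}"
    using assms(3) by (simp add: eigenvalue_sequence_def bij_betw_def atLeast0AtMost)
  have Ds: "diagonalizes d As \<alpha> (1\<^sub>m (Suc d)) (1\<^sub>m (Suc d))" by (rule diagonalizes_diagm[OF inj])
  have "1\<^sub>m (Suc d) * A * 1\<^sub>m (Suc d) = A" using A by simp
  hence "irreducible_tridiagonal d fA" "irreducible_tridiagonal d (fB P Q)"
    using assms(1) idempotent_sequence_iff[OF D assms(2) diagm_carrier] idempotent_sequence_iff[OF Ds assms(3) A]
    by (simp_all add: leonard_system_def)
  with D inj assms(2) show thesis
    by (intro that dataI) (auto simp: eigenvalue_sequence_def)
qed

lemma data_reverse:
  assumes "data th P Q"
  obtains P' Q' where "data (rv th) P' Q'" "vphi (rv th) P' Q' = phi th P Q" "phi (rv th) P' Q' = vphi th P Q"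
proof -
  interpret L: leonard_data d th \<alpha> fA "fB P Q" "\<lambda>i j. P $$ (i, j)" "\<lambda>i j. Q $$ (i, j)"
    using assms by (simp add: data_def)
  have D: "diagonalizes d A th P Q" using assms by (simp add: data_def)
  define P' where "P' = mat (Suc d) (Suc d) (\<lambda>(j, i). P $$ (j, d - i))"
  define Q' where "Q' = mat (Suc d) (Suc d) (\<lambda>(i, j). Q $$ (d - i, j))"
  have D': "diagonalizes d A (rv th) P' Q'"
    unfolding P'_def Q'_def by (rule diagonalizes_permute(1)[OF D bij_betw_reverse]) simp
  have B: "fB P' Q' i j = fB P Q (d - i) (d - j)" if "i \<le> d" "j \<le> d" for i j
    unfolding P'_def Q'_def by (rule diagonalizes_permute(2)[OF D bij_betw_reverse _ diagm_carrier that, of "rv th"]) simp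
  have "irreducible_tridiagonal d (fB P' Q')"
    using irreducible_tridiagonal_reverse[OF L.B] B by (simp add: irreducible_tridiagonal_def)
  hence data: "data (rv th) P' Q'"
    using D' L.ths L.A by (intro dataI) (auto simp: scalar_seq_def)
  have Bp: "leonard_data.B' (fB P' Q') (\<lambda>i j. Q' $$ (i, j)) i j =
      leonard_data.B' (\<lambda>i j. fB P Q (d - i) (d - j)) (\<lambda>h j. Q $$ (d - h, j)) i j" if ij: "i \<le> d" "j \<le> d" for i j
  proof -
    interpret R1: leonard_data d "rv th" \<alpha> fA "fB P' Q'" "\<lambda>i j. P' $$ (i, j)" "\<lambda>i j. Q' $$ (i, j)"
      using data by (simp add: data_def)
    interpret R2: leonard_data d "\<lambda>h. th (d - h)" \<alpha> fA "\<lambda>i j. fB P Q (d - i) (d - j)" "\<lambda>j h. P $$ (j, d - h)" "\<lambda>h j. Q $$ (d - h, j)"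
      by (rule L.reverse)
    show ?thesis unfolding R1.B'_def R2.B'_def using ij B by (simp add: Q'_def)
  qed
  have "vphi (rv th) P' Q' = phi th P Q"
    unfolding L.reverse_split(1)[symmetric] by (rule split_sequence_cong) (simp_all add: Bp)
  moreover have "phi (rv th) P' Q' = vphi th P Q"
    unfolding L.reverse_split(2)[symmetric] by (rule split_sequence_cong) (simp_all add: Bp)
  ultimately show thesis using data by (intro that)
qed

text \<open>The second split sequence is by definition a first one for the reversed idempotents, and
  is found by applying the same result to the reversed diagonalisation.\<close>

lemma array_of_system:
  assumes data: "data th P Q" and E: "eigenvalue_sequence d A E th" and Es: "eigenvalue_sequence d As Es \<alpha>"
  shows "parameter_array_of_system d A As E Es (th, \<alpha>, f, g) \<longleftrightarrow> f = vphi th P Q \<and> g = phi th P Q"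
proof -
  have uE: "t = t'" if "eigenvalue_sequence d A E t" "eigenvalue_sequence d A E t'" for E t t'
    by (rule eigenvalue_sequence_unique[OF A that])
  have uEs: "t = \<alpha>" if "eigenvalue_sequence d As Es t" for t
    by (rule eigenvalue_sequence_unique[OF diagm_carrier that Es])
  have first: "first_split_sequence d A As E Es f \<longleftrightarrow> f = vphi th P Q"
    if "data th P Q" "eigenvalue_sequence d A E th" for th P Q E f
    using that by (intro first_split_sequence_iff[of _ _ _ _ _ _ _ E]) (auto simp: data_def Es uEs intro: uE)
  obtain P' Q' where r: "data (rv th) P' Q'" "vphi (rv th) P' Q' = phi th P Q" by (rule data_reverse[OF data])
  have "eigenvalue_sequence d A (\<lambda>i. E (d - i)) (rv th)"
    by (rule eigenvalue_sequence_permute[OF A E bij_betw_reverse]) (auto simp: scalar_seq_def)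
  from first[OF r(1) this] have "second_split_sequence d A As E Es g \<longleftrightarrow> g = phi th P Q"
    unfolding second_split_sequence_def r(2) .
  thus ?thesis using first[OF data E] E Es by simp
qed

lemma R_iff_pair: "(th, ths, f, g) \<in> R \<longleftrightarrow>
    parameter_array_of_pair d A As (th, ths, f, g) \<and> (\<forall>i\<le>d. ths i = As $$ (i, i))"
proof
  assume p: "(th, ths, f, g) \<in> R"
  obtain P Q where d: "data th P Q" "f = vphi th P Q" "g = phi th P Q" by (rule R_data[OF p])
  have "parameter_array_of_pair d A As (th, ths, f, g)"
    unfolding parameter_array_of_pair_def R_dual[OF p]
    using data_system[OF d(1)] array_of_system[OF d(1) data_system(2,3)[OF d(1)]] d(2,3) by blast
  thus "parameter_array_of_pair d A As (th, ths, f, g) \<and> (\<forall>i\<le>d. ths i = As $$ (i, i))"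
    using R_dual[OF p] by (simp add: diagm_def)
next
  assume p: "parameter_array_of_pair d A As (th, ths, f, g) \<and> (\<forall>i\<le>d. ths i = As $$ (i, i))"
  then obtain E Es where E: "leonard_system d A As E Es" "parameter_array_of_system d A As E Es (th, ths, f, g)"
    unfolding parameter_array_of_pair_def by blast
  have Eth: "eigenvalue_sequence d A E th" "eigenvalue_sequence d As Es ths" using E(2) by auto
  have "ths i = \<alpha> i" for i
    using p \<alpha> Eth(2) by (cases "i \<le> d") (auto simp: eigenvalue_sequence_def scalar_seq_def diagm_def)
  hence ths: "ths = \<alpha>" ..
  obtain P Q where d: "data th P Q" by (rule system_data[OF E(1) Eth(1) Eth(2)[unfolded ths]])
  have "f = vphi th P Q \<and> g = phi th P Q"
    using array_of_system[OF d Eth(1) Eth(2)[unfolded ths]] E(2) unfolding ths by blast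
  thus "(th, ths, f, g) \<in> R" using data_R[OF d] ths by simp
qed

lemma R_down: "p \<in> R \<Longrightarrow> down_array d p \<in> R"
proof -
  assume p: "p \<in> R"
  obtain th ths f g where p': "p = (th, ths, f, g)" by (cases p)
  obtain P Q where d: "data th P Q" "f = vphi th P Q" "g = phi th P Q" by (rule R_data[OF p[unfolded p']])
  obtain P' Q' where "data (rv th) P' Q'" "vphi (rv th) P' Q' = phi th P Q" "phi (rv th) P' Q' = vphi th P Q"
    by (rule data_reverse[OF d(1)])
  thus ?thesis using data_R[of "rv th" P' Q'] d(2,3) R_dual[OF p[unfolded p']] by (simp add: p')
qed

text \<open>Both arrays list the eigenvalues of \<open>A\<close>, so they differ by a permutation,
  which keeps \<open>A*\<close> irreducible tridiagonal and is therefore the identity or the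
  reversal. Eigenvalues and dual eigenvalues determine the rest by
  \<open>entries_unique\<close>.\<close>

lemma R_pair:
  assumes p: "p \<in> R" and q: "q \<in> R"
  shows "q = p \<or> q = down_array d p"
proof -
  obtain th ths f g where p': "p = (th, ths, f, g)" by (cases p)
  obtain t ts f' g' where q': "q = (t, ts, f', g')" by (cases q)
  have duals: "ths = \<alpha>" "ts = \<alpha>" using R_dual p q unfolding p' q' by blast+
  obtain P Q where dp: "data th P Q" by (rule R_data[OF p[unfolded p']])
  obtain P' Q' where dq: "data t P' Q'" by (rule R_data[OF q[unfolded q']])
  note Dp = dp[unfolded data_def] and Dq = dq[unfolded data_def]
  interpret Lp: leonard_data d th \<alpha> fA "fB P Q" "\<lambda>i j. P $$ (i, j)" "\<lambda>i j. Q $$ (i, j)" using Dp by simp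
  interpret Lq: leonard_data d t \<alpha> fA "fB P' Q'" "\<lambda>i j. P' $$ (i, j)" "\<lambda>i j. Q' $$ (i, j)" using Dq by simp
  have im: "t ` {..d} = th ` {..d}"
    using diagonalizes_eigenvalues[of d A th P Q] diagonalizes_eigenvalues[of d A t P' Q'] Dp Dq by simp
  obtain \<sigma> where s: "bij_betw \<sigma> {..d} {..d}" "\<And>i. i \<le> d \<Longrightarrow> t i = th (\<sigma> i)"
    using enumerations_permute[OF Lp.th Lq.th im] by blast
  let ?P = "mat (Suc d) (Suc d) (\<lambda>(j, i). P $$ (j, \<sigma> i))" and ?Q = "mat (Suc d) (Suc d) (\<lambda>(i, j). Q $$ (\<sigma> i, j))"
  have "diagonalizes d A th P Q" using Dp by simp
  note perm = diagonalizes_permute[OF this s]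
  have Et: "eigenvalue_sequence d A (primitive_idempotent d A t) t" by (rule data_system(2)[OF dq])
  have "idempotent_sequence d A As (primitive_idempotent d A t)"
    using data_system(1)[OF dq] by (simp add: leonard_system_def)
  hence "irreducible_tridiagonal d (fB ?P ?Q)"
    using idempotent_sequence_iff[OF perm(1) Et diagm_carrier] by blast
  hence "irreducible_tridiagonal d (\<lambda>i j. fB P Q (\<sigma> i) (\<sigma> j))"
    by (rule irreducible_tridiagonal_cong) (assumption | rule perm(2)[OF _ diagm_carrier])+
  hence "(\<forall>i\<le>d. \<sigma> i = i) \<or> (\<forall>i\<le>d. \<sigma> i = d - i)"
    using irreducible_tridiagonal_permuted(1)[of d "fB P Q" \<sigma>] irreducible_tridiagonalD(1)[OF Lp.B] s(1) by blast
  thus ?thesis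
  proof
    assume id: "\<forall>i\<le>d. \<sigma> i = i"
    have "t i = th i" for i
      using id s(2) Dp Dq by (cases "i \<le> d") (auto simp: scalar_seq_def)
    hence "t = th" ..
    with entries_unique[of d th \<alpha> f g A As f' g'] p q duals show ?thesis by (simp add: R_def p' q')
  next
    assume r: "\<forall>i\<le>d. \<sigma> i = d - i"
    have "t i = rv th i" for i
      using r s(2) Dq by (cases "i \<le> d") (auto simp: scalar_seq_def)
    hence "t = rv th" ..
    with entries_unique[of d "rv th" \<alpha> g f A As f' g'] R_down[OF p] q duals show ?thesis
      by (simp add: R_def p' q')
  qed
qed

text \<open>The dual idempotent sequence may list the diagonal of \<open>A*\<close> in another
  order. Since \<open>A\<close> is tridiagonal in the given order and irreducible in the other, the
  two orders agree up to reversal and \<open>A\<close> is irreducible as it stands.\<close>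

lemma leonard_pair_data:
  assumes "leonard_pair d A As"
  obtains th P Q where "data th P Q"
proof -
  obtain E Es th t where E: "idempotent_sequence d A As E" "eigenvalue_sequence d A E th"
    and Es: "idempotent_sequence d As A Es" "eigenvalue_sequence d As Es t"
    using assms unfolding leonard_pair_def idempotent_sequence_def by blast
  have mf: "card (\<alpha> ` {..d}) = d + 1"
    using assms by (simp add: leonard_pair_def multiplicity_free_def eigenvalue_diagm)
  hence inj: "inj_on \<alpha> {..d}" by (intro eq_card_imp_inj_on) auto
  have t: "inj_on t {..d}" "t ` {..d} = \<alpha> ` {..d}"
    using Es(2) by (auto simp: eigenvalue_sequence_def bij_betw_def eigenvalue_diagm atLeast0AtMost)
  obtain \<sigma> where s: "bij_betw \<sigma> {..d} {..d}" "\<And>i. i \<le> d \<Longrightarrow> t i = \<alpha> (\<sigma> i)"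
    using enumerations_permute[OF inj t] by blast
  have Ds: "diagonalizes d As \<alpha> (1\<^sub>m (Suc d)) (1\<^sub>m (Suc d))" by (rule diagonalizes_diagm[OF inj])
  note perm = diagonalizes_permute[OF Ds s]
  have one: "1\<^sub>m (Suc d) * A * 1\<^sub>m (Suc d) = A" using A by simp
  have "irreducible_tridiagonal d (\<lambda>i j. fA (\<sigma> i) (\<sigma> j))"
    by (rule irreducible_tridiagonal_cong[OF iffD1[OF idempotent_sequence_iff[OF perm(1) Es(2) A] Es(1)]])
       (assumption | rule perm(2)[OF _ A, unfolded one])+
  hence irr: "irreducible_tridiagonal d fA"
    using irreducible_tridiagonal_permuted(2)[of d fA \<sigma>] tri s(1) by blast
  obtain P Q where D: "diagonalizes d A th P Q" by (rule eigenvalue_sequence_diagonalizes[OF A E(2)])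
  have "irreducible_tridiagonal d (fB P Q)"
    using E(1) idempotent_sequence_iff[OF D E(2) diagm_carrier] by simp
  with D inj irr E(2) show thesis by (intro that dataI) (auto simp: eigenvalue_sequence_def)
qed

lemma leonard_pair_iff: "leonard_pair d A As \<longleftrightarrow> R \<noteq> {}"
proof
  assume "leonard_pair d A As"
  then obtain th P Q where "data th P Q" by (rule leonard_pair_data)
  thus "R \<noteq> {}" using data_R by blast
next
  assume "R \<noteq> {}"
  then obtain th ths f g where "(th, ths, f, g) \<in> R" by auto
  then obtain P Q where "data th P Q" by (rule R_data)
  thus "leonard_pair d A As"
    using data_system(1) unfolding leonard_system_def leonard_pair_def by blast
qed

end

theorem theorem25p1:
  fixes d :: nat and A As :: "'a::field mat" and R :: "'a array set"
  assumes "A \<in> carrier_mat (d+1) (d+1)" and "As \<in> carrier_mat (d+1) (d+1)"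
    and "tridiagonal_mat A" and "diagonal_mat As"
    and "R = {p. parameter_array d p \<and> entries_given_by d A As p}"
  shows "(leonard_pair d A As \<longleftrightarrow>
            (\<exists>p. parameter_array d p \<and> entries_given_by d A As p)) \<and>
         (leonard_pair d A As \<longrightarrow>
            R = {(th, ths, vphi, phi).
                   parameter_array_of_pair d A As (th, ths, vphi, phi) \<and>
                   (\<forall>i\<le>d. ths i = As $$ (i,i))} \<and>
            (\<forall>p\<in>R. down_array d p \<in> R \<and> R = {p, down_array d p}))"
proof -
  define \<alpha> where "\<alpha> i = (if i \<le> d then As $$ (i, i) else 0)" for i
  have As: "As = diagm d \<alpha>"
    using assms(2,4) by (intro eq_matI_le[of _ d]) (auto simp: diagm_def \<alpha>_def diagonal_mat_def)
  interpret T: tridiagonal_diagonal d A \<alpha>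
  proof
    show "A $$ (i, j) = 0" if "i \<le> d" "j \<le> d" "\<bar>int i - int j\<bar> > 1" for i j
      using assms(1,3) that by (simp add: tridiagonal_mat_def)
  qed (use assms(1) in \<open>auto simp: \<alpha>_def scalar_seq_def\<close>)
  have R: "R = T.R" unfolding assms(5) T.R_def As ..
  show ?thesis
  proof (intro conjI impI ballI)
    show "leonard_pair d A As \<longleftrightarrow> (\<exists>p. parameter_array d p \<and> entries_given_by d A As p)"
      unfolding As T.leonard_pair_iff T.R_def ex_in_conv[symmetric] mem_Collect_eq ..
    show "R = {(th, ths, vphi, phi). parameter_array_of_pair d A As (th, ths, vphi, phi) \<and>
        (\<forall>i\<le>d. ths i = As $$ (i,i))}"
      unfolding R As
    proof (rule Set.set_eqI)
      fix p :: "'a array"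
      obtain th ths f g where p: "p = (th, ths, f, g)" by (cases p)
      show "p \<in> T.R \<longleftrightarrow> p \<in> {(th, ths, vphi, phi).
          parameter_array_of_pair d A (diagm d \<alpha>) (th, ths, vphi, phi) \<and>
          (\<forall>i\<le>d. ths i = diagm d \<alpha> $$ (i,i))}"
        unfolding p T.R_iff_pair mem_Collect_eq prod.case ..
    qed
  next
    fix p assume p: "p \<in> R"
    show down: "down_array d p \<in> R" using T.R_down p unfolding R by blast
    show "R = {p, down_array d p}"
    proof
      show "R \<subseteq> {p, down_array d p}" using T.R_pair p unfolding R by blast
      show "{p, down_array d p} \<subseteq> R" using p down by simp
    qed
  qed
qed

end
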